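(* Let $1\le r\le n$ be integers. The graded Frobenius series $\mathrm{grFrob}(A(U_{r,n})_{\mathbb{C}},t)$ of the Chow ring of the uniform matroid $U_{r,n}$ has two expressions: (i) $$\sum_{j=0}^{r-1}h_{n-j}\,Q_j^0(\mathbf x,t)\,(1+t+\cdots+t^{r-j-1}),$$ (ii) $$Q_n(\mathbf x,t)-\sum_{j=r}^{n-1}\ \sum_{\substack{\sigma\in\mathfrak S_n\\ \mathrm{fix}(\sigma)\ge n-j}}F_{\mathrm{DEX}(\sigma),n}(\mathbf x)\,t^{\,j-\mathrm{exc}(\sigma)}.$$
   Context: The uniform matroid $U_{r,n}$ is the matroid on $[n]=\{1,\dots,n\}$ with flats $\{S\subseteq[n]:|S|\le r-1\}\cup\{[n]\}$. For a loopless matroid $M$ on $E$ with lattice of flats $\mathcal L(M)$, the Chow ring is the graded $\mathbb{Q}$-algebra (all variables in degree 1) $A(M)=\mathbb{Q}[x_F:F\in\mathcal L(M)\setminus\{\emptyset\}]/(I+J)$, where $I$ is generated by $x_Fx_{F'}$ for incomparable $F,F'$, and $J$ by $\sum_{F:\,i\in F}x_F$ for $i\in E$. Put $A(M)_{\mathbb C}=\mathbb C\otimes_{\mathbb Q}A(M)$. $\mathfrak S_n$ acts on $A(U_{r,n})_{\mathbb C}$ by $\sigma x_F=x_{\sigma(F)}$. For a graded $\mathbb C[\mathfrak S_n]$-module $V=\bigoplus_iV^i$, $\mathrm{grFrob}(V,t)=\sum_i\mathrm{ch}(V^i)t^i$, where $\mathrm{ch}$ is the Frobenius characteristic (irreducible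 $\chi^\lambda\mapsto$ Schur function $s_\lambda$, trivial character $\mapsto h_n$). $h_n$ is the complete homogeneous symmetric function in $\mathbf x=(x_1,x_2,\dots)$, $h_0=1$. For $\sigma=\sigma_1\cdots\sigma_n\in\mathfrak S_n$: $\mathrm{EXC}(\sigma)=\{i\in[n-1]:\sigma_i>i\}$, $\mathrm{exc}(\sigma)=|\mathrm{EXC}(\sigma)|$, $\mathrm{fix}(\sigma)$ is the number of fixed points. Let $\overline\sigma$ be the word over $\{\overline1<\cdots<\overline n<1<\cdots<n\}$ obtained from $\sigma$ by replacing $\sigma_i$ by $\overline{\sigma_i}$ for each $i\in\mathrm{EXC}(\sigma)$; $\mathrm{DEX}(\sigma)=\{i\in[n-1]:\overline\sigma_i>\overline\sigma_{i+1}\}$. For $S\subseteq[n-1]$, $F_{S,n}(\mathbf x)=\sum x_{i_1}\cdots x_{i_n}$ over $i_1\ge\cdots\ge i_n\geq 1$ with $i_j>i_{j+1}$ for $j\in S$. With $D_n$ the set of derangements in $\mathfrak S_n$, $$Q_n(\mathbf x,t)=\sum_{\sigma\in\mathfrak S_n}F_{\mathrm{DEX}(\sigma),n}t^{\mathrm{exc}(\sigma)},\qquad Q_n^0(\mathbf x,t)=\sum_{\sigma\in D_n}F_{\mathrm{DEX}(\sigma),n}t^{\mathrm{exc}(\sigma)}\quad(n\ge1),$$ and $Q_0=Q_0^0=1$. *)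

theory Defs
  imports
    Complex_Main
    "HOL-Library.Poly_Mapping"
    "HOL-Computational_Algebra.Formal_Power_Series"
    "HOL-Combinatorics.Permutations"
    "HOL-Combinatorics.Orbits"
    "HOL-Algebra.QuotRing"
    "HOL-Algebra.Module"
begin

section \<open>Formal power series in countably many variables\<close>

text \<open>
  A series is given by its coefficients on monomials; a monomial is an exponent vector of type
  \<^typ>\<open>nat \<Rightarrow>\<^sub>0 nat\<close>. The index \<open>k :: nat\<close> stands for the variable
  usually written $x_{k+1}$, so that all the variables $x_1, x_2, \dots$ are present and no others.
\<close>

typedef 'a mseries = "UNIV :: ((nat \<Rightarrow>\<^sub>0 nat) \<Rightarrow> 'a) set"
  morphisms mcoeff Mseries
  by simp

lemma mcoeff_Mseries [simp]: "mcoeff (Mseries f) = f"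
  by (simp add: Mseries_inverse)

lemma mseries_eqI: "(\<And>m. mcoeff f m = mcoeff g m) \<Longrightarrow> f = g"
  by (metis ext mcoeff_inverse)

definition splittings :: "('v \<Rightarrow>\<^sub>0 nat) \<Rightarrow> (('v \<Rightarrow>\<^sub>0 nat) \<times> ('v \<Rightarrow>\<^sub>0 nat)) set" where
  "splittings m = {(a, b). a + b = m}"

lemma finite_splittings [simp]: "finite (splittings m)"
proof -
  let ?K = "Poly_Mapping.keys m" and ?l = "Poly_Mapping.lookup :: ('a \<Rightarrow>\<^sub>0 nat) \<Rightarrow> _"
  let ?P = "PiE ?K (\<lambda>i. {..?l m i})"
  have "finite ?P" by (intro finite_PiE) auto
  moreover have "inj_on (\<lambda>(a, b). restrict (?l a) ?K) (splittings m)"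
  proof (rule inj_onI)
    fix x y assume x: "x \<in> splittings m" and y: "y \<in> splittings m"
      and r': "(\<lambda>(a, b). restrict (?l a) ?K) x = (\<lambda>(a, b). restrict (?l a) ?K) y"
    obtain a b where ab: "x = (a, b)" by (cases x)
    obtain c d where cd: "y = (c, d)" by (cases y)
    have eq: "a + b = m" "c + d = m" and r: "restrict (?l a) ?K = restrict (?l c) ?K"
      using x y r' by (simp_all add: ab cd splittings_def)
    have "?l a i = ?l c i" for i
    proof (cases "i \<in> ?K")
      case True
      then show ?thesis using r by (metis restrict_apply')
    next
      case False
      then have "?l (a + b) i = 0" "?l (c + d) i = 0" by (simp_all add: in_keys_iff eq)
      then show ?thesis by (simp add: lookup_add)
    qed
    then have "a = c" by (intro poly_mapping_eqI)
    with eq show "x = y" by (auto simp: ab cd)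
  qed
  moreover have "(\<lambda>(a, b). restrict (?l a) ?K) ` splittings m \<subseteq> ?P"
    by (auto simp: splittings_def lookup_add)
  ultimately show ?thesis using inj_on_finite by blast
qed

instantiation mseries :: (comm_ring_1) comm_ring_1
begin

definition "0 = Mseries (\<lambda>m. 0)"
definition "1 = Mseries (\<lambda>m. if m = 0 then 1 else 0)"
definition "f + g = Mseries (\<lambda>m. mcoeff f m + mcoeff g m)"
definition "f - g = Mseries (\<lambda>m. mcoeff f m - mcoeff g m)"
definition "- f = Mseries (\<lambda>m. - mcoeff f m)"
definition "f * g = Mseries (\<lambda>m. \<Sum>(a, b)\<in>splittings m. mcoeff f a * mcoeff g b)"

instance
proof
  fix f g h :: "'a mseries"
  note defs = zero_mseries_def one_mseries_def plus_mseries_def minus_mseries_def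
    uminus_mseries_def times_mseries_def
  show "f + g + h = f + (g + h)" "f + g = g + f" "0 + f = f" "- f + f = 0" "f - g = f + - g"
    by (auto intro!: mseries_eqI simp: defs algebra_simps)
  show "(0::'a mseries) \<noteq> 1"
  proof
    assume "(0::'a mseries) = 1"
    then have "mcoeff (0::'a mseries) 0 = mcoeff 1 0" by simp
    then show False by (simp add: defs)
  qed
  show "(f + g) * h = f * h + g * h"
    by (auto intro!: mseries_eqI simp: defs algebra_simps sum.distrib case_prod_unfold)
  show "f * g = g * f"
  proof (rule mseries_eqI)
    fix m
    show "mcoeff (f * g) m = mcoeff (g * f) m"
      unfolding times_mseries_def mcoeff_Mseries
      by (rule sum.reindex_bij_witness[where i = prod.swap and j = prod.swap])
        (auto simp: splittings_def ac_simps)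
  qed
  show "1 * f = f"
  proof (rule mseries_eqI)
    fix m
    have "mcoeff (1 * f) m = (\<Sum>(a, b)\<in>splittings m. if a = 0 then mcoeff f b else 0)"
      by (auto simp: defs intro!: sum.cong)
    also have "\<dots> = (\<Sum>(a, b)\<in>{(0 :: nat \<Rightarrow>\<^sub>0 nat, m)}. if a = 0 then mcoeff f b else 0)"
      by (rule sum.mono_neutral_right[OF finite_splittings])
        (auto simp: splittings_def split: if_splits)
    finally show "mcoeff (1 * f) m = mcoeff f m" by simp
  qed
  show "f * g * h = f * (g * h)"
  proof (rule mseries_eqI)
    fix m
    let ?t = "\<lambda>a b c. mcoeff f a * mcoeff g b * mcoeff h c"
    have "mcoeff (f * g * h) m = (\<Sum>x\<in>splittings m. \<Sum>y\<in>splittings (fst x).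
        ?t (fst y) (snd y) (snd x))"
      by (simp add: times_mseries_def case_prod_unfold sum_distrib_right)
    also have "\<dots> = (\<Sum>(x, y)\<in>(SIGMA x:splittings m. splittings (fst x)).
        ?t (fst y) (snd y) (snd x))"
      by (simp add: sum.Sigma)
    also have "\<dots> = (\<Sum>(x, y)\<in>(SIGMA x:splittings m. splittings (snd x)).
        ?t (fst x) (fst y) (snd y))"
      by (rule sum.reindex_bij_witness[
            where i = "\<lambda>((a, s), (b, c)). ((a + b, c), (a, b))"
              and j = "\<lambda>((s, c), (a, b)). ((a, b + c), (b, c))"])
        (auto simp: splittings_def ac_simps)
    also have "\<dots> = (\<Sum>x\<in>splittings m. \<Sum>y\<in>splittings (snd x).
        ?t (fst x) (fst y) (snd y))"
      by (simp add: sum.Sigma)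
    also have "\<dots> = mcoeff (f * (g * h)) m"
      by (simp add: times_mseries_def case_prod_unfold sum_distrib_left mult.assoc)
    finally show "mcoeff (f * g * h) m = mcoeff (f * (g * h)) m" .
  qed
qed

end

definition mconst :: "'a \<Rightarrow> 'a::zero mseries" where
  "mconst c = Mseries (\<lambda>m. if m = 0 then c else 0)"


section \<open>Symmetric and quasisymmetric functions\<close>

definition complete_homogeneous :: "nat \<Rightarrow> complex mseries" where
  "complete_homogeneous n =
     Mseries (\<lambda>m. if (\<Sum>i\<in>Poly_Mapping.keys m. Poly_Mapping.lookup m i) = n then 1 else 0)"

text \<open>This is $\sum_i x_i^k$ for \<open>k \<ge> 1\<close>, the only case used.\<close>

definition power_sum :: "nat \<Rightarrow> complex mseries" where
  "power_sum k = Mseries (\<lambda>m. if \<exists>i. m = Poly_Mapping.single i k then 1 else 0)"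

text \<open>
  The sum of the monomials $x_{i_1} \cdots x_{i_n}$ over the index sequences in the set below.
  Positions in a sequence are numbered from 1, so that $i_j$ is \<open>is ! (j - 1)\<close>.
\<close>

definition fundamental_seqs :: "nat set \<Rightarrow> nat \<Rightarrow> nat list set" where
  "fundamental_seqs S n =
     {is. length is = n \<and> (\<forall>j\<in>{1..<n}. is ! (j - 1) \<ge> is ! j) \<and> (\<forall>j\<in>S. is ! (j - 1) > is ! j)}"

definition fundamental_qsym :: "nat set \<Rightarrow> nat \<Rightarrow> complex mseries" where
  "fundamental_qsym S n =
     Mseries (\<lambda>m. of_nat (card {is \<in> fundamental_seqs S n.
       (\<Sum>i\<leftarrow>is. Poly_Mapping.single i 1) = m}))"


section \<open>Permutation statistics\<close>

definition EXC :: "nat \<Rightarrow> (nat \<Rightarrow> nat) \<Rightarrow> nat set" where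
  "EXC n \<sigma> = {i \<in> {1..<n}. \<sigma> i > i}"

definition exc_number :: "nat \<Rightarrow> (nat \<Rightarrow> nat) \<Rightarrow> nat" where
  "exc_number n \<sigma> = card (EXC n \<sigma>)"

definition fix_number :: "nat \<Rightarrow> (nat \<Rightarrow> nat) \<Rightarrow> nat" where
  "fix_number n \<sigma> = card {i \<in> {1..n}. \<sigma> i = i}"

datatype letter = Barred nat | Plain nat

fun letter_less :: "letter \<Rightarrow> letter \<Rightarrow> bool" where
  "letter_less (Barred a) (Barred b) \<longleftrightarrow> a < b"
| "letter_less (Barred a) (Plain b) \<longleftrightarrow> True"
| "letter_less (Plain a) (Barred b) \<longleftrightarrow> False"
| "letter_less (Plain a) (Plain b) \<longleftrightarrow> a < b"

definition barred_word :: "nat \<Rightarrow> (nat \<Rightarrow> nat) \<Rightarrow> nat \<Rightarrow> letter" where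
  "barred_word n \<sigma> i = (if i \<in> EXC n \<sigma> then Barred (\<sigma> i) else Plain (\<sigma> i))"

definition DEX :: "nat \<Rightarrow> (nat \<Rightarrow> nat) \<Rightarrow> nat set" where
  "DEX n \<sigma> = {i \<in> {1..<n}. letter_less (barred_word n \<sigma> (i + 1)) (barred_word n \<sigma> i)}"


section \<open>Eulerian quasisymmetric functions\<close>

text \<open>
  The variable $t$ is \<^const>\<open>fps_X\<close>: series in $\mathbf x$ and $t$ are formal power series in $t$
  with coefficients in \<^typ>\<open>complex mseries\<close>.
\<close>

definition Q_eulerian :: "nat \<Rightarrow> complex mseries fps" where
  "Q_eulerian n = (\<Sum>\<sigma> | \<sigma> permutes {1..n}.
     fps_const (fundamental_qsym (DEX n \<sigma>) n) * fps_X ^ exc_number n \<sigma>)"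

definition Q0_eulerian :: "nat \<Rightarrow> complex mseries fps" where
  "Q0_eulerian n = (\<Sum>\<sigma> | \<sigma> permutes {1..n} \<and> (\<forall>i\<in>{1..n}. \<sigma> i \<noteq> i).
     fps_const (fundamental_qsym (DEX n \<sigma>) n) * fps_X ^ exc_number n \<sigma>)"

text \<open>For \<open>n = 0\<close> the definitions give the conventional value.\<close>

lemma fundamental_qsym_0: "fundamental_qsym {} 0 = 1"
  by (rule mseries_eqI)
    (auto simp: fundamental_qsym_def fundamental_seqs_def one_mseries_def card_eq_0_iff
      cong: conj_cong)

lemma Q_eulerian_0: "Q_eulerian 0 = 1" and Q0_eulerian_0: "Q0_eulerian 0 = 1"
  by (simp_all add: Q_eulerian_def Q0_eulerian_def DEX_def EXC_def exc_number_def
      fundamental_qsym_0)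


section \<open>Matroids given by their flats, and Chow rings\<close>

locale loopless_matroid =
  fixes E :: "'e set" and L :: "'e set set"
  assumes finite_ground: "finite E"
    and flats_subset: "F \<in> L \<Longrightarrow> F \<subseteq> E"
    and ground_flat: "E \<in> L"
    and inter_flat: "\<lbrakk>F \<in> L; G \<in> L\<rbrakk> \<Longrightarrow> F \<inter> G \<in> L"
    and cover_partition: "\<lbrakk>F \<in> L; x \<in> E - F\<rbrakk> \<Longrightarrow>
          \<exists>!G. G \<in> L \<and> x \<in> G \<and> F \<subset> G \<and> \<not> (\<exists>H\<in>L. F \<subset> H \<and> H \<subset> G)"
    and loopless: "{} \<in> L"

definition uniform_flats :: "nat \<Rightarrow> nat \<Rightarrow> nat set set" where
  "uniform_flats r n = {S. S \<subseteq> {1..n} \<and> card S \<le> r - 1} \<union> {{1..n}}"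

lemma uniform_loopless_matroid:
  assumes "1 \<le> r" "r \<le> n"
  shows "loopless_matroid {1..n} (uniform_flats r n)"
proof
  show "finite {1..n}" "{1..n} \<in> uniform_flats r n" "{} \<in> uniform_flats r n"
    by (auto simp: uniform_flats_def)
  show "F \<subseteq> {1..n}" if "F \<in> uniform_flats r n" for F
    using that by (auto simp: uniform_flats_def)
  show "F \<inter> G \<in> uniform_flats r n" if "F \<in> uniform_flats r n" "G \<in> uniform_flats r n" for F G
  proof (cases "F = {1..n} \<or> G = {1..n}")
    case True
    then have "F \<inter> G = F \<or> F \<inter> G = G"
      using that by (auto simp: uniform_flats_def)
    then show ?thesis using that by metis
  next
    case False
    then have F: "F \<subseteq> {1..n}" "card F \<le> r - 1"
      using that by (simp_all add: uniform_flats_def)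
    then have "card (F \<inter> G) \<le> card F"
      by (intro card_mono) (auto intro: finite_subset)
    with F show ?thesis by (simp add: uniform_flats_def le_infI1)
  qed
  fix F x
  assume F: "F \<in> uniform_flats r n" and x: "x \<in> {1..n} - F"
  then have "F \<noteq> {1..n}" by blast
  with F have sub: "F \<subseteq> {1..n}" and cF: "card F \<le> r - 1"
    by (simp_all add: uniform_flats_def)
  have fin: "finite F" using sub by (rule finite_subset) simp
  show "\<exists>!G. G \<in> uniform_flats r n \<and> x \<in> G \<and> F \<subset> G \<and>
          \<not> (\<exists>H\<in>uniform_flats r n. F \<subset> H \<and> H \<subset> G)" (is "\<exists>!G. ?P G")
  proof (cases "card F = r - 1")
    case True
    have top: "G = {1..n}" if "G \<in> uniform_flats r n" "F \<subset> G" for G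
    proof (rule ccontr)
      assume "G \<noteq> {1..n}"
      with that have G: "G \<subseteq> {1..n}" "card G \<le> r - 1" by (simp_all add: uniform_flats_def)
      have "card F < card G"
        using finite_subset[OF G(1)] that(2) by (intro psubset_card_mono) simp_all
      with G True show False by simp
    qed
    have "{1..n} \<in> uniform_flats r n" by (simp add: uniform_flats_def)
    then have "?P {1..n}"
      using x sub by (auto dest: top)
    then show ?thesis
    proof (rule ex1I)
      fix G assume "?P G"
      then show "G = {1..n}" by (intro top) simp_all
    qed
  next
    case False
    have ins: "insert x F \<in> uniform_flats r n"
      using False cF sub x fin by (simp add: uniform_flats_def)
    show ?thesis
    proof (rule ex1I)
      show "?P (insert x F)" using ins x by (simp add: psubset_eq) blast
    next
      fix G assume G: "?P G"
      then have "insert x F \<subseteq> G" "F \<subset> insert x F" using x by auto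
      with G ins show "G = insert x F" by (metis psubsetI)
    qed
  qed
qed

text \<open>
  Polynomials over \<open>'k\<close> in variables indexed by subsets of the ground set; the coefficient field
  is left open so that the base change of the Chow ring to an extension of $\mathbb Q$ is the
  same presentation with larger coefficients.
\<close>

type_synonym ('e, 'k) flat_poly = "('e set \<Rightarrow>\<^sub>0 nat) \<Rightarrow>\<^sub>0 'k"

definition flat_var :: "'e set \<Rightarrow> ('e, 'k::field) flat_poly" where
  "flat_var F = Poly_Mapping.single (Poly_Mapping.single F 1) 1"

definition flat_poly_ring :: "'e set set \<Rightarrow> ('e, 'k::field) flat_poly ring" where
  "flat_poly_ring L =
     \<lparr>carrier = {p. \<forall>m\<in>Poly_Mapping.keys p. Poly_Mapping.keys m \<subseteq> L - {{}}},
      mult = (*), one = 1, zero = 0, add = (+)\<rparr>"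

definition homogeneous :: "nat \<Rightarrow> ('e, 'k::field) flat_poly \<Rightarrow> bool" where
  "homogeneous i p \<longleftrightarrow> (\<forall>m\<in>Poly_Mapping.keys p.
     (\<Sum>F\<in>Poly_Mapping.keys m. Poly_Mapping.lookup m F) = i)"

definition chow_ideal_I :: "'e set set \<Rightarrow> ('e, 'k::field) flat_poly set" where
  "chow_ideal_I L = Idl\<^bsub>flat_poly_ring L\<^esub>
     {flat_var F * flat_var G | F G.
        F \<in> L - {{}} \<and> G \<in> L - {{}} \<and> \<not> F \<subseteq> G \<and> \<not> G \<subseteq> F}"

definition chow_ideal_J :: "'e set \<Rightarrow> 'e set set \<Rightarrow> ('e, 'k::field) flat_poly set" where
  "chow_ideal_J E L = Idl\<^bsub>flat_poly_ring L\<^esub>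
     {(\<Sum>F\<in>{F \<in> L - {{}}. i \<in> F}. flat_var F) | i. i \<in> E}"

definition chow_ideal :: "'e set \<Rightarrow> 'e set set \<Rightarrow> ('e, 'k::field) flat_poly set" where
  "chow_ideal E L = chow_ideal_I L <+>\<^bsub>flat_poly_ring L\<^esub> chow_ideal_J E L"

definition chow_ring :: "'e set \<Rightarrow> 'e set set \<Rightarrow> ('e, 'k::field) flat_poly set ring" where
  "chow_ring E L = flat_poly_ring L Quot chow_ideal E L"

definition chow_class ::
    "'e set \<Rightarrow> 'e set set \<Rightarrow> ('e, 'k::field) flat_poly \<Rightarrow> ('e, 'k) flat_poly set" where
  "chow_class E L p = chow_ideal E L +>\<^bsub>flat_poly_ring L\<^esub> p"

definition chow_algebra ::
    "'e set \<Rightarrow> 'e set set \<Rightarrow> ('k::field, ('e, 'k) flat_poly set) module" where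
  "chow_algebra E L =
     \<lparr>carrier = carrier (chow_ring E L), mult = mult (chow_ring E L), one = one (chow_ring E L),
      zero = zero (chow_ring E L), add = add (chow_ring E L),
      smult = (\<lambda>c X. chow_class E L (Poly_Mapping.single 0 c) \<otimes>\<^bsub>chow_ring E L\<^esub> X)\<rparr>"

text \<open>The graded piece keeps the operations of the whole algebra; as a vector space only its
  addition and scalar multiplication matter.\<close>

definition chow_piece ::
    "'e set \<Rightarrow> 'e set set \<Rightarrow> nat \<Rightarrow> ('k::field, ('e, 'k) flat_poly set) module" where
  "chow_piece E L i = (chow_algebra E L)
     \<lparr>carrier := chow_class E L ` {p \<in> carrier (flat_poly_ring L). homogeneous i p}\<rparr>"

definition relabel_vars ::
    "('e set \<Rightarrow> 'e set) \<Rightarrow> ('e, 'k::field) flat_poly \<Rightarrow> ('e, 'k) flat_poly" where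
  "relabel_vars g p = (\<Sum>m\<in>Poly_Mapping.keys p.
     Poly_Mapping.single
       (\<Sum>F\<in>Poly_Mapping.keys m. Poly_Mapping.single (g F) (Poly_Mapping.lookup m F))
       (Poly_Mapping.lookup p m))"

text \<open>
  When \<open>\<sigma>\<close> maps flats to flats bijectively, the ideal is stable, and the image of the coset of
  \<open>p\<close> is the coset of the relabelled polynomial.
\<close>

definition chow_action ::
    "('e \<Rightarrow> 'e) \<Rightarrow> ('e, 'k::field) flat_poly set \<Rightarrow> ('e, 'k) flat_poly set" where
  "chow_action \<sigma> X = relabel_vars (image \<sigma>) ` X"


section \<open>Traces and the Frobenius characteristic\<close>

text \<open>Coordinate functions are extensional so that uniqueness only concerns the values on \<open>B\<close>.\<close>

definition coordinates_wrt :: "('k::field, 'v) module \<Rightarrow> 'v set \<Rightarrow> 'v \<Rightarrow> ('v \<Rightarrow> 'k) \<Rightarrow> bool" where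
  "coordinates_wrt V B v c \<longleftrightarrow> c \<in> extensional B \<and> v = (\<Oplus>\<^bsub>V\<^esub>b\<in>B. c b \<odot>\<^bsub>V\<^esub> b)"

definition finite_basis :: "('k::field, 'v) module \<Rightarrow> 'v set \<Rightarrow> bool" where
  "finite_basis V B \<longleftrightarrow>
     finite B \<and> B \<subseteq> carrier V \<and> (\<forall>v\<in>carrier V. \<exists>!c. coordinates_wrt V B v c)"

text \<open>The trace of a linear endomorphism of a finite-dimensional space; it does not depend on the
  basis chosen.\<close>

definition linear_trace :: "('k::field, 'v) module \<Rightarrow> ('v \<Rightarrow> 'v) \<Rightarrow> 'k" where
  "linear_trace V f =
     (let B = (SOME B. finite_basis V B)
      in \<Sum>b\<in>B. (THE c. coordinates_wrt V B (f b) c) b)"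

text \<open>The power sum $p_\mu$, where $\mu$ is the cycle type of \<open>\<sigma>\<close>; the orbits of \<open>\<sigma>\<close> are its
  cycles, fixed points included.\<close>

definition cycle_type_power_sum :: "nat \<Rightarrow> (nat \<Rightarrow> nat) \<Rightarrow> complex mseries" where
  "cycle_type_power_sum n \<sigma> = (\<Prod>C\<in>orbit \<sigma> ` {1..n}. power_sum (card C))"

text \<open>
  The Frobenius characteristic of a representation of $\mathfrak S_n$ with character $\chi$ is
  $\frac{1}{n!} \sum_{\sigma} \chi(\sigma)\, p_{\mathrm{cyc}(\sigma)}$. In this normalization the
  trivial character is mapped to $h_n$, the sign character to $e_n$, and $\chi^\lambda$ to
  $s_\lambda$.
\<close>

definition frobenius_char ::
    "nat \<Rightarrow> (complex, 'v) module \<Rightarrow> ((nat \<Rightarrow> nat) \<Rightarrow> 'v \<Rightarrow> 'v) \<Rightarrow> complex mseries" where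
  "frobenius_char n V act =
     mconst (1 / fact n) *
       (\<Sum>\<sigma> | \<sigma> permutes {1..n}. mconst (linear_trace V (act \<sigma>)) * cycle_type_power_sum n \<sigma>)"

definition graded_frobenius ::
    "nat \<Rightarrow> (nat \<Rightarrow> (complex, 'v) module) \<Rightarrow> ((nat \<Rightarrow> nat) \<Rightarrow> 'v \<Rightarrow> 'v) \<Rightarrow> complex mseries fps" where
  "graded_frobenius n V act = Abs_fps (\<lambda>i. frobenius_char n (V i) act)"

end

theory Submission
  imports Defs "HOL-Library.Infinite_Set"
begin

text \<open>
  The Chow ring of a uniform matroid has a basis of monomials that is permuted by the symmetric group.
  Its Frobenius series is therefore a sum over orbits of these monomials, which satisfies a recursion;
  and the Eulerian quasisymmetric functions satisfy the same recursion.

  The basis consists of the Feichtner--Yuzvinsky monomials, which are supported on a chain of flats and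
  have each exponent smaller than the jump of the rank. They span because, with \<open>h_G\<close> the sum of the
  variables of the flats above \<open>G\<close>, the product \<open>x_F * h_G ^ (rk G - rk F)\<close> lies in the ideal
  (\<open>flat_var_times_upper_sum_power\<close>); so a power of \<open>x_G\<close> that is too high can be rewritten in larger flats
  (\<open>reducible_monomial\<close>). For the Boolean matroid there are \<open>n!\<close> of them (\<open>card_fy_boolean\<close>). The linear
  relations, made inhomogeneous by nonzero constants, and the products of incomparable variables have
  \<open>n!\<close> common zeros, one for each maximal flag. A dependency among the basis monomials would let fewer
  than \<open>n!\<close> monomials span the functions on these points, which is impossible
  (\<open>boolean_independent\<close>). Multiplication by \<open>x_E ^ (n - r)\<close> maps the Chow ring of rank \<open>r\<close> to the
  Boolean one and basis monomials to basis monomials, which gives independence in general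
  (\<open>fy_independent\<close>). The trace of a permutation on a graded piece is then the number of basis monomials
  that it fixes (\<open>trace_chow_piece\<close>).

  Splitting off the largest set of a chain corresponds to induction from a Young subgroup, hence to
  multiplication by a complete homogeneous function (\<open>frobenius_sum_stable\<close>). With \<open>H_k\<close> for the
  contribution of the chains with a given largest set of size \<open>k\<close>, this gives
  \<open>H_k = (\<Sum>j<k. H_j * h_(k - j) * (t + \<dots> + t ^ (k - j - 1)))\<close> and the Frobenius series
  \<open>(\<Sum>j<r. H_j * h_(n - j) * (1 + \<dots> + t ^ (r - j - 1)))\<close> (\<open>graded_frobenius_chow\<close>). The first expression is
  therefore the statement that \<open>H_k\<close> is the derangement part \<open>Q0_eulerian k\<close>.

  This is proved by comparing two ways of counting. The coefficient of a monomial in \<open>Q_n\<close> counts, for one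
  decreasing colouring of the positions, the permutations that increase on the excedances and on the
  other positions of each colour, with the excedances first. Removing the fixed points gives
  \<open>Q_n = (\<Sum>k\<le>n. h_(n - k) * Q0_k)\<close>. Lowering all values cyclically by one maps these permutations to those in
  which fixed points count as excedances, and raises the number of excedances by one
  (\<open>sum_compatible_shift\<close>). Removing the fixed points there as well gives
  \<open>t * (\<Sum>k\<le>n. h_(n - k) * Q0_k) = (\<Sum>k\<le>n. t ^ (n - k) * h_(n - k) * Q0_k)\<close> for \<open>n \<ge> 1\<close>, and solving for \<open>Q0_n\<close>
  yields the recursion for \<open>H_n\<close> (\<open>Q0_eulerian_eq_nested_frobenius\<close>).

  For the second expression, the recursion shows that \<open>Q0_k\<close> is palindromic in \<open>t\<close>, so the inner sum is
  \<open>(\<Sum>k\<le>j. h_(n - k) * Q0_k * t ^ (j - k))\<close>. This is the difference of the first expressions for \<open>j + 1\<close> and \<open>j\<close>,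
  and for \<open>r = n\<close> the first expression is \<open>Q_n\<close> (\<open>truncated_sums\<close>).
\<close>

section \<open>Polynomials in the flats and the Chow ideal\<close>

abbreviation "keys \<equiv> Poly_Mapping.keys"
abbreviation "lookup \<equiv> Poly_Mapping.lookup"
abbreviation "single \<equiv> Poly_Mapping.single"

definition total_degree :: "('v \<Rightarrow>\<^sub>0 nat) \<Rightarrow> nat" where
  "total_degree m = (\<Sum>x\<in>keys m. lookup m x)"

lemma total_degree_superset:
  "finite A \<Longrightarrow> keys m \<subseteq> A \<Longrightarrow> total_degree m = (\<Sum>x\<in>A. lookup m x)"
  unfolding total_degree_def by (rule sum.mono_neutral_left) (auto simp: in_keys_iff)

lemma total_degree_add [simp]: "total_degree (a + b) = total_degree a + total_degree b"
proof -
  let ?A = "keys a \<union> keys b"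
  have "total_degree (a + b) = (\<Sum>x\<in>?A. lookup (a + b) x)"
    by (rule total_degree_superset) (use keys_add[of a b] in auto)
  also have "\<dots> = total_degree a + total_degree b"
    by (simp add: lookup_add sum.distrib total_degree_superset[of ?A])
  finally show ?thesis .
qed

lemma total_degree_single [simp]: "total_degree (single x k) = k"
  by (cases "k = 0") (simp_all add: total_degree_def)

lemma total_degree_zero [simp]: "total_degree 0 = 0"
  by (simp add: total_degree_def)

lemma total_degree_sum [simp]: "total_degree (sum f A) = (\<Sum>x\<in>A. total_degree (f x))"
  by (induction A rule: infinite_finite_induct) auto

lemma total_degree_eq_0_iff [simp]: "total_degree m = 0 \<longleftrightarrow> m = 0"
  by (auto simp: total_degree_def in_keys_iff) (auto intro!: poly_mapping_eqI)

lemma keys_add_nat [simp]: "keys (a + b :: 'v \<Rightarrow>\<^sub>0 nat) = keys a \<union> keys b"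
  by (auto simp: in_keys_iff lookup_add)

lemma keys_sum_nat: "finite A \<Longrightarrow> keys (sum f A :: 'v \<Rightarrow>\<^sub>0 nat) = (\<Union>x\<in>A. keys (f x))"
  by (induction A rule: finite_induct) auto

lemma poly_mapping_eq_sum_single: "p = (\<Sum>m\<in>keys p. single m (lookup p m))"
proof (rule poly_mapping_eqI)
  fix k
  show "lookup p k = lookup (\<Sum>m\<in>keys p. single m (lookup p m)) k"
    by (cases "k \<in> keys p")
      (auto simp: lookup_sum lookup_single when_def sum.delta in_keys_iff if_distrib cong: if_cong)
qed

text \<open>
  Evaluation of polynomials and renaming of variables are both instances of the linear extension
  of a multiplicative function on monomials, so that their being additive and multiplicative needs to
  be checked only once.
\<close>

definition monomial_extension ::
    "('k::comm_ring_1 \<Rightarrow> 'r::comm_ring_1) \<Rightarrow> (('v \<Rightarrow>\<^sub>0 nat) \<Rightarrow> 'r) \<Rightarrow> (('v \<Rightarrow>\<^sub>0 nat) \<Rightarrow>\<^sub>0 'k) \<Rightarrow> 'r" where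
  "monomial_extension e f p = (\<Sum>m\<in>keys p. e (lookup p m) * f m)"

locale multiplicative_extension =
  fixes e :: "'k::comm_ring_1 \<Rightarrow> 'r::comm_ring_1" and f :: "('v \<Rightarrow>\<^sub>0 nat) \<Rightarrow> 'r"
  assumes e_0 [simp]: "e 0 = 0" and e_add: "e (a + b) = e a + e b" and e_mult: "e (a * b) = e a * e b"
    and f_add: "f (m + m') = f m * f m'"
begin

abbreviation "ext \<equiv> monomial_extension e f"

lemma ext_superset:
  "finite A \<Longrightarrow> keys p \<subseteq> A \<Longrightarrow> ext p = (\<Sum>m\<in>A. e (lookup p m) * f m)"
  unfolding monomial_extension_def by (rule sum.mono_neutral_left) (auto simp: in_keys_iff)

lemma ext_add: "ext (p + q) = ext p + ext q"
proof -
  let ?A = "keys p \<union> keys q"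
  have "ext (p + q) = (\<Sum>m\<in>?A. e (lookup (p + q) m) * f m)"
    by (rule ext_superset) (use keys_add[of p q] in auto)
  also have "\<dots> = ext p + ext q"
    by (simp add: lookup_add e_add sum.distrib ext_superset[of ?A] algebra_simps)
  finally show ?thesis .
qed

lemma ext_0 [simp]: "ext 0 = 0"
  by (simp add: monomial_extension_def)

lemma ext_sum: "ext (sum g A) = (\<Sum>x\<in>A. ext (g x))"
  by (induction A rule: infinite_finite_induct) (auto simp: ext_add)

lemma ext_single [simp]: "ext (single m c) = e c * f m"
  by (cases "c = 0") (simp_all add: monomial_extension_def)

lemma ext_mult: "ext (p * q) = ext p * ext q"
proof -
  have "ext (p * q) = ext ((\<Sum>m\<in>keys p. single m (lookup p m)) * (\<Sum>m\<in>keys q. single m (lookup q m)))"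
    by (simp flip: poly_mapping_eq_sum_single)
  also have "\<dots> = (\<Sum>m\<in>keys p. \<Sum>m'\<in>keys q. e (lookup p m * lookup q m') * f (m + m'))"
    by (simp add: sum_product ext_sum mult_single)
  also have "\<dots> = ext p * ext q"
    by (simp add: monomial_extension_def sum_product e_mult f_add ac_simps)
  finally show ?thesis .
qed

end

lemma flat_var_power: "flat_var F ^ k = single (single F k) 1"
  by (induction k) (simp_all add: flat_var_def mult_single single_add[symmetric])

abbreviation flat_polys :: "'e set set \<Rightarrow> ('e, 'k::field) flat_poly set" where
  "flat_polys L \<equiv> carrier (flat_poly_ring L)"

lemma flat_poly_ring_simps [simp]:
  "mult (flat_poly_ring L) = (*)" "one (flat_poly_ring L) = 1" "zero (flat_poly_ring L) = 0"
  "add (flat_poly_ring L) = (+)"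
  by (simp_all add: flat_poly_ring_def)

lemma flat_polys_iff: "p \<in> flat_polys L \<longleftrightarrow> (\<forall>m\<in>keys p. keys m \<subseteq> L - {{}})"
  by (simp add: flat_poly_ring_def)

lemma flat_polys_0 [simp]: "0 \<in> flat_polys L" and flat_polys_1 [simp]: "1 \<in> flat_polys L"
  by (simp_all add: flat_polys_iff)

lemma flat_polys_add [intro]: "p \<in> flat_polys L \<Longrightarrow> q \<in> flat_polys L \<Longrightarrow> p + q \<in> flat_polys L"
  using keys_add[of p q] by (auto simp: flat_polys_iff)

lemma flat_polys_uminus [intro]: "p \<in> flat_polys L \<Longrightarrow> - p \<in> flat_polys L"
  by (simp add: flat_polys_iff in_keys_iff)

lemma flat_polys_mult [intro]: "p \<in> flat_polys L \<Longrightarrow> q \<in> flat_polys L \<Longrightarrow> p * q \<in> flat_polys L"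
  using keys_mult[of p q] by (fastforce simp: flat_polys_iff)

lemma flat_polys_sum [intro]: "(\<And>x. x \<in> A \<Longrightarrow> f x \<in> flat_polys L) \<Longrightarrow> sum f A \<in> flat_polys L"
  by (induction A rule: infinite_finite_induct) auto

lemma flat_polys_power [intro]: "p \<in> flat_polys L \<Longrightarrow> p ^ k \<in> flat_polys L"
  by (induction k) auto

lemma flat_polys_single [intro]: "keys m \<subseteq> L - {{}} \<Longrightarrow> single m c \<in> flat_polys L"
  by (simp add: flat_polys_iff)

lemma flat_polys_flat_var [intro]: "F \<in> L \<Longrightarrow> F \<noteq> {} \<Longrightarrow> flat_var F \<in> flat_polys L"
  by (auto simp: flat_var_def)

lemma cring_flat_poly_ring: "cring (flat_poly_ring L :: ('e, 'k::field) flat_poly ring)"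
proof (rule cringI)
  show "abelian_group (flat_poly_ring L :: ('e, 'k) flat_poly ring)"
  proof (rule abelian_groupI)
    fix x :: "('e, 'k) flat_poly" assume "x \<in> flat_polys L"
    then have "- x \<in> flat_polys L" by auto
    then show "\<exists>y\<in>flat_polys L. y \<oplus>\<^bsub>flat_poly_ring L\<^esub> x = \<zero>\<^bsub>flat_poly_ring L\<^esub>"
      by (intro bexI[of _ "- x"]) simp_all
  qed (auto simp: algebra_simps)
  show "comm_monoid (flat_poly_ring L :: ('e, 'k) flat_poly ring)"
    by (rule comm_monoidI) (auto simp: algebra_simps)
qed (auto simp: algebra_simps)

lemma ideal_flat_polysI:
  fixes P :: "('e, 'k::field) flat_poly set"
  assumes "P \<subseteq> flat_polys L" "0 \<in> P" "\<And>p q. p \<in> P \<Longrightarrow> q \<in> P \<Longrightarrow> p + q \<in> P"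
    and mult: "\<And>p u. u \<in> flat_polys L \<Longrightarrow> p \<in> P \<Longrightarrow> u * p \<in> P"
  shows "ideal P (flat_poly_ring L)"
proof -
  interpret cring "flat_poly_ring L :: ('e, 'k) flat_poly ring" by (rule cring_flat_poly_ring)
  have neg: "- p \<in> P" if "p \<in> P" for p
    using mult[OF flat_polys_uminus[OF flat_polys_1] that] by simp
  have inv: "\<ominus>\<^bsub>flat_poly_ring L\<^esub> p = - p" if "p \<in> P" for p
    using that assms(1) by (intro minus_equality) auto
  show ?thesis
  proof (rule idealI)
    show "subgroup P (add_monoid (flat_poly_ring L))"
    proof (rule subgroup.intro)
      show "inv\<^bsub>add_monoid (flat_poly_ring L)\<^esub> p \<in> P" if "p \<in> P" for p
        using inv[OF that] neg[OF that] by (simp add: a_inv_def)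
    qed (use assms in auto)
  next
    fix p u :: "('e, 'k) flat_poly" assume "p \<in> P" "u \<in> flat_polys L"
    then show "u \<otimes>\<^bsub>flat_poly_ring L\<^esub> p \<in> P" "p \<otimes>\<^bsub>flat_poly_ring L\<^esub> u \<in> P"
      using mult[of u p] by (simp_all add: mult.commute)
  qed (rule ring_axioms)
qed

definition linear_relation :: "'e set set \<Rightarrow> 'e \<Rightarrow> ('e, 'k::field) flat_poly" where
  "linear_relation L i = (\<Sum>F\<in>{F \<in> L - {{}}. i \<in> F}. flat_var F)"

context
  fixes E :: "'e set" and L :: "'e set set"
begin

interpretation R: cring "flat_poly_ring L :: ('e, 'k::field) flat_poly ring"
  by (rule cring_flat_poly_ring)

lemma incomparable_gens_in:
  "{flat_var F * flat_var G | F G. F \<in> L - {{}} \<and> G \<in> L - {{}} \<and> \<not> F \<subseteq> G \<and> \<not> G \<subseteq> F}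
     \<subseteq> (flat_polys L :: ('e, 'k::field) flat_poly set)"
  by auto

lemma linear_gens_in:
  "{(\<Sum>F\<in>{F \<in> L - {{}}. i \<in> F}. flat_var F) | i. i \<in> E}
     \<subseteq> (flat_polys L :: ('e, 'k::field) flat_poly set)"
  by auto

lemma ideal_chow_ideal: "ideal (chow_ideal E L) (flat_poly_ring L :: ('e, 'k::field) flat_poly ring)"
  unfolding chow_ideal_def chow_ideal_I_def chow_ideal_J_def
  by (intro R.add_ideals R.genideal_ideal incomparable_gens_in linear_gens_in)

lemma chow_ideal_0 [simp]: "(0 :: ('e, 'k::field) flat_poly) \<in> chow_ideal E L"
  using additive_subgroup.zero_closed[OF ideal.axioms(1)[OF ideal_chow_ideal]] by simp

lemma chow_ideal_add:
  "p \<in> chow_ideal E L \<Longrightarrow> q \<in> chow_ideal E L \<Longrightarrow> p + q \<in> (chow_ideal E L :: ('e, 'k::field) flat_poly set)"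
  using additive_subgroup.a_closed[OF ideal.axioms(1)[OF ideal_chow_ideal]] by simp

lemma chow_ideal_mult:
  "p \<in> chow_ideal E L \<Longrightarrow> u \<in> flat_polys L \<Longrightarrow> u * p \<in> (chow_ideal E L :: ('e, 'k::field) flat_poly set)"
  using ideal.I_l_closed[OF ideal_chow_ideal] by simp

lemma chow_ideal_uminus:
  "p \<in> chow_ideal E L \<Longrightarrow> - p \<in> (chow_ideal E L :: ('e, 'k::field) flat_poly set)"
  using chow_ideal_mult[OF _ flat_polys_uminus[OF flat_polys_1]] by simp

lemma chow_ideal_diff:
  "p \<in> chow_ideal E L \<Longrightarrow> q \<in> chow_ideal E L \<Longrightarrow> p - q \<in> (chow_ideal E L :: ('e, 'k::field) flat_poly set)"
  using chow_ideal_add[of p "- q"] chow_ideal_uminus[of q] by auto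

lemma chow_ideal_sum:
  "(\<And>x. x \<in> A \<Longrightarrow> f x \<in> chow_ideal E L) \<Longrightarrow> sum f A \<in> (chow_ideal E L :: ('e, 'k::field) flat_poly set)"
  by (induction A rule: infinite_finite_induct) (auto intro: chow_ideal_add)

lemma chow_ideal_I_J_subset:
  "chow_ideal_I L \<subseteq> (chow_ideal E L :: ('e, 'k::field) flat_poly set)"
  "chow_ideal_J E L \<subseteq> (chow_ideal E L :: ('e, 'k::field) flat_poly set)"
proof -
  have I: "ideal (chow_ideal_I L) (flat_poly_ring L :: ('e, 'k) flat_poly ring)"
    unfolding chow_ideal_I_def by (intro R.genideal_ideal incomparable_gens_in)
  have J: "ideal (chow_ideal_J E L) (flat_poly_ring L :: ('e, 'k) flat_poly ring)"
    unfolding chow_ideal_J_def by (intro R.genideal_ideal linear_gens_in)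
  have zero: "(0 :: ('e, 'k) flat_poly) \<in> chow_ideal_I L" "(0 :: ('e, 'k) flat_poly) \<in> chow_ideal_J E L"
    using additive_subgroup.zero_closed[OF ideal.axioms(1)[OF I]]
      additive_subgroup.zero_closed[OF ideal.axioms(1)[OF J]] by simp_all
  show "chow_ideal_I L \<subseteq> (chow_ideal E L :: ('e, 'k) flat_poly set)"
  proof
    fix p :: "('e, 'k) flat_poly" assume "p \<in> chow_ideal_I L"
    then have "p + 0 \<in> chow_ideal E L"
      unfolding chow_ideal_def set_add_def' using zero(2) by (auto intro!: exI bexI)
    then show "p \<in> chow_ideal E L" by simp
  qed
  show "chow_ideal_J E L \<subseteq> (chow_ideal E L :: ('e, 'k) flat_poly set)"
  proof
    fix p :: "('e, 'k) flat_poly" assume "p \<in> chow_ideal_J E L"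
    then have "0 + p \<in> chow_ideal E L"
      unfolding chow_ideal_def set_add_def' using zero(1) by (auto intro!: exI bexI)
    then show "p \<in> chow_ideal E L" by simp
  qed
qed

lemma incomparable_in_chow_ideal:
  assumes "F \<in> L" "G \<in> L" "F \<noteq> {}" "G \<noteq> {}" "\<not> F \<subseteq> G" "\<not> G \<subseteq> F"
  shows "flat_var F * flat_var G \<in> (chow_ideal E L :: ('e, 'k::field) flat_poly set)"
proof -
  have "flat_var F * flat_var G \<in> (chow_ideal_I L :: ('e, 'k) flat_poly set)"
    unfolding chow_ideal_I_def
    by (rule subsetD[OF R.genideal_self[OF incomparable_gens_in]]) (use assms in auto)
  then show ?thesis using chow_ideal_I_J_subset(1) by blast
qed

lemma linear_relation_in_chow_ideal:
  assumes "i \<in> E"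
  shows "linear_relation L i \<in> (chow_ideal E L :: ('e, 'k::field) flat_poly set)"
proof -
  have "linear_relation L i \<in> (chow_ideal_J E L :: ('e, 'k) flat_poly set)"
    unfolding chow_ideal_J_def linear_relation_def
    by (rule subsetD[OF R.genideal_self[OF linear_gens_in]]) (use assms in auto)
  then show ?thesis using chow_ideal_I_J_subset(2) by blast
qed

text \<open>
  A statement about all elements of the Chow ideal is proved by taking for \<open>P\<close> the set of polynomials
  that satisfy it.
\<close>

lemma chow_ideal_least:
  fixes P :: "('e, 'k::field) flat_poly set"
  assumes zero: "0 \<in> P" and add: "\<And>p q. p \<in> P \<Longrightarrow> q \<in> P \<Longrightarrow> p + q \<in> P"
    and mult: "\<And>p u. u \<in> flat_polys L \<Longrightarrow> p \<in> flat_polys L \<Longrightarrow> p \<in> P \<Longrightarrow> u * p \<in> P"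
    and incomparable: "\<And>F G. F \<in> L \<Longrightarrow> G \<in> L \<Longrightarrow> F \<noteq> {} \<Longrightarrow> G \<noteq> {} \<Longrightarrow> \<not> F \<subseteq> G \<Longrightarrow> \<not> G \<subseteq> F \<Longrightarrow>
        flat_var F * flat_var G \<in> P"
    and linear: "\<And>i. i \<in> E \<Longrightarrow> linear_relation L i \<in> P"
  shows "chow_ideal E L \<subseteq> P"
proof -
  let ?Q = "P \<inter> flat_polys L"
  have Q: "ideal ?Q (flat_poly_ring L)"
    by (rule ideal_flat_polysI) (use assms in auto)
  have "chow_ideal_I L \<subseteq> ?Q"
    unfolding chow_ideal_I_def by (rule R.genideal_minimal[OF Q]) (use incomparable in auto)
  moreover have "chow_ideal_J E L \<subseteq> ?Q"
    unfolding chow_ideal_J_def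
    by (rule R.genideal_minimal[OF Q]) (use linear in \<open>auto simp: linear_relation_def\<close>)
  ultimately show ?thesis
    unfolding chow_ideal_def set_add_def' by (auto intro!: add)
qed

end

(* Keeps the intervals {1..n} in this form. *)
declare One_nat_def [simp del]

section \<open>Nested monomials span the Chow ring\<close>

lemma split_monomial: "g \<le> lookup m G \<Longrightarrow> \<exists>m'. m = m' + single G g"
  for m :: "'v \<Rightarrow>\<^sub>0 nat"
  by (intro exI[of _ "m - single G g"] poly_mapping_eqI)
    (auto simp: lookup_add lookup_minus lookup_single when_def)

text \<open>
  These are the exponent vectors of the Feichtner--Yuzvinsky basis. Taking \<open>{}\<close> among the lower sets
  bounds the exponent of the smallest set of the chain.
\<close>

definition nested :: "('e set \<Rightarrow> nat) \<Rightarrow> ('e set \<Rightarrow>\<^sub>0 nat) \<Rightarrow> bool" where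
  "nested rk m \<longleftrightarrow> (\<forall>F\<in>keys m. \<forall>G\<in>keys m. F \<subseteq> G \<or> G \<subseteq> F) \<and>
     (\<forall>G\<in>keys m. \<forall>F\<in>insert {} (keys m). F \<subset> G \<longrightarrow> lookup m G + rk F < rk G)"

definition uniform_rank :: "nat \<Rightarrow> nat set \<Rightarrow> nat" where
  "uniform_rank r F = min r (card F)"

definition fy_monomials :: "nat \<Rightarrow> nat \<Rightarrow> (nat set \<Rightarrow>\<^sub>0 nat) set" where
  "fy_monomials r n = {m. keys m \<subseteq> uniform_flats r n - {{}} \<and> nested (uniform_rank r) m}"

lemma finite_bounded_poly_mappings:
  assumes "finite A"
  shows "finite {m :: 'v \<Rightarrow>\<^sub>0 nat. keys m \<subseteq> A \<and> (\<forall>x. lookup m x \<le> k)}" (is "finite ?M")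
proof (rule inj_on_finite)
  show "inj_on (\<lambda>m. restrict (lookup m) A) ?M"
  proof (rule inj_onI)
    fix a b assume a: "a \<in> ?M" and b: "b \<in> ?M" and eq: "restrict (lookup a) A = restrict (lookup b) A"
    show "a = b"
    proof (rule poly_mapping_eqI)
      fix x
      show "lookup a x = lookup b x"
      proof (cases "x \<in> A")
        case True
        then show ?thesis using eq by (metis restrict_apply')
      next
        case False
        then have "x \<notin> keys a" "x \<notin> keys b" using a b by auto
        then show ?thesis by (simp add: in_keys_iff)
      qed
    qed
  qed
  show "(\<lambda>m. restrict (lookup m) A) ` ?M \<subseteq> PiE A (\<lambda>_. {..k})" by auto
  show "finite (PiE A (\<lambda>_. {..k}))" using assms by (intro finite_PiE) auto
qed

lemma finite_uniform_flats [simp]: "finite (uniform_flats r n)"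
  by (rule finite_subset[of _ "Pow {1..n}"]) (auto simp: uniform_flats_def)

lemma lookup_fy_le:
  assumes "m \<in> fy_monomials r n"
  shows "lookup m G \<le> r"
proof (cases "G \<in> keys m")
  case True
  then have "{} \<subset> G" using assms by (auto simp: fy_monomials_def)
  with True have "lookup m G + uniform_rank r {} < uniform_rank r G"
    using assms by (auto simp: fy_monomials_def nested_def)
  then show ?thesis by (simp add: uniform_rank_def)
qed (simp add: in_keys_iff)

lemma finite_fy_monomials [simp]: "finite (fy_monomials r n)"
  by (rule finite_subset[OF _ finite_bounded_poly_mappings[of "uniform_flats r n" r]])
    (use lookup_fy_le in \<open>auto simp: fy_monomials_def\<close>)

definition upper_sum :: "'e set set \<Rightarrow> 'e set \<Rightarrow> ('e, 'k::field) flat_poly" where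
  "upper_sum L G = (\<Sum>H\<in>{H \<in> L. G \<subseteq> H}. flat_var H)"

text \<open>
  The convention \<open>x\<close> of the empty flat = 1 lets the relation below also start at the bottom of the lattice.
\<close>

definition flat_var1 :: "'e set \<Rightarrow> ('e, 'k::field) flat_poly" where
  "flat_var1 F = (if F = {} then 1 else flat_var F)"

definition monomial_weight :: "(nat set \<Rightarrow>\<^sub>0 nat) \<Rightarrow> nat" where
  "monomial_weight m = (\<Sum>F\<in>keys m. lookup m F * card F)"

lemma monomial_weight_superset:
  "finite A \<Longrightarrow> keys m \<subseteq> A \<Longrightarrow> monomial_weight m = (\<Sum>F\<in>A. lookup m F * card F)"
  unfolding monomial_weight_def by (rule sum.mono_neutral_left) (auto simp: in_keys_iff)

lemma monomial_weight_add [simp]: "monomial_weight (a + b) = monomial_weight a + monomial_weight b"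
  by (simp add: monomial_weight_superset[of "keys a \<union> keys b"] lookup_add sum.distrib algebra_simps)

lemma monomial_weight_single [simp]: "monomial_weight (single F k) = k * card F"
  by (cases "k = 0") (simp_all add: monomial_weight_def)

lemma monomial_weight_0 [simp]: "monomial_weight 0 = 0"
  by (simp add: monomial_weight_def)

locale uniform =
  fixes r n :: nat
  assumes r_pos: "1 \<le> r" and r_le: "r \<le> n"
begin

abbreviation E :: "nat set" where "E \<equiv> {1..n}"
abbreviation L :: "nat set set" where "L \<equiv> uniform_flats r n"
abbreviation rk :: "nat set \<Rightarrow> nat" where "rk \<equiv> uniform_rank r"

lemma flat_iff: "F \<in> L \<longleftrightarrow> F \<subseteq> E \<and> (card F \<le> r - 1 \<or> F = E)"
  by (auto simp: uniform_flats_def)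

lemma flat_subset: "F \<in> L \<Longrightarrow> F \<subseteq> E"
  by (simp add: flat_iff)

lemma finite_flat: "F \<in> L \<Longrightarrow> finite F"
  using flat_subset finite_subset by blast

lemma rk_flat: "F \<in> L \<Longrightarrow> rk F = (if F = E then r else card F)"
  using r_pos r_le by (auto simp: flat_iff uniform_rank_def)

lemma E_nonempty: "E \<noteq> {}"
  using r_pos r_le by auto

lemma rk_strict_mono:
  assumes "F \<in> L" "G \<in> L" "F \<subset> G"
  shows "rk F < rk G"
proof -
  have "finite G" using assms(2) by (auto simp: flat_iff intro: finite_subset)
  then have "card F < card G" using assms(3) by (rule psubset_card_mono)
  moreover have "F \<noteq> E" "card F \<le> r - 1" using assms by (auto simp: flat_iff)
  ultimately show ?thesis using assms(1,2) r_pos by (auto simp: rk_flat)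
qed

text \<open>
  \<open>G\<close> is the flat spanned by \<open>G'\<close> and \<open>i\<close>, which covers \<open>G'\<close>.
\<close>

definition covered_by :: "nat set \<Rightarrow> nat \<Rightarrow> nat set \<Rightarrow> bool" where
  "covered_by G' i G \<longleftrightarrow> G' \<in> L \<and> G \<in> L \<and> i \<in> E \<and> i \<notin> G' \<and> i \<in> G \<and> G' \<subseteq> G \<and> rk G = rk G' + 1 \<and>
     (\<forall>H\<in>L. G' \<subseteq> H \<and> i \<in> H \<longrightarrow> G \<subseteq> H)"

text \<open>
  A flat \<open>G\<close> other than \<open>E\<close> covers the sets obtained by removing one element, while \<open>E\<close> covers the sets of
  size \<open>r - 1\<close>.
\<close>

lemma obtain_covered:
  assumes F: "F \<in> L" and G: "G \<in> L" and FG: "F \<subset> G"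
  obtains G' i where "covered_by G' i G" "F \<subseteq> G'"
proof (cases "G = E")
  case True
  have FE: "F \<subseteq> E" "card F \<le> r - 1" using F FG G by (auto simp: flat_iff)
  obtain G' where G': "F \<subseteq> G'" "G' \<subseteq> E" "card G' = r - 1"
    using exists_subset_between[of F "r - 1" E] FE r_le by force
  have "G' \<noteq> E" using G'(3) r_pos r_le by auto
  then obtain i where i: "i \<in> E" "i \<notin> G'" using G'(2) by blast
  have "H = E" if "H \<in> L" "G' \<subseteq> H" "i \<in> H" for H
  proof (rule ccontr)
    assume "H \<noteq> E"
    then have "card H \<le> r - 1" "finite H" using that by (auto simp: flat_iff intro: finite_subset)
    moreover have "card (insert i G') \<le> card H"
      using that \<open>finite H\<close> by (intro card_mono) auto
    moreover have "card (insert i G') = r"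
      using i G' r_pos finite_subset[OF G'(2)] by (simp add: card_insert_disjoint)
    ultimately show False using r_pos by simp
  qed
  then have top: "\<forall>H\<in>L. G' \<subseteq> H \<and> i \<in> H \<longrightarrow> G \<subseteq> H"
    using True by blast
  have G'L: "G' \<in> L" using G' by (auto simp: flat_iff)
  have "rk G = rk G' + 1"
    using rk_flat[OF G] rk_flat[OF G'L] True \<open>G' \<noteq> E\<close> G'(3) r_pos by simp
  then have "covered_by G' i G"
    using i G G'L True G'(2) top unfolding covered_by_def by blast
  then show ?thesis using G'(1) that by blast
next
  case False
  then have GE: "G \<subseteq> E" "card G \<le> r - 1" using G by (auto simp: flat_iff)
  then have fin: "finite G" by (auto intro: finite_subset)
  obtain i where i: "i \<in> G" "i \<notin> F" using FG by blast
  have c: "card (G - {i}) = card G - 1" "card G \<ge> 1"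
    using i fin card_gt_0_iff[of G] by auto
  have "G - {i} \<noteq> E" using GE(1) False by blast
  have sub: "G - {i} \<in> L" using GE c by (auto simp: flat_iff)
  have "rk G = rk (G - {i}) + 1"
    using rk_flat[OF G] rk_flat[OF sub] False \<open>G - {i} \<noteq> E\<close> c by simp
  moreover have "i \<in> E" using i GE by blast
  ultimately have "covered_by (G - {i}) i G"
    using i G sub unfolding covered_by_def by blast
  then show ?thesis using i FG that by blast
qed

context
  fixes I :: "(nat, 'k::field) flat_poly set"
  assumes I_def: "I = chow_ideal E L"
begin

lemma I_add: "p \<in> I \<Longrightarrow> q \<in> I \<Longrightarrow> p + q \<in> I"
  unfolding I_def by (rule chow_ideal_add)

lemma I_mult: "p \<in> I \<Longrightarrow> u \<in> flat_polys L \<Longrightarrow> u * p \<in> I"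
  unfolding I_def by (rule chow_ideal_mult)

lemma I_sum: "(\<And>x. x \<in> A \<Longrightarrow> f x \<in> I) \<Longrightarrow> sum f A \<in> I"
  unfolding I_def by (rule chow_ideal_sum)

lemma I_diff: "p \<in> I \<Longrightarrow> q \<in> I \<Longrightarrow> p - q \<in> I"
  unfolding I_def by (rule chow_ideal_diff)

lemma I_zero: "0 \<in> I"
  by (simp add: I_def)

lemma upper_sum_in: "G \<noteq> {} \<Longrightarrow> (upper_sum L G :: (nat, 'k) flat_poly) \<in> flat_polys L"
  unfolding upper_sum_def by auto

text \<open>Multiplying the linear relation at \<open>i\<close> by a variable \<open>x_H\<close> with \<open>i \<notin> H\<close> leaves only the flats above
  both \<open>H\<close> and \<open>i\<close>, as the others are incomparable to \<open>H\<close>.\<close>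

lemma upper_sum_times_var:
  assumes cov: "covered_by G' i G" and H: "H \<in> L" "G' \<subseteq> H" "i \<notin> H" "H \<noteq> {}"
  shows "flat_var H * upper_sum L G \<in> I"
proof -
  let ?A = "{K \<in> L - {{}}. i \<in> K}" and ?B = "{K \<in> L. G \<subseteq> K}"
  have BA: "?B \<subseteq> ?A" using cov by (auto simp: covered_by_def)
  have fin: "finite ?A" by (rule finite_subset[OF _ finite_uniform_flats[of r n]]) auto
  have "flat_var H * linear_relation L i - (\<Sum>K\<in>?A - ?B. flat_var H * flat_var K) \<in> I"
  proof (rule I_diff)
    show "flat_var H * linear_relation L i \<in> I"
      unfolding I_def
      by (rule chow_ideal_mult[OF linear_relation_in_chow_ideal])
        (use cov H in \<open>auto simp: covered_by_def\<close>)
    show "(\<Sum>K\<in>?A - ?B. flat_var H * flat_var K) \<in> I"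
    proof (rule I_sum)
      fix K assume K: "K \<in> ?A - ?B"
      then have "K \<in> L" "i \<in> K" "\<not> G \<subseteq> K" by auto
      then have "\<not> H \<subseteq> K" using cov H(2) unfolding covered_by_def by (meson order_trans)
      moreover have "\<not> K \<subseteq> H" using K H by auto
      ultimately show "flat_var H * flat_var K \<in> I"
        unfolding I_def using H K by (intro incomparable_in_chow_ideal) auto
    qed
  qed
  moreover have "(\<Sum>K\<in>?A. flat_var H * flat_var K) =
      (\<Sum>K\<in>?A - ?B. flat_var H * flat_var K :: (nat, 'k) flat_poly) + (\<Sum>K\<in>?B. flat_var H * flat_var K)"
    by (rule sum.subset_diff[OF BA fin])
  ultimately show ?thesis
    by (simp add: linear_relation_def upper_sum_def sum_distrib_left)
qed

text \<open>
  \<open>upper_sum L G' - upper_sum L G\<close> is the sum of the variables of the flats above \<open>G'\<close> that avoid \<open>i\<close>, each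
  of which is killed by \<open>upper_sum L G\<close>. So multiplication by \<open>upper_sum L G\<close> does not distinguish the two
  sums, and neither their powers.
\<close>

lemma upper_sum_cover_product:
  assumes cov: "covered_by G' i G" and ne: "G' \<noteq> {}"
  shows "upper_sum L G * (upper_sum L G' - upper_sum L G) \<in> I"
proof -
  let ?A = "{H \<in> L. G' \<subseteq> H}" and ?B = "{H \<in> L. G \<subseteq> H}"
  have BA: "?B \<subseteq> ?A" using cov by (auto simp: covered_by_def)
  have fin: "finite ?A" by (rule finite_subset[OF _ finite_uniform_flats[of r n]]) auto
  have "upper_sum L G' = (\<Sum>H\<in>?A - ?B. flat_var H) + (upper_sum L G :: (nat, 'k) flat_poly)"
    unfolding upper_sum_def by (rule sum.subset_diff[OF BA fin])
  then have "upper_sum L G * (upper_sum L G' - upper_sum L G) =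
      (\<Sum>H\<in>?A - ?B. flat_var H * upper_sum L G :: (nat, 'k) flat_poly)"
    by (simp add: sum_distrib_left mult.commute)
  also have "\<dots> \<in> I"
  proof (rule I_sum)
    fix H assume H: "H \<in> ?A - ?B"
    then have "i \<notin> H" using cov by (auto simp: covered_by_def)
    then show "flat_var H * upper_sum L G \<in> I"
      using H ne by (intro upper_sum_times_var[OF cov]) auto
  qed
  finally show ?thesis .
qed

lemma upper_sum_power_cover:
  assumes cov: "covered_by G' i G" and ne: "G' \<noteq> {}"
  shows "upper_sum L G * (upper_sum L G' ^ e - upper_sum L G ^ e) \<in> I"
proof (induction e)
  case 0
  show ?case by (simp add: I_def)
next
  case (Suc e)
  let ?h = "upper_sum L G :: (nat, 'k) flat_poly" and ?h' = "upper_sum L G' :: (nat, 'k) flat_poly"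
  have "G \<noteq> {}" using cov by (auto simp: covered_by_def)
  then have in_R: "?h' \<in> flat_polys L" "?h ^ e \<in> flat_polys L"
    using ne upper_sum_in by auto
  have "?h * (?h' ^ Suc e - ?h ^ Suc e) = ?h' * (?h * (?h' ^ e - ?h ^ e)) + ?h ^ e * (?h * (?h' - ?h))"
    by (simp add: algebra_simps)
  then show ?case
    using I_add[OF I_mult[OF Suc in_R(1)] I_mult[OF upper_sum_cover_product[OF cov ne] in_R(2)]] by simp
qed

lemma upper_sum_cover_empty:
  assumes "covered_by {} i G"
  shows "upper_sum L G \<in> I"
proof -
  have "{K \<in> L - {{}}. i \<in> K} = {K \<in> L. G \<subseteq> K}"
    using assms by (auto simp: covered_by_def)
  then have "upper_sum L G = (linear_relation L i :: (nat, 'k) flat_poly)"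
    by (simp add: upper_sum_def linear_relation_def)
  then show ?thesis
    using assms linear_relation_in_chow_ideal[of i E L] by (simp add: I_def covered_by_def)
qed

lemma flat_var1_in: "F \<in> L \<Longrightarrow> (flat_var1 F :: (nat, 'k) flat_poly) \<in> flat_polys L"
  by (auto simp: flat_var1_def)

text \<open>The relation behind the rewriting: climbing from \<open>F\<close> to \<open>G\<close> through covers, each step costs one
  more factor of the sum over the flats above.\<close>

lemma flat_var_times_upper_sum_power:
  assumes "F \<in> L" "G \<in> L" "F \<subset> G"
  shows "flat_var1 F * upper_sum L G ^ (rk G - rk F) \<in> I"
  using assms(2,3)
proof (induction "rk G" arbitrary: G rule: less_induct)
  case less
  obtain G' i where cov: "covered_by G' i G" and FG': "F \<subseteq> G'"
    using obtain_covered[OF assms(1) less.prems] .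
  have G': "G' \<in> L" and rkG: "rk G = rk G' + 1" and i: "i \<notin> G'" and Gne: "G \<noteq> {}"
    using cov by (auto simp: covered_by_def)
  let ?h = "upper_sum L G :: (nat, 'k) flat_poly" and ?h' = "upper_sum L G' :: (nat, 'k) flat_poly"
  have h: "?h \<in> flat_polys L" using upper_sum_in Gne by auto
  show ?case
  proof (cases "F = G'")
    case True
    then have "flat_var1 F * ?h \<in> I"
      using upper_sum_times_var[OF cov G' subset_refl i] upper_sum_cover_empty[of i G] cov
      by (cases "G' = {}") (auto simp: flat_var1_def)
    then show ?thesis using True rkG by simp
  next
    case False
    then have sub: "F \<subset> G'" using FG' by blast
    then have lt: "rk F < rk G'" using rk_strict_mono assms(1) G' by blast
    define e where "e = rk G' - rk F"
    have IH: "flat_var1 F * ?h' ^ e \<in> I"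
      using less.hyps[of G'] G' rkG sub by (simp add: e_def)
    have eq: "rk G - rk F = Suc e" using rkG lt by (simp add: e_def)
    have "flat_var1 F * ?h ^ Suc e = ?h * (flat_var1 F * ?h' ^ e) - flat_var1 F * (?h * (?h' ^ e - ?h ^ e))"
      by (simp add: algebra_simps)
    also have "\<dots> \<in> I"
      using sub by (intro I_diff I_mult IH h flat_var1_in assms upper_sum_power_cover[OF cov]) auto
    finally show ?thesis using eq by simp
  qed
qed

text \<open>
  The weight is what increases in the rewriting to normal form; as the degree is preserved and the
  weight is at most \<open>n\<close> times the degree, the rewriting terminates.
\<close>

definition heavy :: "nat \<Rightarrow> nat \<Rightarrow> (nat, 'k) flat_poly \<Rightarrow> bool" where
  "heavy d w p \<longleftrightarrow> (\<forall>\<mu>\<in>keys p. keys \<mu> \<subseteq> L - {{}} \<and> total_degree \<mu> = d \<and> w \<le> monomial_weight \<mu>)"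

lemma heavy_add: "heavy d w p \<Longrightarrow> heavy d w q \<Longrightarrow> heavy d w (p + q)"
  unfolding heavy_def using keys_add[of p q] by blast

lemma heavy_sum: "(\<And>x. x \<in> A \<Longrightarrow> heavy d w (f x)) \<Longrightarrow> heavy d w (sum f A)"
proof (induction A rule: infinite_finite_induct)
  case (insert x F)
  then show ?case by (simp add: heavy_add)
qed (simp_all add: heavy_def)

lemma heavy_mult: "heavy d w p \<Longrightarrow> heavy d' w' q \<Longrightarrow> heavy (d + d') (w + w') (p * q)"
  unfolding heavy_def using keys_mult[of p q] by (fastforce intro: add_mono)

lemma heavy_power: "heavy d w p \<Longrightarrow> heavy (e * d) (e * w) (p ^ e)"
  by (induction e) (auto dest: heavy_mult simp: heavy_def[of 0])

lemma heavy_flat_var: "H \<in> L \<Longrightarrow> H \<noteq> {} \<Longrightarrow> w \<le> card H \<Longrightarrow> heavy 1 w (flat_var H)"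
  by (auto simp: heavy_def flat_var_def split: if_splits)

text \<open>Replacing \<open>x_G\<close> by the sum over the flats above \<open>G\<close> only adds monomials of larger weight, because
  those flats are larger.\<close>

lemma heavy_upper_sum_power_diff:
  assumes G: "G \<in> L" "G \<noteq> {}" and g: "0 < g"
  shows "heavy g (g * card G + 1) (upper_sum L G ^ g - flat_var G ^ g)"
proof -
  let ?h = "upper_sum L G :: (nat, 'k) flat_poly" and ?x = "flat_var G :: (nat, 'k) flat_poly"
  let ?A = "{H \<in> L. G \<subseteq> H}"
  have card: "card G + 1 \<le> card H" if "H \<in> L" "G \<subset> H" for H
    using that psubset_card_mono[of H G] finite_flat[of H] by simp
  have "?h = ?x + (\<Sum>H\<in>?A - {G}. flat_var H)"
    unfolding upper_sum_def using G by (subst sum.remove[of _ G]) (auto intro: finite_subset)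
  moreover have "heavy 1 (card G + 1) (\<Sum>H\<in>?A - {G}. flat_var H)"
    using G by (intro heavy_sum heavy_flat_var card) auto
  ultimately have diff: "heavy 1 (card G + 1) (?h - ?x)" by simp
  have h: "heavy 1 (card G) ?h"
    unfolding upper_sum_def using G by (intro heavy_sum heavy_flat_var card_mono) (auto intro: finite_flat)
  have x: "heavy 1 (card G) ?x" using G by (intro heavy_flat_var) auto
  obtain g' where g': "g = Suc g'" using g by (cases g) auto
  have "?h ^ g - ?x ^ g = (?h - ?x) * (\<Sum>p<g. ?h ^ p * ?x ^ (g' - p))"
    unfolding power_diff_sumr2 by (simp add: g' mult.commute)
  moreover have "heavy (1 + g') (card G + 1 + g' * card G) ((?h - ?x) * (\<Sum>p<g. ?h ^ p * ?x ^ (g' - p)))"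
  proof (intro heavy_mult diff heavy_sum)
    fix p assume "p \<in> {..<g}"
    then have p: "p + (g' - p) = g'" using g' by auto
    have "heavy (p * 1 + (g' - p) * 1) (p * card G + (g' - p) * card G) (?h ^ p * ?x ^ (g' - p))"
      by (intro heavy_mult heavy_power h x)
    then show "heavy g' (g' * card G) (?h ^ p * ?x ^ (g' - p))"
      using p by (simp flip: add_mult_distrib)
  qed
  moreover have "1 + g' = g" "card G + 1 + g' * card G = g * card G + 1" by (simp_all add: g')
  ultimately show ?thesis by (simp only:)
qed

definition fy_degree :: "nat \<Rightarrow> (nat set \<Rightarrow>\<^sub>0 nat) set" where
  "fy_degree d = {m \<in> fy_monomials r n. total_degree m = d}"

lemma finite_fy_degree [simp]: "finite (fy_degree d)"
  by (simp add: fy_degree_def)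

definition reducible :: "nat \<Rightarrow> (nat, 'k) flat_poly \<Rightarrow> bool" where
  "reducible d p \<longleftrightarrow> (\<exists>c. p - (\<Sum>s\<in>fy_degree d. single s (c s)) \<in> I)"

lemma reducible_add: "reducible d p \<Longrightarrow> reducible d q \<Longrightarrow> reducible d (p + q)"
proof -
  assume "reducible d p" "reducible d q"
  then obtain c c' where "p - (\<Sum>s\<in>fy_degree d. single s (c s)) \<in> I"
    "q - (\<Sum>s\<in>fy_degree d. single s (c' s)) \<in> I"
    by (auto simp: reducible_def)
  then have "p - (\<Sum>s\<in>fy_degree d. single s (c s)) + (q - (\<Sum>s\<in>fy_degree d. single s (c' s))) \<in> I"
    by (rule I_add)
  then have "p + q - (\<Sum>s\<in>fy_degree d. single s (c s + c' s)) \<in> I"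
    by (simp add: single_add sum.distrib algebra_simps)
  then show ?thesis unfolding reducible_def by (intro exI[of _ "\<lambda>s. c s + c' s"])
qed

lemma reducible_smult: "reducible d p \<Longrightarrow> reducible d (single 0 a * p)"
proof -
  assume "reducible d p"
  then obtain c where "p - (\<Sum>s\<in>fy_degree d. single s (c s)) \<in> I"
    by (auto simp: reducible_def)
  then have "single 0 a * (p - (\<Sum>s\<in>fy_degree d. single s (c s))) \<in> I"
    by (rule I_mult) auto
  then have "single 0 a * p - (\<Sum>s\<in>fy_degree d. single s (a * c s)) \<in> I"
    by (simp add: right_diff_distrib sum_distrib_left mult_single)
  then show ?thesis unfolding reducible_def by (intro exI[of _ "\<lambda>s. a * c s"])
qed

lemma reducible_ideal: "p \<in> I \<Longrightarrow> reducible d p"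
  unfolding reducible_def by (intro exI[of _ "\<lambda>s. 0"]) simp

lemma reducible_sum: "(\<And>x. x \<in> A \<Longrightarrow> reducible d (f x)) \<Longrightarrow> reducible d (sum f A)"
proof (induction A rule: infinite_finite_induct)
  case (insert x F)
  then show ?case by (simp add: reducible_add)
qed (simp_all add: reducible_ideal I_zero)

lemma reducible_keys:
  assumes "\<And>\<mu>. \<mu> \<in> keys p \<Longrightarrow> reducible d (single \<mu> 1)"
  shows "reducible d p"
proof -
  have "p = (\<Sum>m\<in>keys p. single 0 (lookup p m) * single m 1)"
    using poly_mapping_eq_sum_single[of p] by (simp add: mult_single)
  then show ?thesis
    using reducible_sum[of "keys p" d "\<lambda>m. single 0 (lookup p m) * single m 1"] reducible_smult assms
    by metis
qed

lemma monomial_weight_le: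
  assumes "keys m \<subseteq> L"
  shows "monomial_weight m \<le> total_degree m * n"
proof -
  have "monomial_weight m \<le> (\<Sum>F\<in>keys m. lookup m F * n)"
    unfolding monomial_weight_def
  proof (intro sum_mono mult_left_mono)
    fix F assume "F \<in> keys m"
    then have "F \<subseteq> E" using assms flat_subset by blast
    then have "card F \<le> card E" by (intro card_mono) auto
    then show "card F \<le> n" by simp
  qed auto
  then show ?thesis by (simp add: total_degree_def sum_distrib_right)
qed

text \<open>
  A monomial whose sets do not form a chain is in the ideal. If the exponent of \<open>G\<close> is too large for a
  lower set \<open>F\<close>, the relation \<open>flat_var_times_upper_sum_power\<close> replaces \<open>x_F * x_G ^ g\<close> by monomials of
  larger weight.
\<close>

lemma reducible_monomial:
  assumes "keys m \<subseteq> L - {{}}"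
  shows "reducible (total_degree m) (single m 1)"
  using assms
proof (induction "total_degree m * n - monomial_weight m" arbitrary: m rule: less_induct)
  case less
  show ?case
  proof (cases "\<forall>F\<in>keys m. \<forall>G\<in>keys m. F \<subseteq> G \<or> G \<subseteq> F")
    case False
    then obtain F G where FG: "F \<in> keys m" "G \<in> keys m" "\<not> F \<subseteq> G" "\<not> G \<subseteq> F"
      by blast
    obtain m1 where m1: "m = m1 + single F 1"
      using split_monomial[of 1 m F] FG by (auto simp: in_keys_iff Suc_le_eq)
    have "F \<noteq> G" using FG by auto
    then have "G \<in> keys m1" using FG m1 by (auto split: if_splits)
    then obtain m2 where m2: "m1 = m2 + single G 1"
      using split_monomial[of 1 m1 G] by (auto simp: in_keys_iff Suc_le_eq)
    have "single m 1 = single m2 1 * (flat_var F * flat_var G :: (nat, 'k) flat_poly)"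
      by (simp add: m1 m2 flat_var_def mult_single ac_simps)
    also have "\<dots> \<in> I"
      unfolding I_def using less.prems FG m1 m2
      by (intro chow_ideal_mult incomparable_in_chow_ideal flat_polys_single) auto
    finally show ?thesis by (rule reducible_ideal)
  next
    case chain: True
    show ?thesis
    proof (cases "m \<in> fy_monomials r n")
      case True
      then have "(\<Sum>s\<in>fy_degree (total_degree m). single s (if s = m then 1 else 0)) = single m (1::'k)"
        by (subst sum.remove[of _ m]) (auto simp: fy_degree_def intro!: sum.neutral)
      then show ?thesis unfolding reducible_def
        by (intro exI[of _ "\<lambda>s. if s = m then 1 else 0"]) (simp add: I_def)
    next
      case False
      then obtain G F where G: "G \<in> keys m" and F: "F \<in> insert {} (keys m)" "F \<subset> G"
        and big: "rk G \<le> lookup m G + rk F"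
        using less.prems chain by (fastforce simp: fy_monomials_def nested_def)
      have GL: "G \<in> L" "G \<noteq> {}" and FL: "F \<in> L"
        using G F less.prems by (auto simp: flat_iff[of "{}"])
      define g where "g = rk G - rk F"
      have g: "0 < g" "g \<le> lookup m G"
        using rk_strict_mono[OF FL GL(1) F(2)] big by (auto simp: g_def)
      obtain m1 where m1: "m = m1 + single G g" using split_monomial[OF g(2)] by blast
      have "\<exists>m2. m1 = m2 + (if F = {} then 0 else single F 1)"
      proof (cases "F = {}")
        case False
        then have "F \<in> keys m1" using F m1 by (auto split: if_splits)
        then show ?thesis using split_monomial[of 1 m1 F] False by (auto simp: in_keys_iff Suc_le_eq)
      qed auto
      then obtain m2 where m2: "m1 = m2 + (if F = {} then 0 else single F 1)" by blast
      have m2_in: "keys m2 \<subseteq> L - {{}}" using less.prems m1 m2 by auto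
      let ?u = "single m2 1 :: (nat, 'k) flat_poly"
      let ?h = "upper_sum L G :: (nat, 'k) flat_poly" and ?x = "flat_var G :: (nat, 'k) flat_poly"
      have eq: "single m 1 = ?u * flat_var1 F * ?x ^ g"
        by (simp add: m1 m2 flat_var1_def flat_var_power) (simp add: flat_var_def mult_single)
      have u: "heavy (total_degree m2) (monomial_weight m2) ?u"
        using m2_in by (auto simp: heavy_def)
      have f: "heavy (if F = {} then 0 else 1) (card F) (flat_var1 F)"
        using F FL by (auto simp: flat_var1_def heavy_def[of 0] intro!: heavy_flat_var)
      have "heavy (total_degree m2 + (if F = {} then 0 else 1) + g)
          (monomial_weight m2 + card F + (g * card G + 1)) (?u * flat_var1 F * (?h ^ g - ?x ^ g))"
        by (intro heavy_mult u f heavy_upper_sum_power_diff GL g)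
      then have heavy: "heavy (total_degree m) (monomial_weight m + 1) (?u * flat_var1 F * (?h ^ g - ?x ^ g))"
        by (simp add: m1 m2 add.assoc split: if_splits)
      have "reducible (total_degree m) (?u * flat_var1 F * (?h ^ g - ?x ^ g))"
      proof (rule reducible_keys)
        fix \<mu> assume "\<mu> \<in> keys (?u * flat_var1 F * (?h ^ g - ?x ^ g))"
        then have \<mu>: "keys \<mu> \<subseteq> L - {{}}" "total_degree \<mu> = total_degree m"
          "monomial_weight m + 1 \<le> monomial_weight \<mu>"
          using heavy by (auto simp: heavy_def)
        moreover have "monomial_weight \<mu> \<le> total_degree \<mu> * n"
          by (rule monomial_weight_le) (use \<mu> in auto)
        ultimately show "reducible (total_degree m) (single \<mu> 1)"
          using less.hyps[of \<mu>] by simp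
      qed
      then have red: "reducible (total_degree m) (single 0 (- 1) * (?u * flat_var1 F * (?h ^ g - ?x ^ g)))"
        by (rule reducible_smult)
      have "?u * (flat_var1 F * ?h ^ g) \<in> I"
        unfolding g_def using m2_in
        by (intro I_mult flat_var_times_upper_sum_power FL GL F flat_polys_single)
      then have "reducible (total_degree m) (?u * (flat_var1 F * ?h ^ g) +
          single 0 (- 1) * (?u * flat_var1 F * (?h ^ g - ?x ^ g)))"
        by (intro reducible_add red reducible_ideal)
      moreover have "?u * (flat_var1 F * ?h ^ g) +
          single 0 (- 1) * (?u * flat_var1 F * (?h ^ g - ?x ^ g)) = single m 1"
        unfolding eq by (simp add: single_uminus algebra_simps)
      ultimately show ?thesis by simp
    qed
  qed
qed

lemma reducible_homogeneous:
  assumes "p \<in> flat_polys L" "homogeneous d p"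
  shows "reducible d p"
proof (rule reducible_keys)
  fix \<mu> assume "\<mu> \<in> keys p"
  then have "keys \<mu> \<subseteq> L - {{}}" "total_degree \<mu> = d"
    using assms by (auto simp: flat_polys_iff homogeneous_def total_degree_def)
  then show "reducible d (single \<mu> 1)" using reducible_monomial[of \<mu>] by simp
qed

end

end

section \<open>Counting nested monomials by their largest set\<close>

definition relabel_monomial :: "('e set \<Rightarrow> 'e set) \<Rightarrow> ('e set \<Rightarrow>\<^sub>0 nat) \<Rightarrow> ('e set \<Rightarrow>\<^sub>0 nat)" where
  "relabel_monomial g m = (\<Sum>F\<in>keys m. single (g F) (lookup m F))"

lemma relabel_monomial_superset:
  "finite A \<Longrightarrow> keys m \<subseteq> A \<Longrightarrow> relabel_monomial g m = (\<Sum>F\<in>A. single (g F) (lookup m F))"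
  unfolding relabel_monomial_def by (rule sum.mono_neutral_left) (auto simp: in_keys_iff)

lemma relabel_monomial_add [simp]:
  "relabel_monomial g (a + b) = relabel_monomial g a + relabel_monomial g b"
  by (simp add: relabel_monomial_superset[of "keys a \<union> keys b"] lookup_add single_add sum.distrib)

lemma relabel_monomial_0 [simp]: "relabel_monomial g 0 = 0"
  by (simp add: relabel_monomial_def)

lemma relabel_monomial_single [simp]: "relabel_monomial g (single F k) = single (g F) k"
  by (cases "k = 0") (simp_all add: relabel_monomial_def)

lemma relabel_monomial_cong:
  "(\<And>F. F \<in> keys m \<Longrightarrow> g F = g' F) \<Longrightarrow> relabel_monomial g m = relabel_monomial g' m"
  by (simp add: relabel_monomial_def)

lemma relabel_monomial_relabel: "relabel_monomial g (relabel_monomial g' m) = relabel_monomial (g \<circ> g') m"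
proof -
  have *: "relabel_monomial g (sum h A) = (\<Sum>x\<in>A. relabel_monomial g (h x))" for h and A :: "'a set set"
    by (induction A rule: infinite_finite_induct) simp_all
  show ?thesis by (simp add: relabel_monomial_def[of g'] relabel_monomial_def[of "g \<circ> g'"] *)
qed

lemma relabel_monomial_id [simp]: "relabel_monomial (\<lambda>F. F) m = m" "relabel_monomial id m = m"
  by (simp_all add: relabel_monomial_def flip: poly_mapping_eq_sum_single)

lemma total_degree_relabel [simp]: "total_degree (relabel_monomial g m) = total_degree m"
  by (simp add: relabel_monomial_def) (simp add: total_degree_def)

lemma keys_relabel_monomial: "keys (relabel_monomial g m) = g ` keys m"
  by (auto simp: relabel_monomial_def keys_sum_nat in_keys_iff split: if_splits)

definition top_monomials :: "'e set \<Rightarrow> ('e set \<Rightarrow>\<^sub>0 nat) set" where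
  "top_monomials K = {m. {} \<notin> keys m \<and> nested card m \<and> \<Union>(keys m) = K}"

lemma top_monomials_empty: "top_monomials {} = {0}"
proof -
  have "m = 0" if "m \<in> top_monomials {}" for m :: "'a set \<Rightarrow>\<^sub>0 nat"
  proof -
    have "keys m \<subseteq> {{}}" "{} \<notin> keys m" using that by (auto simp: top_monomials_def)
    then have "keys m = {}" by blast
    then show ?thesis by simp
  qed
  then show ?thesis by (auto simp: top_monomials_def nested_def)
qed

text \<open>
  The element \<open>{}\<close> is for the empty chain, whose union it is.
\<close>

lemma Union_chain_in:
  assumes "finite C" "\<forall>F\<in>C. \<forall>G\<in>C. F \<subseteq> G \<or> G \<subseteq> F"
  shows "\<Union>C \<in> insert {} C"
  using assms
proof (induction C rule: finite_induct)
  case (insert x C)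
  then have IH: "\<Union>C \<in> insert {} C" by auto
  show ?case
  proof (cases "\<Union>C \<in> C")
    case True
    then have "\<Union>C \<subseteq> x \<or> x \<subseteq> \<Union>C" using insert.prems by auto
    then have "\<Union>(insert x C) = x \<or> \<Union>(insert x C) = \<Union>C" by auto
    then show ?thesis using True by (metis insertI1 insertI2)
  next
    case False
    then show ?thesis using IH by auto
  qed
qed auto

lemma nested_cong:
  assumes "\<And>F. F \<in> insert {} (keys m) \<Longrightarrow> rk F = rk' F"
  shows "nested rk m \<longleftrightarrow> nested rk' m"
proof -
  have "nested rk' m" if "nested rk m" "\<And>F. F \<in> insert {} (keys m) \<Longrightarrow> rk F = rk' F" for rk rk' :: "'a set \<Rightarrow> nat"
    using that unfolding nested_def by simp
  from this[of rk rk'] this[of rk' rk] show ?thesis using assms by metis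
qed

text \<open>
  Only the largest set \<open>F\<close> below \<open>K\<close> matters for the exponent of \<open>K\<close>, because the rank is monotone.
\<close>

lemma nested_add_top:
  assumes F: "F = \<Union>(keys m)" and K: "F \<subset> K" and a: "0 < a"
    and mono: "\<And>G. G \<subseteq> F \<Longrightarrow> rk G \<le> rk F"
  shows "nested rk (m + single K a) \<longleftrightarrow> nested rk m \<and> a + rk F < rk K"
proof -
  have Kn: "K \<notin> keys m" using F K by auto
  have sub: "G \<subset> K" if "G \<in> insert {} (keys m)" for G using that F K by auto
  have keys: "keys (m + single K a) = insert K (keys m)" using a by auto
  have lk: "lookup (m + single K a) K = a" using Kn by (simp add: lookup_add in_keys_iff)
  have lG: "lookup (m + single K a) G = lookup m G" if "G \<in> keys m" for G
    using that Kn by (auto simp: lookup_add lookup_single when_def)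
  show ?thesis
  proof
    assume N: "nested rk (m + single K a)"
    then have chain: "\<forall>F\<in>keys m. \<forall>G\<in>keys m. F \<subseteq> G \<or> G \<subseteq> F"
      and gap: "\<And>G F. G \<in> insert K (keys m) \<Longrightarrow> F \<in> insert {} (insert K (keys m)) \<Longrightarrow> F \<subset> G \<Longrightarrow>
        lookup (m + single K a) G + rk F < rk G"
      unfolding nested_def keys by blast+
    have "F \<in> insert {} (keys m)" unfolding F by (rule Union_chain_in[OF _ chain]) simp
    then have "a + rk F < rk K" using gap[of K F] K lk by auto
    moreover have "nested rk m"
      unfolding nested_def
    proof (intro conjI chain ballI impI)
      fix G F assume "G \<in> keys m" "F \<in> insert {} (keys m)" "F \<subset> G"
      then show "lookup m G + rk F < rk G" using gap[of G F] lG[of G] by auto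
    qed
    ultimately show "nested rk m \<and> a + rk F < rk K" by simp
  next
    assume N: "nested rk m \<and> a + rk F < rk K"
    have "lookup (m + single K a) G + rk G' < rk G"
      if G: "G \<in> insert K (keys m)" and G': "G' \<in> insert {} (insert K (keys m))" "G' \<subset> G" for G G'
    proof (cases "G = K")
      case True
      then have "G' \<subseteq> F" using G' F by auto
      then have "rk G' \<le> rk F" by (rule mono)
      then show ?thesis using N True lk by simp
    next
      case False
      then have GG: "G \<in> keys m" "G' \<in> insert {} (keys m)" using G G' sub by auto
      have "\<forall>G\<in>keys m. \<forall>F\<in>insert {} (keys m). F \<subset> G \<longrightarrow> lookup m G + rk F < rk G"
        using N unfolding nested_def by (elim conjE)
      then have "lookup m G + rk G' < rk G" using GG G'(2) by (metis (no_types))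
      then show ?thesis using lG[OF GG(1)] by simp
    qed
    moreover have "\<forall>F\<in>insert K (keys m). \<forall>G\<in>insert K (keys m). F \<subseteq> G \<or> G \<subseteq> F"
      using N sub unfolding nested_def by blast
    ultimately show "nested rk (m + single K a)" unfolding nested_def keys by blast
  qed
qed

lemma split_top:
  fixes m :: "'e set \<Rightarrow>\<^sub>0 nat"
  assumes chain: "\<forall>F\<in>keys m. \<forall>G\<in>keys m. F \<subseteq> G \<or> G \<subseteq> F" and sub: "keys m \<subseteq> Pow K" and K: "K \<noteq> {}"
  obtains m' where "m = m' + single K (lookup m K)" "K \<notin> keys m'" "keys m' = keys m - {K}"
    "\<Union>(keys m') \<subset> K"
proof -
  obtain m' where m': "m = m' + single K (lookup m K)"
    using split_monomial[of "lookup m K" m K] by blast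
  have "lookup m K = lookup m' K + lookup m K"
    using arg_cong[OF m', of "\<lambda>m. lookup m K"] by (simp add: lookup_add)
  then have n: "K \<notin> keys m'" by (simp add: in_keys_iff)
  then have "keys m' = keys (m' + single K (lookup m K)) - {K}"
    by (auto split: if_splits)
  then have keys: "keys m' = keys m - {K}" using m' by simp
  have "\<Union>(keys m') \<in> insert {} (keys m')"
    by (rule Union_chain_in) (use chain keys in auto)
  then have "\<Union>(keys m') \<noteq> K" using n K by auto
  moreover have "\<Union>(keys m') \<subseteq> K" using keys sub by auto
  ultimately show ?thesis using that[OF m' n keys] by blast
qed

lemma add_top_inj:
  assumes "m + single K a = m' + single K a'" "K \<notin> keys m" "K \<notin> keys m'"
  shows "m = m' \<and> a = (a' :: nat)"
proof -
  have "a = a'"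
    using arg_cong[OF assms(1), of "\<lambda>m. lookup m K"] assms(2,3) by (simp add: lookup_add in_keys_iff)
  then show ?thesis using assms(1) by simp
qed

lemma top_monomials_bij:
  assumes K: "finite K" "K \<noteq> {}"
  shows "bij_betw (\<lambda>(F, a, m). m + single K a)
    (SIGMA F:{F. F \<subset> K}. {1..<card K - card F} \<times> top_monomials F) (top_monomials K)"
    (is "bij_betw ?f ?D _")
proof (rule bij_betw_imageI)
  have top: "K \<notin> keys m" if "m \<in> top_monomials F" "F \<subset> K" for m F
    using that by (auto simp: top_monomials_def)
  show "inj_on ?f ?D"
  proof (rule inj_onI)
    fix x y assume x: "x \<in> ?D" and y: "y \<in> ?D" and eq: "?f x = ?f y"
    obtain F a m F' a' m' where xy: "x = (F, a, m)" "y = (F', a', m')" by (cases x, cases y) auto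
    have "m = m' \<and> a = a'"
      using eq x y top[of m F] top[of m' F'] by (intro add_top_inj[of m K a m' a']) (auto simp: xy)
    then show "x = y" using x y by (auto simp: xy top_monomials_def)
  qed
  show "?f ` ?D = top_monomials K"
  proof (intro equalityI subsetI)
    fix y assume "y \<in> ?f ` ?D"
    then obtain p where p: "p \<in> ?D" "y = ?f p" by blast
    obtain F a m where "p = (F, a, m)" by (cases p)
    with p have y: "y = m + single K a" and F: "F \<subset> K" and a: "a \<in> {1..<card K - card F}"
      and m: "m \<in> top_monomials F" by auto
    have "nested card y"
      unfolding y using a m F K finite_subset[of F K]
      by (subst nested_add_top[of F]) (auto simp: top_monomials_def intro!: card_mono)
    then show "y \<in> top_monomials K" using a m F K by (auto simp: top_monomials_def y)
  next
    fix m assume m: "m \<in> top_monomials K"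
    then have chain: "\<forall>F\<in>keys m. \<forall>G\<in>keys m. F \<subseteq> G \<or> G \<subseteq> F" and sub: "keys m \<subseteq> Pow K"
      by (auto simp: top_monomials_def nested_def)
    obtain m' where m': "m = m' + single K (lookup m K)" "K \<notin> keys m'" "keys m' = keys m - {K}"
      and F: "\<Union>(keys m') \<subset> K"
      using split_top[OF chain sub K(2)] .
    let ?F = "\<Union>(keys m')" and ?a = "lookup m K"
    have "\<Union>(keys m) = K" using m by (simp add: top_monomials_def)
    then have "K \<in> keys m" using Union_chain_in[OF _ chain] K(2) by auto
    then have a: "0 < ?a" by (simp add: in_keys_iff)
    have fin: "finite ?F" using F K(1) by (meson finite_subset psubset_imp_subset)
    have "nested card m' \<and> ?a + card ?F < card K"
      using m by (subst nested_add_top[OF refl F a, symmetric])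
        (auto simp: top_monomials_def fin simp flip: m'(1) intro!: card_mono)
    then have "(?F, ?a, m') \<in> ?D" using m F a m'(3) by (auto simp: top_monomials_def)
    then show "m \<in> ?f ` ?D" using m'(1) by (intro image_eqI[of _ _ "(?F, ?a, m')"]) auto
  qed
qed

lemma (in uniform) fy_monomials_bij:
  "bij_betw (\<lambda>(F, a, m). m + single E a)
    (SIGMA F:{F. F \<subset> E \<and> card F \<le> r - 1}. {..<r - card F} \<times> top_monomials F) (fy_monomials r n)"
    (is "bij_betw ?f ?D _")
proof (rule bij_betw_imageI)
  have top: "E \<notin> keys m" if "m \<in> top_monomials F" "F \<subset> E" for m F
    using that by (auto simp: top_monomials_def)
  have rk_card: "rk G = card G" if "G \<subseteq> F" "F \<subset> E" "card F \<le> r - 1" for G F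
    using that card_mono[of F G] finite_subset[of F E] by (auto simp: uniform_rank_def)
  have rkE: "rk E = r" using rk_flat[of E] by (simp add: flat_iff)
  have nested_iff: "nested rk m \<longleftrightarrow> nested card m"
    if "\<Union>(keys m) = F" "F \<subset> E" "card F \<le> r - 1" for m F
    using that by (intro nested_cong rk_card) auto
  show "inj_on ?f ?D"
  proof (rule inj_onI)
    fix x y assume x: "x \<in> ?D" and y: "y \<in> ?D" and eq: "?f x = ?f y"
    obtain F a m F' a' m' where xy: "x = (F, a, m)" "y = (F', a', m')" by (cases x, cases y) auto
    have "m = m' \<and> a = a'"
      using eq x y top[of m F] top[of m' F'] by (intro add_top_inj[of m E a m' a']) (auto simp: xy)
    then show "x = y" using x y by (auto simp: xy top_monomials_def)
  qed
  show "?f ` ?D = fy_monomials r n"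
  proof (intro equalityI subsetI)
    fix y assume "y \<in> ?f ` ?D"
    then obtain p where p: "p \<in> ?D" "y = ?f p" by blast
    obtain F a m where "p = (F, a, m)" by (cases p)
    with p have y: "y = m + single E a" and F: "F \<subset> E" "card F \<le> r - 1"
      and a: "a < r - card F" and m: "{} \<notin> keys m" "nested card m" "\<Union>(keys m) = F"
      by (auto simp: top_monomials_def)
    have mono: "rk G \<le> rk F" if "G \<subseteq> F" for G
      using that F card_mono[of F G] finite_subset[of F E]
      by (simp add: rk_card[OF that F] rk_card[OF subset_refl F])
    have "nested rk y"
    proof (cases "a = 0")
      case True
      then show ?thesis using m F nested_iff by (simp add: y)
    next
      case False
      then have "0 < a" by simp
      then have "nested rk (m + single E a) \<longleftrightarrow> nested rk m \<and> a + rk F < rk E"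
        using m(3) F(1) mono by (intro nested_add_top) auto
      then show ?thesis
        using m F nested_iff a by (simp add: y rk_card[OF subset_refl F] rkE less_diff_conv)
    qed
    moreover have "G \<in> L" if "G \<in> keys m" for G
      using that m F card_mono[of F G] finite_subset[of F E] by (fastforce simp: flat_iff)
    ultimately show "y \<in> fy_monomials r n"
      using m(1) E_nonempty by (auto simp: fy_monomials_def y flat_iff[of E])
  next
    fix m assume m: "m \<in> fy_monomials r n"
    then have chain: "\<forall>F\<in>keys m. \<forall>G\<in>keys m. F \<subseteq> G \<or> G \<subseteq> F" and sub: "keys m \<subseteq> Pow E"
      by (auto simp: fy_monomials_def nested_def dest!: flat_subset)
    obtain m' where m': "m = m' + single E (lookup m E)" "E \<notin> keys m'" "keys m' = keys m - {E}"
      and F: "\<Union>(keys m') \<subset> E"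
      using split_top[OF chain sub E_nonempty] .
    let ?F = "\<Union>(keys m')" and ?a = "lookup m E"
    have "?F \<in> insert {} (keys m')"
      by (rule Union_chain_in) (use chain m' in auto)
    moreover have "keys m' \<subseteq> L" using m m'(3) by (auto simp: fy_monomials_def)
    moreover have "{} \<in> L" by (simp add: flat_iff)
    ultimately have "?F \<in> L" by (metis insertE subsetD)
    then have cF: "card ?F \<le> r - 1" using F unfolding flat_iff by blast
    have mono: "rk G \<le> rk ?F" if "G \<subseteq> ?F" for G
      using that F cF card_mono[of ?F G] finite_subset[of ?F E]
      by (simp add: rk_card[OF that F cF] rk_card[OF subset_refl F cF])
    have "nested rk m" using m by (simp add: fy_monomials_def)
    then have "nested rk m' \<and> ?a < r - card ?F"
    proof (cases "?a = 0")
      case True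
      then show ?thesis using m'(1) \<open>nested rk m\<close> cF r_pos by simp
    next
      case False
      then have a: "0 < ?a" by simp
      have "nested rk m' \<and> ?a + rk ?F < rk E"
        using \<open>nested rk m\<close> nested_add_top[where rk = rk, OF refl F a mono] m'(1) by simp
      then show ?thesis by (simp add: rk_card[OF subset_refl F cF] rkE less_diff_conv)
    qed
    then have "(?F, ?a, m') \<in> ?D"
      using m F cF m'(3) nested_iff[OF refl F cF] by (auto simp: top_monomials_def fy_monomials_def)
    then show "m \<in> ?f ` ?D" using m'(1) by (intro image_eqI[of _ _ "(?F, ?a, m')"]) auto
  qed
qed

lemma sum_psubsets_card:
  fixes f :: "nat \<Rightarrow> 'a::comm_semiring_1"
  assumes "finite K"
  shows "(\<Sum>F | F \<subset> K. f (card F)) = (\<Sum>j<card K. of_nat (card K choose j) * f j)"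
proof -
  have "(\<Sum>F | F \<subset> K. f (card F)) = (\<Sum>j<card K. \<Sum>F\<in>{F \<in> {F. F \<subset> K}. card F = j}. f (card F))"
    using assms by (intro sum.group[symmetric]) (auto intro: psubset_card_mono finite_subset[of _ "Pow K"])
  also have "\<dots> = (\<Sum>j<card K. of_nat (card K choose j) * f j)"
  proof (rule sum.cong)
    fix j assume j: "j \<in> {..<card K}"
    then have "{F \<in> {F. F \<subset> K}. card F = j} = {F. F \<subseteq> K \<and> card F = j}"
      by auto
    then show "(\<Sum>F\<in>{F \<in> {F. F \<subset> K}. card F = j}. f (card F)) = of_nat (card K choose j) * f j"
      using n_subsets[OF assms, of j] by simp
  qed simp
  finally show ?thesis .
qed

definition fixed_monomials :: "(nat \<Rightarrow> nat) \<Rightarrow> (nat set \<Rightarrow>\<^sub>0 nat) set \<Rightarrow> (nat set \<Rightarrow>\<^sub>0 nat) set" where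
  "fixed_monomials \<sigma> M = {m \<in> M. relabel_monomial (image \<sigma>) m = m}"

definition top_series :: "'r::comm_ring_1 \<Rightarrow> nat set \<Rightarrow> (nat \<Rightarrow> nat) \<Rightarrow> 'r" where
  "top_series t K \<sigma> = (\<Sum>m\<in>fixed_monomials \<sigma> (top_monomials K). t ^ total_degree m)"

lemma finite_top_monomials:
  assumes "finite K"
  shows "finite (top_monomials K)"
proof (rule finite_subset[OF _ finite_bounded_poly_mappings[of "Pow K" "card K"]])
  show "top_monomials K \<subseteq> {m. keys m \<subseteq> Pow K \<and> (\<forall>x. lookup m x \<le> card K)}"
  proof
    fix m assume m: "m \<in> top_monomials K"
    have "lookup m G \<le> card K" for G
    proof (cases "G \<in> keys m")
      case True
      then have "{} \<subset> G" "G \<subseteq> K" using m by (auto simp: top_monomials_def)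
      then have "lookup m G < card G" using m True unfolding top_monomials_def nested_def by fastforce
      also have "card G \<le> card K" using \<open>G \<subseteq> K\<close> assms by (rule card_mono[rotated])
      finally show ?thesis by simp
    qed (simp add: in_keys_iff)
    moreover have "keys m \<subseteq> Pow K" using m by (auto simp: top_monomials_def)
    ultimately show "m \<in> {m. keys m \<subseteq> Pow K \<and> (\<forall>x. lookup m x \<le> card K)}"
      by simp
  qed
qed (use assms in simp)

lemma top_series_cong:
  assumes "\<And>x. x \<in> K \<Longrightarrow> \<sigma> x = \<tau> x"
  shows "top_series t K \<sigma> = top_series t K \<tau>"
proof -
  have "fixed_monomials \<sigma> (top_monomials K) = fixed_monomials \<tau> (top_monomials K)"
  proof -
    have "relabel_monomial (image \<sigma>) m = relabel_monomial (image \<tau>) m" if "m \<in> top_monomials K" for m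
      using that assms by (intro relabel_monomial_cong image_cong) (auto simp: top_monomials_def)
    then show ?thesis by (auto simp: fixed_monomials_def)
  qed
  then show ?thesis by (simp add: top_series_def)
qed

lemma top_series_empty [simp]: "top_series t {} \<sigma> = 1"
  by (simp add: top_series_def top_monomials_empty fixed_monomials_def cong: conj_cong)

text \<open>
  \<open>F\<close> is the union of the sets of \<open>m\<close>, which \<open>\<sigma>\<close> permutes.
\<close>

lemma fixed_top_image:
  assumes "m \<in> fixed_monomials \<sigma> (top_monomials F)"
  shows "\<sigma> ` F = F"
proof -
  have "image \<sigma> ` keys m = keys m"
    using assms keys_relabel_monomial[of "image \<sigma>" m] by (simp add: fixed_monomials_def)
  then have "\<Union>(image \<sigma> ` keys m) = \<Union>(keys m)" by simp
  then have "\<sigma> ` \<Union>(keys m) = \<Union>(keys m)" by (simp add: image_Union)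
  then show ?thesis using assms by (simp add: fixed_monomials_def top_monomials_def)
qed

text \<open>
  As \<open>\<sigma>\<close> preserves \<open>K\<close>, it fixes \<open>m + single K a\<close> if and only if it fixes \<open>m\<close>, and then it preserves the
  largest set \<open>F\<close> of \<open>m\<close>.
\<close>

lemma fixed_add_top_series:
  assumes K: "finite K" "\<sigma> permutes K" and \<F>: "\<F> \<subseteq> {F. F \<subset> K}"
    and bij: "bij_betw (\<lambda>(F, a, m). m + single K a) (SIGMA F:\<F>. A F \<times> top_monomials F) M"
    and fin: "\<And>F. finite (A F)"
  shows "(\<Sum>m\<in>fixed_monomials \<sigma> M. t ^ total_degree m) =
    (\<Sum>F | F \<in> \<F> \<and> \<sigma> ` F = F. top_series t F \<sigma> * (\<Sum>a\<in>A F. (t :: 'r::comm_ring_1) ^ a))"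
proof -
  let ?w = "\<lambda>m. if relabel_monomial (image \<sigma>) m = m then t ^ total_degree m else 0"
  let ?D = "SIGMA F:\<F>. A F \<times> top_monomials F"
  have fin\<F>: "finite \<F>" using \<F> K(1) by (auto intro: finite_subset[of _ "Pow K"])
  have finT: "finite (top_monomials F)" if "F \<in> \<F>" for F
    using that \<F> K(1) by (intro finite_top_monomials) (auto intro: finite_subset)
  have finM: "finite M"
    using bij_betw_finite[OF bij] fin fin\<F> finT by auto
  have "(\<Sum>m\<in>fixed_monomials \<sigma> M. t ^ total_degree m) = (\<Sum>m\<in>M. ?w m)"
    unfolding fixed_monomials_def using finM by (subst sum.inter_filter) auto
  also have "\<dots> = (\<Sum>(F, a, m)\<in>?D. ?w (m + single K a))"
    by (subst sum.reindex_bij_betw[OF bij, symmetric]) (auto intro!: sum.cong)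
  also have "\<dots> = (\<Sum>(F, a, m)\<in>?D. t ^ a * ?w m)"
  proof (rule sum.cong)
    fix x assume "x \<in> ?D"
    obtain F a m where x: "x = (F, a, m)" by (cases x)
    have "relabel_monomial (image \<sigma>) (m + single K a) = m + single K a \<longleftrightarrow> relabel_monomial (image \<sigma>) m = m"
      using permutes_image[OF K(2)] by simp
    then show "(case x of (F, a, m) \<Rightarrow> ?w (m + single K a)) = (case x of (F, a, m) \<Rightarrow> t ^ a * ?w m)"
      by (simp add: x power_add mult.commute)
  qed simp
  also have "\<dots> = (\<Sum>F\<in>\<F>. \<Sum>p\<in>A F \<times> top_monomials F. t ^ fst p * ?w (snd p))"
    using fin\<F> fin finT by (subst sum.Sigma) (auto simp: case_prod_unfold)
  also have "\<dots> = (\<Sum>F\<in>\<F>. (\<Sum>a\<in>A F. t ^ a) * (\<Sum>m\<in>top_monomials F. ?w m))"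
    by (simp add: sum_product sum.cartesian_product case_prod_unfold)
  also have "\<dots> = (\<Sum>F\<in>\<F>. top_series t F \<sigma> * (\<Sum>a\<in>A F. t ^ a))"
    using finT by (intro sum.cong refl) (simp add: top_series_def fixed_monomials_def sum.inter_filter mult.commute)
  also have "\<dots> = (\<Sum>F | F \<in> \<F> \<and> \<sigma> ` F = F. top_series t F \<sigma> * (\<Sum>a\<in>A F. t ^ a))"
  proof (rule sum.mono_neutral_right[OF fin\<F>])
    show "\<forall>F\<in>\<F> - {F. F \<in> \<F> \<and> \<sigma> ` F = F}. top_series t F \<sigma> * (\<Sum>a\<in>A F. t ^ a) = 0"
    proof
      fix F assume "F \<in> \<F> - {F. F \<in> \<F> \<and> \<sigma> ` F = F}"
      then have "fixed_monomials \<sigma> (top_monomials F) = {}" using fixed_top_image by blast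
      then show "top_series t F \<sigma> * (\<Sum>a\<in>A F. t ^ a) = 0" by (simp add: top_series_def)
    qed
  qed auto
  finally show ?thesis .
qed

lemma top_series_rec:
  assumes "finite K" "K \<noteq> {}" "\<sigma> permutes K"
  shows "top_series t K \<sigma> =
    (\<Sum>F | F \<subset> K \<and> \<sigma> ` F = F. top_series t F \<sigma> * (\<Sum>a=1..<card K - card F. (t :: 'r::comm_ring_1) ^ a))"
  unfolding top_series_def[of t K]
  using fixed_add_top_series[OF assms(1,3) _ top_monomials_bij[OF assms(1,2)], of t] by simp

lemma (in uniform) fy_series:
  assumes "\<sigma> permutes E"
  shows "(\<Sum>m\<in>fixed_monomials \<sigma> (fy_monomials r n). t ^ total_degree m) =
    (\<Sum>F | F \<subset> E \<and> card F \<le> r - 1 \<and> \<sigma> ` F = F.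
       top_series t F \<sigma> * (\<Sum>a<r - card F. (t :: 'r::comm_ring_1) ^ a))"
  using fixed_add_top_series[OF _ assms _ fy_monomials_bij, of t] by (simp add: Collect_mono conj_assoc)

section \<open>The number of nested monomials of the Boolean matroid\<close>

fun top_count :: "nat \<Rightarrow> int" where
  "top_count k = (if k = 0 then 1 else \<Sum>j<k. of_nat (k choose j) * (top_count j * of_nat (k - j - 1)))"

declare top_count.simps [simp del]

lemma top_series_one:
  assumes "finite K"
  shows "top_series (1::int) K id = top_count (card K)"
  using assms
proof (induction "card K" arbitrary: K rule: less_induct)
  case less
  show ?case
  proof (cases "K = {}")
    case True
    then show ?thesis by (simp add: top_count.simps)
  next
    case False
    have "top_series (1::int) K id = (\<Sum>F | F \<subset> K. top_series 1 F id * int (card K - card F - 1))"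
      using less.prems False by (subst top_series_rec) (auto simp: permutes_id)
    also have "\<dots> = (\<Sum>F | F \<subset> K. top_count (card F) * int (card K - card F - 1))"
    proof (rule sum.cong)
      fix F assume "F \<in> {F. F \<subset> K}"
      then have "card F < card K" "finite F"
        using less.prems by (auto intro: psubset_card_mono finite_subset)
      then show "top_series 1 F id * int (card K - card F - 1) = top_count (card F) * int (card K - card F - 1)"
        using less.hyps by simp
    qed simp
    also have "\<dots> = top_count (card K)"
      using less.prems False
      by (subst sum_psubsets_card[where f = "\<lambda>j. top_count j * int (card K - j - 1)"])
        (auto simp: top_count.simps[of "card K"])
    finally show ?thesis .
  qed
qed

text \<open>
  With \<open>a\<^sub>j\<close> for the values above and \<open>N\<^sub>n\<close> for the sum below, the recursion for \<open>a\<^sub>n\<close> gives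
  \<open>N\<^sub>n = \<Sum>j\<le>n. (n choose j) * a\<^sub>j\<close>, while absorption gives \<open>N\<^sub>n = n * (\<Sum>j<n. (n - 1 choose j) * a\<^sub>j)\<close>.
\<close>

lemma sum_top_count:
  "(\<Sum>j<Suc n. int (Suc n choose j) * (top_count j * int (Suc n - j))) = fact (Suc n)"
proof (induction n)
  case 0
  show ?case by (simp add: top_count.simps)
next
  case (Suc n)
  let ?m = "Suc n"
  have "(\<Sum>j\<le>?m. int (?m choose j) * top_count j) =
      (\<Sum>j<?m. int (?m choose j) * top_count j) + top_count ?m"
    by (simp add: lessThan_Suc_atMost[symmetric])
  also have "top_count ?m = (\<Sum>j<?m. int (?m choose j) * (top_count j * int (?m - j - 1)))"
    by (simp add: top_count.simps[of ?m])
  also have "(\<Sum>j<?m. int (?m choose j) * top_count j) + \<dots> =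
      (\<Sum>j<?m. int (?m choose j) * (top_count j * int (?m - j)))"
    unfolding sum.distrib[symmetric]
  proof (rule sum.cong)
    fix j assume "j \<in> {..<?m}"
    then have "int (?m - j) = int (?m - j - 1) + 1" by auto
    then show "int (?m choose j) * top_count j + int (?m choose j) * (top_count j * int (?m - j - 1)) =
      int (?m choose j) * (top_count j * int (?m - j))"
      by (simp only:) (simp add: algebra_simps)
  qed simp
  finally have closed: "(\<Sum>j\<le>?m. int (?m choose j) * top_count j) = fact ?m" using Suc by simp
  have "(\<Sum>j<Suc ?m. int (Suc ?m choose j) * (top_count j * int (Suc ?m - j))) =
      (\<Sum>j\<le>?m. int (Suc ?m) * (int (?m choose j) * top_count j))"
    unfolding lessThan_Suc_atMost
  proof (rule sum.cong)
    fix j assume j: "j \<in> {..?m}"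
    have "(Suc ?m choose j) * (Suc ?m - j) = Suc ?m * (?m choose j)"
      using binomial_absorb_comp[of "Suc ?m" j] by (simp add: mult.commute)
    then have "int (Suc ?m choose j) * int (Suc ?m - j) = int (Suc ?m) * int (?m choose j)"
      by (metis of_nat_mult)
    then show "int (Suc ?m choose j) * (top_count j * int (Suc ?m - j)) =
      int (Suc ?m) * (int (?m choose j) * top_count j)"
      by (metis mult.assoc mult.commute)
  qed simp
  also have "\<dots> = int (Suc ?m) * fact ?m" by (simp only: closed sum_distrib_left[symmetric])
  finally show ?case by (simp only: fact_Suc)
qed

text \<open>
  The number of nested monomials is the value at \<open>t = 1\<close> of the series for the identity permutation.
\<close>

lemma card_fy_boolean:
  assumes "1 \<le> n"
  shows "card (fy_monomials n n) = fact n"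
proof -
  interpret uniform n n using assms by unfold_locales auto
  have "image id = (id :: nat set \<Rightarrow> nat set)" by auto
  then have "int (card (fy_monomials n n)) = (\<Sum>m\<in>fixed_monomials id (fy_monomials n n). (1::int) ^ total_degree m)"
    by (simp add: fixed_monomials_def)
  also have "\<dots> = (\<Sum>F | F \<subset> E \<and> card F \<le> n - 1 \<and> id ` F = F. top_series 1 F id * (\<Sum>a<n - card F. (1::int) ^ a))"
    by (rule fy_series) (rule permutes_id)
  also have "{F. F \<subset> E \<and> card F \<le> n - 1 \<and> id ` F = F} = {F. F \<subset> E}"
  proof -
    have "card F \<le> n - 1" if "F \<subset> E" for F
      using psubset_card_mono[OF _ that] by simp
    then show ?thesis by auto
  qed
  also have "(\<Sum>F | F \<subset> E. top_series 1 F id * (\<Sum>a<n - card F. (1::int) ^ a)) =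
      (\<Sum>F | F \<subset> E. top_count (card F) * int (n - card F))"
    by (intro sum.cong refl) (auto simp: top_series_one finite_subset)
  also have "\<dots> = (\<Sum>j<n. int (n choose j) * (top_count j * int (n - j)))"
    using sum_psubsets_card[of E "\<lambda>j. top_count j * int (n - j)"] by simp
  also have "\<dots> = fact n" using sum_top_count[of "n - 1"] assms by (simp del: fact_Suc)
  finally show ?thesis by (metis of_nat_eq_iff of_nat_fact)
qed

section \<open>Linear independence for the Boolean matroid\<close>

text \<open>
  Gaussian elimination: each equation is used to eliminate one unknown.
\<close>

lemma nonzero_solution:
  fixes f :: "'s \<Rightarrow> 'p \<Rightarrow> 'k::field"
  assumes "finite S" "finite P" "card S < card P"
  shows "\<exists>a. (\<exists>p\<in>P. a p \<noteq> 0) \<and> (\<forall>s\<in>S. (\<Sum>p\<in>P. a p * f s p) = 0)"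
  using assms
proof (induction S arbitrary: P f rule: finite_induct)
  case empty
  then obtain p where "p \<in> P" by (metis card.empty less_numeral_extra(3) equals0I)
  then show ?case by (intro exI[of _ "\<lambda>_. 1"]) auto
next
  case (insert s0 S)
  show ?case
  proof (cases "\<forall>p\<in>P. f s0 p = 0")
    case True
    have "card S < card P" using insert by simp
    then obtain a where "\<exists>p\<in>P. a p \<noteq> 0" "\<forall>s\<in>S. (\<Sum>p\<in>P. a p * f s p) = 0"
      using insert.IH[OF insert.prems(1)] by blast
    then show ?thesis using True by (intro exI[of _ a]) auto
  next
    case False
    then obtain p0 where p0: "p0 \<in> P" "f s0 p0 \<noteq> 0" by blast
    let ?P = "P - {p0}" and ?c = "f s0 p0"
    have "card S < card ?P" using insert p0 by simp
    then obtain a where a: "\<exists>p\<in>?P. a p \<noteq> 0"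
      "\<forall>s\<in>S. (\<Sum>p\<in>?P. a p * (f s p - f s p0 * f s0 p / ?c)) = 0"
      using insert.IH[of ?P "\<lambda>s p. f s p - f s p0 * f s0 p / ?c"] insert.prems by auto
    define x where "x = - (\<Sum>p\<in>?P. a p * f s0 p) / ?c"
    let ?a = "a(p0 := x)"
    have sum: "(\<Sum>p\<in>P. ?a p * f s p) = x * f s p0 + (\<Sum>p\<in>?P. a p * f s p)" for s
      using insert.prems p0 by (subst sum.remove[of _ p0]) auto
    have "(\<Sum>p\<in>P. ?a p * f s p) = 0" if "s \<in> S" for s
    proof -
      have "0 = (\<Sum>p\<in>?P. a p * (f s p - f s p0 * f s0 p / ?c))" using a(2) that by simp
      also have "\<dots> = (\<Sum>p\<in>?P. a p * f s p) - (\<Sum>p\<in>?P. a p * f s0 p) * f s p0 / ?c"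
        by (simp add: right_diff_distrib sum_subtractf sum_distrib_right sum_distrib_left sum_divide_distrib mult_ac)
      finally show ?thesis unfolding sum unfolding x_def by (simp add: mult.commute)
    qed
    moreover have "(\<Sum>p\<in>P. ?a p * f s0 p) = 0" unfolding sum unfolding x_def using p0 by simp
    moreover have "\<exists>p\<in>P. ?a p \<noteq> 0" using a(1) by auto
    ultimately show ?thesis by (intro exI[of _ ?a]) auto
  qed
qed

text \<open>
  The point attached to \<open>\<pi>\<close> has nonzero coordinates exactly at the sets of the flag \<open>\<pi> ` {1..k}\<close>,
  chosen so that the coordinates of the sets containing \<open>i\<close> sum to \<open>i\<close>, by telescoping.
\<close>

definition flag_point :: "nat \<Rightarrow> (nat \<Rightarrow> nat) \<Rightarrow> nat set \<Rightarrow> complex" where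
  "flag_point n \<pi> F = (if F \<noteq> {} \<and> F = \<pi> ` {1..card F}
     then of_nat (\<pi> (card F)) - (if card F = n then 0 else of_nat (\<pi> (card F + 1))) else 0)"

definition monomial_value :: "('v \<Rightarrow> complex) \<Rightarrow> ('v \<Rightarrow>\<^sub>0 nat) \<Rightarrow> complex" where
  "monomial_value x m = (\<Prod>F\<in>keys m. x F ^ lookup m F)"

lemma monomial_value_superset:
  "finite A \<Longrightarrow> keys m \<subseteq> A \<Longrightarrow> monomial_value x m = (\<Prod>F\<in>A. x F ^ lookup m F)"
  unfolding monomial_value_def by (rule prod.mono_neutral_left) (auto simp: in_keys_iff)

lemma monomial_value_add: "monomial_value x (a + b) = monomial_value x a * monomial_value x b"
  by (simp add: monomial_value_superset[of "keys a \<union> keys b"] lookup_add power_add prod.distrib)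

lemma monomial_value_0 [simp]: "monomial_value x 0 = 1"
  by (simp add: monomial_value_def)

lemma monomial_value_single [simp]: "monomial_value x (single F k) = x F ^ k"
  by (cases "k = 0") (simp_all add: monomial_value_def)

lemma monomial_value_sum: "finite A \<Longrightarrow> monomial_value x (sum f A) = (\<Prod>y\<in>A. monomial_value x (f y))"
  by (induction A rule: finite_induct) (simp_all add: monomial_value_add)

text \<open>
  This is the value of a polynomial at the point \<open>x\<close> multiplied by the parameter of the power series, whose
  powers record the degrees of the monomials.
\<close>

definition scaled_value :: "('v \<Rightarrow> complex) \<Rightarrow> (('v \<Rightarrow>\<^sub>0 nat) \<Rightarrow>\<^sub>0 complex) \<Rightarrow> complex fps" where
  "scaled_value x =
     monomial_extension fps_const (\<lambda>m. fps_const (monomial_value x m) * fps_X ^ total_degree m)"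

context
  fixes x :: "'v \<Rightarrow> complex"
begin

interpretation multiplicative_extension fps_const
  "\<lambda>m. fps_const (monomial_value x m) * fps_X ^ total_degree m"
  by unfold_locales
    (simp_all add: monomial_value_add power_add mult_ac fps_const_mult[symmetric] del: fps_const_mult)

lemmas scaled_value_0 [simp] = ext_0[folded scaled_value_def]
  and scaled_value_add = ext_add[folded scaled_value_def]
  and scaled_value_sum = ext_sum[folded scaled_value_def]
  and scaled_value_mult = ext_mult[folded scaled_value_def]
  and scaled_value_single [simp] = ext_single[folded scaled_value_def]

end

lemma fps_const_sum: "fps_const (sum f A) = (\<Sum>x\<in>A. fps_const (f x))"
  by (induction A rule: infinite_finite_induct) (simp_all flip: fps_const_add)

locale flag_points =
  fixes n :: nat
  assumes n_pos: "1 \<le> n"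
begin

sublocale uniform n n using n_pos by unfold_locales auto

lemma L_eq_Pow: "L = Pow E"
proof -
  have "F \<in> L" if "F \<subseteq> E" for F
  proof (cases "F = E")
    case False
    then have "card F < card E" using that by (intro psubset_card_mono) auto
    then show ?thesis using that by (auto simp: flat_iff)
  qed (simp add: flat_iff)
  then show ?thesis using flat_subset by blast
qed

context
  fixes \<pi> :: "nat \<Rightarrow> nat"
  assumes \<pi>: "\<pi> permutes E"
begin

lemma card_flag: "card (\<pi> ` {1..k}) = k"
  using card_image[OF inj_on_subset[OF permutes_inj[OF \<pi>] subset_UNIV], of "{1..k}"] by simp

lemma flag_point_flag:
  "1 \<le> k \<Longrightarrow> flag_point n \<pi> (\<pi> ` {1..k}) = of_nat (\<pi> k) - (if k = n then 0 else of_nat (\<pi> (k + 1)))"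
  by (simp add: flag_point_def card_flag)

lemma sum_flag_points:
  assumes i: "i \<in> E"
  shows "(\<Sum>F\<in>{F \<in> Pow E. i \<in> F}. flag_point n \<pi> F) = of_nat i"
proof -
  obtain k where k: "k \<in> E" "\<pi> k = i" using i permutes_image[OF \<pi>] by (metis imageE)
  let ?b = "\<lambda>j. if j = n + 1 then 0 else of_nat (\<pi> j) :: complex"
  have inj: "inj_on (\<lambda>j. \<pi> ` {1..j}) {k..n}" by (metis card_flag inj_onI)
  have "(\<Sum>F\<in>{F \<in> Pow E. i \<in> F}. flag_point n \<pi> F) = (\<Sum>F\<in>(\<lambda>j. \<pi> ` {1..j}) ` {k..n}. flag_point n \<pi> F)"
  proof (rule sum.mono_neutral_right)
    show "(\<lambda>j. \<pi> ` {1..j}) ` {k..n} \<subseteq> {F \<in> Pow E. i \<in> F}"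
      using k permutes_in_image[OF \<pi>] by auto
    show "\<forall>F\<in>{F \<in> Pow E. i \<in> F} - (\<lambda>j. \<pi> ` {1..j}) ` {k..n}. flag_point n \<pi> F = 0"
    proof
      fix F assume F: "F \<in> {F \<in> Pow E. i \<in> F} - (\<lambda>j. \<pi> ` {1..j}) ` {k..n}"
      show "flag_point n \<pi> F = 0"
      proof (rule ccontr)
        assume "flag_point n \<pi> F \<noteq> 0"
        then have eq: "F = \<pi> ` {1..card F}" by (auto simp: flag_point_def split: if_splits)
        then have "\<pi> k \<in> \<pi> ` {1..card F}" using F k by auto
        then have "k \<le> card F" using permutes_inj[OF \<pi>] by (auto simp: inj_image_mem_iff)
        moreover have "card F \<le> n" using F card_mono[of E F] by auto
        ultimately show False using F eq by auto
      qed
    qed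
  qed auto
  also have "\<dots> = (\<Sum>j=k..n. ?b j - ?b (j + 1))"
    using k by (simp add: sum.reindex[OF inj] flag_point_flag)
  also have "\<dots> = - (\<Sum>j=k..n. ?b (Suc j) - ?b j)"
    by (simp only: sum_negf[symmetric] minus_diff_eq Suc_eq_plus1)
  also have "\<dots> = ?b k - ?b (n + 1)"
    using k by (subst sum_Suc_diff) simp_all
  also have "\<dots> = of_nat i" using k by simp
  finally show ?thesis .
qed

lemma scaled_value_linear:
  assumes "i \<in> E"
  shows "scaled_value (flag_point n \<pi>) (linear_relation L i) = fps_const (of_nat i) * fps_X"
proof -
  have "scaled_value (flag_point n \<pi>) (linear_relation L i) =
      (\<Sum>F\<in>{F \<in> L - {{}}. i \<in> F}. fps_const (flag_point n \<pi> F) * fps_X)"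
    by (simp add: linear_relation_def scaled_value_sum flat_var_def)
  also have "{F \<in> L - {{}}. i \<in> F} = {F \<in> Pow E. i \<in> F}" by (auto simp: L_eq_Pow)
  finally show ?thesis using sum_flag_points[OF assms]
    by (simp flip: sum_distrib_right fps_const_sum)
qed

lemma scaled_value_incomparable:
  assumes "\<not> F \<subseteq> G" "\<not> G \<subseteq> F"
  shows "scaled_value (flag_point n \<pi>) (flat_var F * flat_var G) = 0"
proof -
  have "flag_point n \<pi> F = 0 \<or> flag_point n \<pi> G = 0"
  proof (rule ccontr)
    assume "\<not> ?thesis"
    then have "F = \<pi> ` {1..card F}" "G = \<pi> ` {1..card G}"
      by (auto simp: flag_point_def split: if_splits)
    moreover have "{1..card F} \<subseteq> {1..card G} \<or> {1..card G} \<subseteq> {1..card F}"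
      by auto
    ultimately show False using assms by (metis image_mono)
  qed
  then show ?thesis by (auto simp: scaled_value_mult flat_var_def)
qed

end

text \<open>
  The product of incomparable variables vanishes at the flag points, and a linear relation becomes a
  constant times the parameter; so elements of the ideal lose one power of the parameter. Passing from
  \<open>q\<close> to \<open>q'\<close> is what lowers the degree in the induction below.
\<close>

lemma scaled_value_chow_ideal:
  assumes "q \<in> chow_ideal E L"
  shows "\<exists>q'\<in>flat_polys L. \<forall>\<pi>. \<pi> permutes E \<longrightarrow>
    scaled_value (flag_point n \<pi>) q = fps_X * scaled_value (flag_point n \<pi>) q'"
    (is "?Q q")
proof -
  have "chow_ideal E L \<subseteq> {q. ?Q q}"
  proof (rule chow_ideal_least, unfold mem_Collect_eq)
    show "?Q 0" by (intro bexI[of _ 0]) auto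
  next
    fix p q :: "(nat, complex) flat_poly" assume "?Q p" "?Q q"
    then obtain p' q' where
      "p' \<in> flat_polys L" "\<forall>\<pi>. \<pi> permutes E \<longrightarrow> scaled_value (flag_point n \<pi>) p = fps_X * scaled_value (flag_point n \<pi>) p'"
      "q' \<in> flat_polys L" "\<forall>\<pi>. \<pi> permutes E \<longrightarrow> scaled_value (flag_point n \<pi>) q = fps_X * scaled_value (flag_point n \<pi>) q'"
      by blast
    then show "?Q (p + q)"
      by (intro bexI[of _ "p' + q'"]) (auto simp: scaled_value_add algebra_simps)
  next
    fix u p :: "(nat, complex) flat_poly" assume u: "u \<in> flat_polys L" and "?Q p"
    then obtain p' where
      "p' \<in> flat_polys L" "\<forall>\<pi>. \<pi> permutes E \<longrightarrow> scaled_value (flag_point n \<pi>) p = fps_X * scaled_value (flag_point n \<pi>) p'"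
      by blast
    then show "?Q (u * p)" using u
      by (intro bexI[of _ "u * p'"]) (auto simp: scaled_value_mult mult.left_commute)
  next
    fix F G :: "nat set" assume "\<not> F \<subseteq> G" "\<not> G \<subseteq> F"
    then show "?Q (flat_var F * flat_var G)"
      by (intro bexI[of _ 0]) (auto simp: scaled_value_incomparable)
  next
    fix i assume "i \<in> E"
    then show "?Q (linear_relation L i)"
      by (intro bexI[of _ "single 0 (of_nat i)"])
        (auto simp: scaled_value_linear mult.commute simp del: single_of_nat)
  qed
  then show ?thesis using assms by blast
qed

text \<open>
  The sets \<open>\<rho> ` {1..k}\<close> determine \<open>\<rho>\<close>, so a flag point is recognized by its nonzero coordinates.
\<close>

lemma flag_points_differ:
  assumes \<pi>: "\<pi> permutes E" and \<rho>: "\<rho> permutes E" and eq: "\<And>k. k \<in> E \<Longrightarrow> flag_point n \<pi> (\<rho> ` {1..k}) \<noteq> 0"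
  shows "\<pi> = \<rho>"
proof
  have im: "\<pi> ` {1..k} = \<rho> ` {1..k}" if "k \<le> n" for k
  proof (cases "k = 0")
    case False
    then show ?thesis using eq[of k] that card_flag[OF \<rho>] by (auto simp: flag_point_def split: if_splits)
  qed auto
  fix j
  show "\<pi> j = \<rho> j"
  proof (cases "j \<in> E")
    case True
    have s: "\<sigma> ` {1..j} - \<sigma> ` {1..j - 1} = {\<sigma> j}" if "\<sigma> permutes E" for \<sigma>
    proof -
      have "\<sigma> ` {1..j} - \<sigma> ` {1..j - 1} = \<sigma> ` ({1..j} - {1..j - 1})"
        by (rule image_set_diff[OF permutes_inj[OF that], symmetric])
      also have "{1..j} - {1..j - 1} = {j}" using True by auto
      finally show ?thesis by simp
    qed
    have "\<pi> ` {1..j} = \<rho> ` {1..j}" "\<pi> ` {1..j - 1} = \<rho> ` {1..j - 1}"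
    proof -
      have "j \<le> n" "j - 1 \<le> n" using True by auto
      then show "\<pi> ` {1..j} = \<rho> ` {1..j}" "\<pi> ` {1..j - 1} = \<rho> ` {1..j - 1}"
        using im[of j] im[of "j - 1"] by blast+
    qed
    then have "{\<pi> j} = {\<rho> j}"
      unfolding s[OF \<pi>, symmetric] s[OF \<rho>, symmetric] by simp
    then show ?thesis by simp
  next
    case False
    then show ?thesis using \<pi> \<rho> by (simp add: permutes_not_in)
  qed
qed

lemma flag_point_self:
  assumes \<pi>: "\<pi> permutes E" and k: "k \<in> E"
  shows "flag_point n \<pi> (\<pi> ` {1..k}) \<noteq> 0"
proof -
  have "\<pi> k \<in> E" using permutes_in_image[OF \<pi>] k by simp
  moreover have "\<pi> k \<noteq> \<pi> (k + 1)" using permutes_inj[OF \<pi>] by (auto simp: inj_eq)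
  ultimately show ?thesis using k by (cases "k = n") (simp_all add: flag_point_flag[OF \<pi>])
qed

definition flag_monomial :: "(nat \<Rightarrow> nat) \<Rightarrow> nat set \<Rightarrow>\<^sub>0 nat" where
  "flag_monomial \<rho> = (\<Sum>k\<in>E. single (\<rho> ` {1..k}) 1)"

lemma flag_monomial_value:
  assumes "\<pi> permutes E" "\<rho> permutes E"
  shows "monomial_value (flag_point n \<pi>) (flag_monomial \<rho>) \<noteq> 0 \<longleftrightarrow> \<pi> = \<rho>"
  using flag_points_differ[OF assms] flag_point_self[OF assms(1)]
  by (auto simp: flag_monomial_def monomial_value_sum)

text \<open>
  If a dependency among the nested monomials existed, one of them could be omitted from the spanning
  set, leaving fewer than \<open>n!\<close> of them. Some combination of the evaluations at the \<open>n!\<close> flag points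
  would then vanish on all of these, hence on all polynomials by induction on the degree, which the
  flag monomials exclude.
\<close>

lemma boolean_independent:
  assumes count: "card (fy_monomials n n) \<le> fact n"
    and rel: "(\<Sum>s\<in>fy_degree d. single s (c s)) \<in> (chow_ideal E L :: (nat, complex) flat_poly set)"
    and s0: "s0 \<in> fy_degree d"
  shows "c s0 = 0"
proof (rule ccontr)
  assume c0: "c s0 \<noteq> 0"
  let ?I = "chow_ideal E L :: (nat, complex) flat_poly set"
  let ?P = "{\<pi>. \<pi> permutes E}"
  have finP: "finite ?P" by (simp add: finite_permutations)
  have s0': "s0 \<in> fy_monomials n n" "total_degree s0 = d" using s0 by (auto simp: fy_degree_def)
  have "card (fy_monomials n n - {s0}) < card (fy_monomials n n)"
    using s0' by (intro psubset_card_mono) auto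
  also have "\<dots> \<le> card ?P" using count card_permutations[of E n] by simp
  finally have "card (fy_monomials n n - {s0}) < card ?P" .
  then obtain a where a: "\<exists>\<pi>\<in>?P. a \<pi> \<noteq> 0"
    "\<And>s. s \<in> fy_monomials n n - {s0} \<Longrightarrow> (\<Sum>\<pi>\<in>?P. a \<pi> * monomial_value (flag_point n \<pi>) s) = 0"
    using nonzero_solution[OF _ finP, of "fy_monomials n n - {s0}" "\<lambda>s \<pi>. monomial_value (flag_point n \<pi>) s"]
    by auto
  define \<Lambda> where "\<Lambda> q = (\<Sum>\<pi>\<in>?P. fps_const (a \<pi>) * scaled_value (flag_point n \<pi>) q)"
    for q :: "(nat, complex) flat_poly"
  have \<Lambda>_add: "\<Lambda> (p + q) = \<Lambda> p + \<Lambda> q" for p q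
    by (simp add: \<Lambda>_def scaled_value_add algebra_simps sum.distrib)
  have \<Lambda>_0: "\<Lambda> 0 = 0" by (simp add: \<Lambda>_def)
  have \<Lambda>_sum: "\<Lambda> (sum f A) = (\<Sum>x\<in>A. \<Lambda> (f x))" for f and A :: "'z set"
    by (simp add: \<Lambda>_def scaled_value_sum sum_distrib_left) (rule sum.swap)
  have \<Lambda>_single: "\<Lambda> (single m b) = fps_const (b * (\<Sum>\<pi>\<in>?P. a \<pi> * monomial_value (flag_point n \<pi>) m)) * fps_X ^ total_degree m"
    for m b
    by (simp add: \<Lambda>_def sum_distrib_left sum_distrib_right mult_ac fps_const_sum flip: fps_const_mult)
  have vanish: "fps_nth (\<Lambda> q) e = 0" if "q \<in> flat_polys L" for q e
    using that
  proof (induction e arbitrary: q rule: less_induct)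
    case (less e)
    have ideal: "fps_nth (\<Lambda> q) e = 0" if "q \<in> ?I" for q
    proof -
      note divisible = scaled_value_chow_ideal[OF that]
      obtain q' where q': "q' \<in> flat_polys L" "\<forall>\<pi>. \<pi> permutes E \<longrightarrow>
          scaled_value (flag_point n \<pi>) q = fps_X * scaled_value (flag_point n \<pi>) q'"
        using divisible by blast
      then have "\<Lambda> q = fps_X * \<Lambda> q'"
        by (simp add: \<Lambda>_def sum_distrib_left mult_ac)
      then show ?thesis using less.IH[of "e - 1" q'] q'(1) by (cases e) auto
    qed
    have mono: "fps_nth (\<Lambda> (single m b)) e = 0" if m: "keys m \<subseteq> L - {{}}" for m b
    proof (cases "total_degree m = e")
      case False
      then show ?thesis by (simp add: \<Lambda>_single)
    next
      case True
      obtain c' where c': "single m 1 - (\<Sum>s\<in>fy_degree e. single s (c' s)) \<in> ?I"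
        using reducible_monomial[OF refl m] True unfolding reducible_def[OF refl] by auto
      \<comment> \<open>The dependency is used to remove \<open>s0\<close> from the normal form.\<close>
      define x where "x = (if e = d then c' s0 / c s0 else 0)"
      have "single 0 x * (\<Sum>s\<in>fy_degree d. single s (c s)) \<in> ?I"
        by (intro chow_ideal_mult rel) auto
      then have I2: "(\<Sum>s\<in>fy_degree d. single s (x * c s)) \<in> ?I"
        by (simp add: sum_distrib_left mult_single)
      define c'' where "c'' s = (if e = d then c' s - x * c s else c' s)" for s
      have "(\<Sum>s\<in>fy_degree e. single s (c'' s)) = (\<Sum>s\<in>fy_degree e. single s (c' s)) -
          (if e = d then (\<Sum>s\<in>fy_degree d. single s (x * c s)) else 0)"
        by (simp add: c''_def single_diff sum_subtractf)
      then have "single m 1 - (\<Sum>s\<in>fy_degree e. single s (c'' s)) =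
          single m 1 - (\<Sum>s\<in>fy_degree e. single s (c' s)) + (if e = d then (\<Sum>s\<in>fy_degree d. single s (x * c s)) else 0)"
        by simp
      also have "\<dots> \<in> ?I" using c' I2 by (auto intro: chow_ideal_add)
      finally have "fps_nth (\<Lambda> (single m 1 - (\<Sum>s\<in>fy_degree e. single s (c'' s)))) e = 0"
        by (rule ideal)
      moreover have "\<Lambda> (single s (c'' s)) = 0" if "s \<in> fy_degree e" for s
      proof (cases "s = s0")
        case True
        then have "e = d" using that s0' by (simp add: fy_degree_def)
        then show ?thesis using True c0 by (simp add: c''_def x_def \<Lambda>_0)
      next
        case False
        then show ?thesis using that a(2)[of s] by (simp add: \<Lambda>_single fy_degree_def)
      qed
      then have "\<Lambda> (\<Sum>s\<in>fy_degree e. single s (c'' s)) = 0" by (simp add: \<Lambda>_sum)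
      ultimately have "fps_nth (\<Lambda> (single m 1)) e = 0"
        using \<Lambda>_add[of "single m 1 - (\<Sum>s\<in>fy_degree e. single s (c'' s))" "\<Sum>s\<in>fy_degree e. single s (c'' s)"] by simp
      then show ?thesis by (simp add: \<Lambda>_single)
    qed
    have "\<Lambda> q = (\<Sum>m\<in>keys q. \<Lambda> (single m (lookup q m)))"
      by (subst poly_mapping_eq_sum_single) (rule \<Lambda>_sum)
    moreover have "keys m \<subseteq> L - {{}}" if "m \<in> keys q" for m
      using less.prems that by (auto simp: flat_polys_iff)
    ultimately show ?case by (simp add: fps_sum_nth mono)
  qed
  obtain \<rho> where \<rho>: "\<rho> permutes E" "a \<rho> \<noteq> 0" using a(1) by auto
  let ?m = "flag_monomial \<rho>"
  have "keys ?m \<subseteq> L - {{}}"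
    using permutes_in_image[OF \<rho>(1)] by (auto simp: flag_monomial_def keys_sum_nat L_eq_Pow split: if_splits)
  then have "fps_nth (\<Lambda> (single ?m 1)) (total_degree ?m) = 0"
    by (intro vanish flat_polys_single)
  then have "(\<Sum>\<pi>\<in>?P. a \<pi> * monomial_value (flag_point n \<pi>) ?m) = 0"
    by (simp add: \<Lambda>_single)
  moreover have "(\<Sum>\<pi>\<in>?P. a \<pi> * monomial_value (flag_point n \<pi>) ?m) = a \<rho> * monomial_value (flag_point n \<rho>) ?m"
    using \<rho> flag_monomial_value[OF _ \<rho>(1)] by (subst sum.remove[OF finP, of \<rho>]) (auto intro!: sum.neutral)
  ultimately show False using \<rho>(2) flag_monomial_value[OF \<rho>(1) \<rho>(1)] by simp
qed

end

section \<open>Frobenius characteristics of permutation characters\<close>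

definition cycle_power_sum :: "nat set \<Rightarrow> (nat \<Rightarrow> nat) \<Rightarrow> complex mseries" where
  "cycle_power_sum K \<sigma> = (\<Prod>C\<in>orbit \<sigma> ` K. power_sum (card C))"

abbreviation h_series :: "nat \<Rightarrow> complex mseries fps" where
  "h_series k \<equiv> fps_const (complete_homogeneous k)"

abbreviation scalar :: "complex \<Rightarrow> complex mseries fps" where
  "scalar c \<equiv> fps_const (mconst c)"

lemma mcoeff_simps [simp]:
  "mcoeff 0 m = 0" "mcoeff (f + g) m = mcoeff f m + mcoeff g m" "mcoeff (f - g) m = mcoeff f m - mcoeff g m"
  "mcoeff (- f) m = - mcoeff f m"
  "mcoeff 1 m = (if m = 0 then 1 else 0)"
  by (simp_all add: zero_mseries_def plus_mseries_def minus_mseries_def uminus_mseries_def one_mseries_def)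

lemma mcoeff_mult: "mcoeff (f * g) m = (\<Sum>(a, b)\<in>splittings m. mcoeff f a * mcoeff g b)"
  by (simp add: times_mseries_def)

lemma mcoeff_sum: "mcoeff (sum f A) m = (\<Sum>x\<in>A. mcoeff (f x) m)"
  by (induction A rule: infinite_finite_induct) auto

lemma mcoeff_mconst_mult [simp]: "mcoeff (mconst c * f) m = c * mcoeff f m"
proof -
  have "mcoeff (mconst c * f) m = (\<Sum>(a, b)\<in>splittings m. if a = 0 then c * mcoeff f b else 0)"
    by (auto simp: mcoeff_mult mconst_def intro!: sum.cong)
  also have "\<dots> = (\<Sum>(a, b)\<in>{(0 :: nat \<Rightarrow>\<^sub>0 nat, m)}. if a = 0 then c * mcoeff f b else 0)"
    by (rule sum.mono_neutral_right[OF finite_splittings]) (auto simp: splittings_def split: if_splits)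
  finally show ?thesis by simp
qed

lemma mconst_mult: "mconst a * mconst b = (mconst (a * b) :: complex mseries)"
  by (rule mseries_eqI) (simp, simp add: mconst_def)

lemma mconst_1 [simp]: "mconst 1 = (1 :: complex mseries)"
  by (rule mseries_eqI) (simp add: mconst_def)

lemma mconst_0 [simp]: "mconst 0 = (0 :: complex mseries)"
  by (rule mseries_eqI) (simp add: mconst_def)

lemma mconst_add: "mconst (a + b) = (mconst a + mconst b :: complex mseries)"
  by (rule mseries_eqI) (simp add: mconst_def)

lemma mconst_of_nat: "mconst (of_nat k) = (of_nat k :: complex mseries)"
  by (induction k) (simp_all add: mconst_add)

lemma complete_homogeneous_0 [simp]: "complete_homogeneous 0 = 1"
proof (rule mseries_eqI)
  fix m :: "nat \<Rightarrow>\<^sub>0 nat"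
  show "mcoeff (complete_homogeneous 0) m = mcoeff 1 m"
    using total_degree_eq_0_iff[of m] unfolding total_degree_def complete_homogeneous_def by simp
qed

lemma mcoeff_complete_homogeneous:
  "mcoeff (complete_homogeneous n) m = (if total_degree m = n then 1 else 0)"
  by (simp add: complete_homogeneous_def total_degree_def)

lemma mcoeff_power_sum_mult:
  assumes "k \<ge> 1"
  shows "mcoeff (power_sum k * g) w = (\<Sum>(a, b)\<in>{(a, b) \<in> splittings w. \<exists>i. a = single i k}. mcoeff g b)"
proof -
  have "mcoeff (power_sum k * g) w = (\<Sum>p\<in>splittings w. if \<exists>i. fst p = single i k then mcoeff g (snd p) else 0)"
    by (auto simp: mcoeff_mult power_sum_def intro!: sum.cong)
  also have "\<dots> = (\<Sum>p\<in>{p \<in> splittings w. \<exists>i. fst p = single i k}. mcoeff g (snd p))"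
    by (rule sum.inter_filter[symmetric]) simp
  finally show ?thesis by (simp add: case_prod_unfold)
qed

text \<open>A product of power sums enumerates the choices of one variable for each factor.\<close>

definition choices :: "'c set \<Rightarrow> ('c \<Rightarrow> nat) \<Rightarrow> (nat \<Rightarrow>\<^sub>0 nat) \<Rightarrow> ('c \<Rightarrow> nat) set" where
  "choices S k w = {d \<in> S \<rightarrow>\<^sub>E UNIV. (\<Sum>x\<in>S. single (d x) (k x)) = w}"

lemma mcoeff_prod_power_sum:
  assumes "finite S" "\<And>x. x \<in> S \<Longrightarrow> k x \<ge> 1"
  shows "finite (choices S k w) \<and> mcoeff (\<Prod>x\<in>S. power_sum (k x)) w = of_nat (card (choices S k w))"
  using assms
proof (induction S arbitrary: w rule: finite_induct)
  case empty
  have "choices {} k w = (if w = 0 then {\<lambda>x. undefined} else {})" by (auto simp: choices_def)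
  then show ?case by simp
next
  case (insert x S)
  have kx: "k x \<ge> 1" and IH: "finite (choices S k b)"
    "mcoeff (\<Prod>x\<in>S. power_sum (k x)) b = of_nat (card (choices S k b))" for b
    using insert by auto
  let ?P = "{(a, b) \<in> splittings w. \<exists>i. a = single i (k x)}"
  let ?D = "SIGMA (a, b):?P. choices S k b"
  have finP: "finite ?P" by (rule finite_subset[OF _ finite_splittings[of w]]) auto
  let ?f = "\<lambda>d. ((single (d x) (k x), \<Sum>y\<in>S. single (d y) (k y)), restrict d S)"
  have bij: "bij_betw ?f (choices (insert x S) k w) ?D"
  proof (rule bij_betw_imageI)
    show "inj_on ?f (choices (insert x S) k w)"
    proof (rule inj_onI)
      fix d d' assume d: "d \<in> choices (insert x S) k w" "d' \<in> choices (insert x S) k w" and eq: "?f d = ?f d'"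
      have "lookup (single (d x) (k x)) (d x) = lookup (single (d' x) (k x)) (d x)" using eq by simp
      then have "d x = d' x" using kx by (auto simp: lookup_single when_def split: if_splits)
      moreover have "d y = d' y" if "y \<in> S" for y using eq that by (metis (no_types, lifting) Pair_inject restrict_apply')
      ultimately show "d = d'"
        using d by (intro PiE_ext[of d "insert x S" "\<lambda>_. UNIV" d']) (auto simp: choices_def)
    qed
    show "?f ` choices (insert x S) k w = ?D"
    proof (intro equalityI subsetI)
      fix p assume "p \<in> ?f ` choices (insert x S) k w"
      then obtain d where d: "d \<in> choices (insert x S) k w" and p: "p = ?f d" by blast
      have "(\<Sum>y\<in>S. single (restrict d S y) (k y)) = (\<Sum>y\<in>S. single (d y) (k y))"
        by (intro sum.cong) auto
      then show "p \<in> ?D" using d insert.hyps by (auto simp: p choices_def splittings_def)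
    next
      fix p assume "p \<in> ?D"
      then obtain a b d i where p: "p = ((a, b), d)" and ab: "a + b = w" "a = single i (k x)"
        and d: "d \<in> choices S k b" by (auto simp: splittings_def)
      let ?d = "d(x := i)"
      have s: "(\<Sum>y\<in>S. single (?d y) (k y)) = b"
        using d insert.hyps by (auto simp: choices_def intro!: sum.cong)
      have "?d \<in> insert x S \<rightarrow>\<^sub>E UNIV"
        using d by (intro PiE_fun_upd) (simp_all add: choices_def)
      then have "?d \<in> choices (insert x S) k w"
        using insert.hyps ab s by (simp add: choices_def)
      moreover have "restrict ?d S = d"
        using insert.hyps d by (auto simp: choices_def PiE_def extensional_def fun_eq_iff)
      then have "?f ?d = p" using s by (simp add: p ab)
      ultimately show "p \<in> ?f ` choices (insert x S) k w" by (intro image_eqI[of p ?f ?d, OF sym])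
    qed
  qed
  have finD: "finite ?D" using finP IH(1) by auto
  have "mcoeff (\<Prod>x\<in>insert x S. power_sum (k x)) w = (\<Sum>(a, b)\<in>?P. of_nat (card (choices S k b)))"
    using insert.hyps by (simp add: mcoeff_power_sum_mult[OF kx] IH(2))
  also have "\<dots> = of_nat (card ?D)"
    using finP IH(1) by (subst card_SigmaI) (auto simp: case_prod_unfold)
  also have "card ?D = card (choices (insert x S) k w)" using bij_betw_same_card[OF bij] by simp
  finally show ?case using bij_betw_finite[OF bij] finD by simp
qed

definition colourings :: "nat set \<Rightarrow> (nat \<Rightarrow>\<^sub>0 nat) \<Rightarrow> (nat \<Rightarrow> nat) set" where
  "colourings K w = choices K (\<lambda>_. 1) w"

lemma colourings_iff: "c \<in> colourings K w \<longleftrightarrow> c \<in> K \<rightarrow>\<^sub>E UNIV \<and> (\<Sum>x\<in>K. single (c x) 1) = w"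
  by (simp add: colourings_def choices_def)

lemma finite_colourings: "finite K \<Longrightarrow> finite (colourings K w)"
  unfolding colourings_def using mcoeff_prod_power_sum[of K "\<lambda>_. 1"] by simp

lemma sum_single_const: "(\<Sum>x\<in>C. single v (1::nat)) = single v (card C)"
  by (induction C rule: infinite_finite_induct) (simp_all add: plus_1_eq_Suc flip: single_add)

context
  fixes K :: "nat set" and \<sigma> :: "nat \<Rightarrow> nat"
  assumes K: "finite K" and \<sigma>: "\<sigma> permutes K"
begin

lemma permutation_\<sigma>: "permutation \<sigma>"
  using K \<sigma> by (auto simp: permutation_permutes)

lemma self_in_orbit: "x \<in> orbit \<sigma> x"
  by (rule permutation_self_in_orbit[OF permutation_\<sigma>])

lemma orbit_subset_K: "x \<in> K \<Longrightarrow> orbit \<sigma> x \<subseteq> K"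
  using permutes_orbit_subset[OF \<sigma>] .

lemma orbit_eq_in: "x \<in> K \<Longrightarrow> y \<in> orbit \<sigma> x \<Longrightarrow> orbit \<sigma> y = orbit \<sigma> x"
proof -
  assume "y \<in> orbit \<sigma> x"
  moreover have "cyclic_on \<sigma> (orbit \<sigma> x)"
    by (rule cyclic_on_orbit'[OF permutation_\<sigma>])
  ultimately show ?thesis unfolding cyclic_on_alldef by blast
qed

lemma orbit_step_eq: "x \<in> K \<Longrightarrow> orbit \<sigma> (\<sigma> x) = orbit \<sigma> x"
  by (rule orbit_eq_in) (auto intro: orbit.base)

text \<open>
  Choosing a colour for each cycle is choosing a colouring that is constant along \<open>\<sigma>\<close>.
\<close>

lemma mcoeff_cycle_power_sum:
  "mcoeff (cycle_power_sum K \<sigma>) w = of_nat (card {c \<in> colourings K w. \<forall>x\<in>K. c (\<sigma> x) = c x})"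
proof -
  let ?S = "orbit \<sigma> ` K"
  have finS: "finite ?S" using K by simp
  have finC: "finite C" if "C \<in> ?S" for C using that orbit_subset_K K finite_subset by blast
  have ne: "card C \<ge> 1" if "C \<in> ?S" for C
  proof -
    have "C \<noteq> {}" using that self_in_orbit by blast
    then have "card C \<noteq> 0" using finC[OF that] by simp
    then show ?thesis by simp
  qed
  have part: "(\<Sum>x\<in>K. g x) = (\<Sum>C\<in>?S. \<Sum>x\<in>C. g x)" for g :: "nat \<Rightarrow> nat \<Rightarrow>\<^sub>0 nat"
  proof -
    have "K = \<Union>?S" using orbit_subset_K self_in_orbit by blast
    then have "(\<Sum>x\<in>K. g x) = (\<Sum>x\<in>\<Union>?S. g x)" by simp
    also have "\<dots> = (\<Sum>C\<in>?S. \<Sum>x\<in>C. g x)"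
    proof (rule sum.Union_disjoint[unfolded o_def])
      show "\<forall>A\<in>?S. \<forall>B\<in>?S. A \<noteq> B \<longrightarrow> A \<inter> B = {}"
      proof (intro ballI impI)
        fix A B assume "A \<in> ?S" "B \<in> ?S" "A \<noteq> B"
        then obtain x y where xy: "x \<in> K" "y \<in> K" "A = orbit \<sigma> x" "B = orbit \<sigma> y"
          by blast
        show "A \<inter> B = {}"
        proof (rule ccontr)
          assume "A \<inter> B \<noteq> {}"
          then obtain z where "z \<in> orbit \<sigma> x" "z \<in> orbit \<sigma> y" using xy by blast
          then have "A = B" using orbit_eq_in xy by metis
          then show False using \<open>A \<noteq> B\<close> by simp
        qed
      qed
    qed (use finC in auto)
    finally show ?thesis .
  qed
  have content: "(\<Sum>x\<in>K. single (d (orbit \<sigma> x)) (1::nat)) = (\<Sum>C\<in>?S. single (d C) (card C))"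
    for d :: "nat set \<Rightarrow> nat"
  proof -
    have "(\<Sum>x\<in>K. single (d (orbit \<sigma> x)) (1::nat)) = (\<Sum>C\<in>?S. \<Sum>x\<in>C. single (d (orbit \<sigma> x)) 1)"
      by (rule part)
    also have "\<dots> = (\<Sum>C\<in>?S. \<Sum>x\<in>C. single (d C) 1)"
      by (intro sum.cong refl) (auto simp: orbit_eq_in)
    finally show ?thesis by (simp only: sum_single_const)
  qed
  let ?T = "{c \<in> colourings K w. \<forall>x\<in>K. c (\<sigma> x) = c x}"
  let ?f = "\<lambda>d. \<lambda>x\<in>K. d (orbit \<sigma> x)"
  have const: "c y = c x" if c: "\<forall>x\<in>K. c (\<sigma> x) = c x" and x: "x \<in> K" and y: "y \<in> orbit \<sigma> x" for c :: "nat \<Rightarrow> nat" and x y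
    using y
  proof (induction y rule: orbit.induct)
    case base
    then show ?case using c x by simp
  next
    case (step y)
    then show ?case using c orbit_subset_K[OF x] by auto
  qed
  have "bij_betw ?f (choices ?S card w) ?T"
  proof (rule bij_betw_imageI)
    show "inj_on ?f (choices ?S card w)"
    proof (rule inj_onI)
      fix d d' assume d: "d \<in> choices ?S card w" "d' \<in> choices ?S card w" and eq: "?f d = ?f d'"
      have "d (orbit \<sigma> x) = d' (orbit \<sigma> x)" if "x \<in> K" for x using fun_cong[OF eq, of x] that by simp
      then show "d = d'"
        using d by (intro PiE_ext[of d ?S "\<lambda>_. UNIV" d']) (auto simp: choices_def)
    qed
    show "?f ` choices ?S card w = ?T"
    proof (intro equalityI subsetI)
      fix c assume "c \<in> ?f ` choices ?S card w"
      then obtain d where d: "d \<in> choices ?S card w" and c: "c = ?f d" by blast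
      have "(\<Sum>x\<in>K. single (c x) (1::nat)) = (\<Sum>x\<in>K. single (d (orbit \<sigma> x)) 1)"
        by (intro sum.cong) (auto simp: c)
      also have "\<dots> = w" unfolding content using d by (simp add: choices_def)
      finally show "c \<in> ?T"
        using permutes_in_image[OF \<sigma>] by (auto simp: colourings_iff c orbit_step_eq)
    next
      fix c assume c: "c \<in> ?T"
      have "(\<lambda>C\<in>?S. c (SOME x. x \<in> C)) (orbit \<sigma> x) = c x" if "x \<in> K" for x
      proof -
        have "(SOME y. y \<in> orbit \<sigma> x) \<in> orbit \<sigma> x"
          using self_in_orbit by (rule someI)
        then show ?thesis using const[of c x] c that by simp
      qed
      then obtain d where d: "d \<in> ?S \<rightarrow>\<^sub>E UNIV" "\<And>x. x \<in> K \<Longrightarrow> d (orbit \<sigma> x) = c x"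
        using restrict_PiE_iff[of _ ?S "\<lambda>_. UNIV"] by (metis UNIV_I)
      have "w = (\<Sum>x\<in>K. single (c x) 1)" using c by (simp add: colourings_iff)
      also have "\<dots> = (\<Sum>x\<in>K. single (d (orbit \<sigma> x)) 1)"
        by (intro sum.cong refl) (simp only: d(2))
      also have "\<dots> = (\<Sum>C\<in>?S. single (d C) (card C))" by (rule content)
      finally have mem: "d \<in> choices ?S card w" using d(1) by (simp add: choices_def)
      have "c = ?f d"
        using c d(2) by (auto simp: colourings_iff PiE_def extensional_def fun_eq_iff)
      then show "c \<in> ?f ` choices ?S card w" using mem by (rule image_eqI)
    qed
  qed
  then have "card (choices ?S card w) = card ?T" by (rule bij_betw_same_card)
  moreover have "mcoeff (cycle_power_sum K \<sigma>) w = of_nat (card (choices ?S card w))"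
    unfolding cycle_power_sum_def by (rule conjunct2[OF mcoeff_prod_power_sum[OF finS ne]])
  ultimately show ?thesis by simp
qed

end

lemma colourings_nonempty:
  assumes "finite K" "total_degree w = card K"
  shows "colourings K w \<noteq> {}"
  using assms
proof (induction K arbitrary: w rule: finite_induct)
  case empty
  then show ?case by (auto simp: colourings_iff)
next
  case (insert x K)
  then have "w \<noteq> 0" by auto
  then obtain v where "v \<in> keys w" by fastforce
  then obtain w' where w': "w = w' + single v 1"
    using split_monomial[of 1 w v] by (auto simp: in_keys_iff Suc_le_eq)
  then obtain c where c: "c \<in> colourings K w'" using insert by fastforce
  let ?c = "c(x := v)"
  have "(\<Sum>y\<in>K. single (?c y) 1) = w'"
    using c insert.hyps by (auto simp: colourings_iff intro!: sum.cong)
  then have "?c \<in> colourings (insert x K) w"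
    using c insert.hyps by (auto simp: colourings_iff w' PiE_def extensional_def add.commute)
  then show ?case by blast
qed

lemma colourings_degree: "c \<in> colourings K w \<Longrightarrow> total_degree w = card K"
  by (auto simp: colourings_iff)

lemma colourings_transitive:
  assumes K: "finite K" and c: "c \<in> colourings K w" "c0 \<in> colourings K w"
  obtains \<tau> where "\<tau> permutes K" "\<forall>x\<in>K. c x = c0 (\<tau> x)"
proof -
  have count: "count (image_mset f (mset_set K)) v = lookup (\<Sum>x\<in>K. single (f x) 1) v" for f :: "nat \<Rightarrow> nat" and v
    using K by (induction K rule: finite_induct) (auto simp: lookup_add lookup_single when_def)
  have "image_mset c (mset_set K) = image_mset c0 (mset_set K)"
    using c by (intro multiset_eqI) (simp add: count colourings_iff)
  then show ?thesis using image_mset_eq_implies_permutes[OF K] that by blast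
qed

text \<open>
  Burnside's count for the transitive action on the colourings with a given content. The stabilizer of
  \<open>c\<close> is a translate of the set of permutations carrying \<open>c0\<close> to \<open>c\<close>, and these sets partition the
  symmetric group.
\<close>

lemma sum_stabilizers:
  assumes K: "finite K"
  shows "(\<Sum>\<sigma> | \<sigma> permutes K. card {c \<in> colourings K w. \<forall>x\<in>K. c (\<sigma> x) = c x}) =
    (if total_degree w = card K then fact (card K) else 0)"
proof (cases "total_degree w = card K")
  case False
  then have "colourings K w = {}" using colourings_degree by blast
  then show ?thesis using False by simp
next
  case True
  then obtain c0 where c0: "c0 \<in> colourings K w" using colourings_nonempty[OF K] by blast
  let ?P = "{\<sigma>. \<sigma> permutes K}"
  let ?move = "\<lambda>c. {\<rho>. \<rho> permutes K \<and> restrict (c0 \<circ> \<rho>) K = c}"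
  have finP: "finite ?P" using K by (simp add: finite_permutations)
  have finC: "finite (colourings K w)" using K by (rule finite_colourings)
  have stab: "card {\<sigma>. \<sigma> permutes K \<and> (\<forall>x\<in>K. c (\<sigma> x) = c x)} = card (?move c)" if c: "c \<in> colourings K w" for c
  proof -
    obtain \<tau> where \<tau>: "\<tau> permutes K" "\<forall>x\<in>K. c x = c0 (\<tau> x)"
      using colourings_transitive[OF K c c0] .
    have ext: "restrict g K = c \<longleftrightarrow> (\<forall>x\<in>K. g x = c x)" for g
      using c by (auto simp: colourings_iff PiE_def extensional_def fun_eq_iff)
    have "bij_betw (\<lambda>\<sigma>. \<tau> \<circ> \<sigma>) {\<sigma>. \<sigma> permutes K \<and> (\<forall>x\<in>K. c (\<sigma> x) = c x)} (?move c)"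
    proof (rule bij_betw_byWitness[where f' = "\<lambda>\<rho>. inv_into UNIV \<tau> \<circ> \<rho>"])
      show "\<forall>\<sigma>\<in>{\<sigma>. \<sigma> permutes K \<and> (\<forall>x\<in>K. c (\<sigma> x) = c x)}. inv_into UNIV \<tau> \<circ> (\<tau> \<circ> \<sigma>) = \<sigma>"
        using permutes_inv_o(2)[OF \<tau>(1)] by (simp flip: comp_assoc)
      show "\<forall>\<rho>\<in>?move c. \<tau> \<circ> (inv_into UNIV \<tau> \<circ> \<rho>) = \<rho>"
        using permutes_inv_o(1)[OF \<tau>(1)] by (simp flip: comp_assoc)
      show "(\<lambda>\<sigma>. \<tau> \<circ> \<sigma>) ` {\<sigma>. \<sigma> permutes K \<and> (\<forall>x\<in>K. c (\<sigma> x) = c x)} \<subseteq> ?move c"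
        using \<tau> permutes_in_image by (fastforce simp: ext permutes_compose)
      show "(\<lambda>\<rho>. inv_into UNIV \<tau> \<circ> \<rho>) ` ?move c \<subseteq> {\<sigma>. \<sigma> permutes K \<and> (\<forall>x\<in>K. c (\<sigma> x) = c x)}"
      proof (intro image_subsetI CollectI conjI ballI)
        fix \<rho> assume "\<rho> \<in> ?move c"
        then have \<rho>: "\<rho> permutes K" "restrict (c0 \<circ> \<rho>) K = c" by auto
        show "inv_into UNIV \<tau> \<circ> \<rho> permutes K"
          by (rule permutes_compose[OF \<rho>(1) permutes_inv[OF \<tau>(1)]])
        fix x assume x: "x \<in> K"
        have "inv_into UNIV \<tau> (\<rho> x) \<in> K"
          using x permutes_in_image[OF \<rho>(1)] permutes_in_image[OF permutes_inv[OF \<tau>(1)]] by simp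
        then have "c (inv_into UNIV \<tau> (\<rho> x)) = c0 (\<rho> x)"
          using \<tau> permutes_inverses(1)[OF \<tau>(1)] by simp
        then show "c ((inv_into UNIV \<tau> \<circ> \<rho>) x) = c x"
          using \<rho>(2)[symmetric] x by simp
      qed
    qed
    then show ?thesis by (rule bij_betw_same_card)
  qed
  have "(\<Sum>\<sigma>\<in>?P. card {c \<in> colourings K w. \<forall>x\<in>K. c (\<sigma> x) = c x}) =
      (\<Sum>\<sigma>\<in>?P. \<Sum>c\<in>colourings K w. if \<forall>x\<in>K. c (\<sigma> x) = c x then 1 else 0)"
    using finC by (intro sum.cong refl) (simp flip: sum.inter_filter)
  also have "\<dots> = (\<Sum>c\<in>colourings K w. \<Sum>\<sigma>\<in>?P. if \<forall>x\<in>K. c (\<sigma> x) = c x then 1 else 0)"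
    by (rule sum.swap)
  also have "\<dots> = (\<Sum>c\<in>colourings K w. card {\<sigma>. \<sigma> permutes K \<and> (\<forall>x\<in>K. c (\<sigma> x) = c x)})"
    using finP by (intro sum.cong refl) (simp flip: sum.inter_filter)
  also have "\<dots> = (\<Sum>c\<in>colourings K w. card (?move c))" by (intro sum.cong refl stab)
  also have "\<dots> = card (\<Union>c\<in>colourings K w. ?move c)"
    using finP finC by (intro card_UN_disjoint[symmetric]) auto
  also have "(\<Union>c\<in>colourings K w. ?move c) = ?P"
  proof -
    have "restrict (c0 \<circ> \<rho>) K \<in> colourings K w" if \<rho>: "\<rho> permutes K" for \<rho>
    proof -
      have "(\<Sum>x\<in>K. single ((restrict (c0 \<circ> \<rho>) K) x) (1::nat)) = (\<Sum>x\<in>K. single (c0 (\<rho> x)) 1)"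
        by simp
      also have "\<dots> = (\<Sum>x\<in>K. single (c0 x) 1)"
        by (rule sum.permute[OF \<rho>, of "\<lambda>x. single (c0 x) 1", unfolded o_def, symmetric])
      finally show ?thesis using c0 by (simp add: colourings_iff)
    qed
    then show ?thesis by auto
  qed
  also have "card ?P = fact (card K)" by (rule card_permutations[OF refl K])
  finally show ?thesis using True by simp
qed

lemma sum_cycle_power_sum:
  assumes "finite K"
  shows "(\<Sum>\<sigma> | \<sigma> permutes K. cycle_power_sum K \<sigma>) = mconst (fact (card K)) * complete_homogeneous (card K)"
proof (rule mseries_eqI)
  fix w
  have "mcoeff (\<Sum>\<sigma> | \<sigma> permutes K. cycle_power_sum K \<sigma>) w =
      (\<Sum>\<sigma> | \<sigma> permutes K. of_nat (card {c \<in> colourings K w. \<forall>x\<in>K. c (\<sigma> x) = c x}))"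
    by (simp add: mcoeff_sum mcoeff_cycle_power_sum[OF assms])
  also have "\<dots> = of_nat (if total_degree w = card K then fact (card K) else 0)"
    unfolding sum_stabilizers[OF assms, symmetric] by simp
  finally show "mcoeff (\<Sum>\<sigma> | \<sigma> permutes K. cycle_power_sum K \<sigma>) w =
      mcoeff (mconst (fact (card K)) * complete_homogeneous (card K)) w"
    by (simp add: mcoeff_complete_homogeneous)
qed

text \<open>
  All degrees of a graded representation are collected in one class function with values in power
  series. The permuted set \<open>K\<close> is arbitrary, so that the recursion over subsets of \<open>K\<close> needs no
  standardization of the subsets.
\<close>

definition frobenius :: "nat set \<Rightarrow> ((nat \<Rightarrow> nat) \<Rightarrow> complex mseries fps) \<Rightarrow> complex mseries fps" where
  "frobenius K f = scalar (1 / fact (card K)) *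
     (\<Sum>\<sigma> | \<sigma> permutes K. f \<sigma> * fps_const (cycle_power_sum K \<sigma>))"

lemma frobenius_cong:
  "(\<And>\<sigma>. \<sigma> permutes K \<Longrightarrow> f \<sigma> = g \<sigma>) \<Longrightarrow> frobenius K f = frobenius K g"
  unfolding frobenius_def by (intro arg_cong2[of _ _ _ _ "(*)"] sum.cong refl) auto

lemma frobenius_times: "frobenius K (\<lambda>\<sigma>. f \<sigma> * c) = frobenius K f * c"
  by (simp add: frobenius_def sum_distrib_left sum_distrib_right mult_ac)

lemma frobenius_one:
  assumes "finite K"
  shows "frobenius K (\<lambda>_. 1) = h_series (card K)"
proof -
  have "frobenius K (\<lambda>_. 1) = fps_const (mconst (1 / fact (card K)) * (\<Sum>\<sigma> | \<sigma> permutes K. cycle_power_sum K \<sigma>))"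
    by (simp add: frobenius_def fps_const_sum flip: fps_const_mult)
  also have "\<dots> = h_series (card K)"
    unfolding sum_cycle_power_sum[OF assms] by (simp add: mult.assoc[symmetric] mconst_mult)
  finally show ?thesis .
qed

context
  fixes K F :: "nat set"
  assumes K: "finite K" and F: "F \<subseteq> K"
begin

lemma permutes_pair_props:
  assumes \<alpha>: "\<alpha> permutes F" and \<beta>: "\<beta> permutes K - F"
  shows "\<alpha> \<circ> \<beta> permutes K" "(\<alpha> \<circ> \<beta>) ` F = F" "\<And>x. x \<in> F \<Longrightarrow> (\<alpha> \<circ> \<beta>) x = \<alpha> x"
    "\<And>x. x \<in> K - F \<Longrightarrow> (\<alpha> \<circ> \<beta>) x = \<beta> x"
proof -
  show "\<alpha> \<circ> \<beta> permutes K"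
    by (rule permutes_compose[OF permutes_subset[OF \<beta>] permutes_subset[OF \<alpha> F]]) auto
  show e: "(\<alpha> \<circ> \<beta>) x = \<alpha> x" if "x \<in> F" for x using \<beta> that by (simp add: permutes_not_in)
  show "(\<alpha> \<circ> \<beta>) ` F = F" using e permutes_image[OF \<alpha>] by (metis image_cong)
  show "(\<alpha> \<circ> \<beta>) x = \<beta> x" if "x \<in> K - F" for x
    using \<alpha> permutes_in_image[OF \<beta>, of x] that by (simp add: permutes_not_in)
qed

lemma cycle_power_sum_pair:
  assumes \<alpha>: "\<alpha> permutes F" and \<beta>: "\<beta> permutes K - F"
  shows "cycle_power_sum K (\<alpha> \<circ> \<beta>) = cycle_power_sum F \<alpha> * cycle_power_sum (K - F) \<beta>"
proof -
  note p = permutes_pair_props[OF \<alpha> \<beta>]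
  have finF: "finite F" using K F finite_subset by blast
  have o1: "orbit (\<alpha> \<circ> \<beta>) x = orbit \<alpha> x" if "x \<in> F" for x
    by (rule orbit_cong0[OF that]) (use p permutes_in_image[OF \<alpha>] in auto)
  have o2: "orbit (\<alpha> \<circ> \<beta>) x = orbit \<beta> x" if "x \<in> K - F" for x
    by (rule orbit_cong0[OF that]) (use p(4) permutes_in_image[OF \<beta>] in \<open>auto simp del: o_apply\<close>)
  have "orbit (\<alpha> \<circ> \<beta>) ` K = orbit (\<alpha> \<circ> \<beta>) ` (F \<union> (K - F))"
    using F by (simp add: Un_absorb1)
  also have "\<dots> = orbit \<alpha> ` F \<union> orbit \<beta> ` (K - F)"
    unfolding image_Un by (intro arg_cong2[of _ _ _ _ "(\<union>)"] image_cong) (auto simp: o1 o2)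
  finally have un: "orbit (\<alpha> \<circ> \<beta>) ` K = orbit \<alpha> ` F \<union> orbit \<beta> ` (K - F)" .
  have "C \<subseteq> F \<and> C \<noteq> {}" if "C \<in> orbit \<alpha> ` F" for C
    using that permutes_orbit_subset[OF \<alpha>] self_in_orbit[OF finF \<alpha>] by blast
  moreover have "C \<subseteq> K - F" if "C \<in> orbit \<beta> ` (K - F)" for C
    using that permutes_orbit_subset[OF \<beta>] by blast
  ultimately have "orbit \<alpha> ` F \<inter> orbit \<beta> ` (K - F) = {}" by blast
  then show ?thesis
    unfolding cycle_power_sum_def un using K finF by (subst prod.union_disjoint) auto
qed

lemma sum_permutes_stable:
  "(\<Sum>\<sigma> | \<sigma> permutes K \<and> \<sigma> ` F = F. g \<sigma>) =
     (\<Sum>(\<alpha>, \<beta>)\<in>{\<alpha>. \<alpha> permutes F} \<times> {\<beta>. \<beta> permutes K - F}. g (\<alpha> \<circ> \<beta>))"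
  for g :: "(nat \<Rightarrow> nat) \<Rightarrow> 'a::comm_monoid_add"
proof (rule sum.reindex_bij_witness[where j = "\<lambda>\<sigma>. (perm_restrict \<sigma> F, perm_restrict \<sigma> (K - F))"
      and i = "\<lambda>(\<alpha>, \<beta>). \<alpha> \<circ> \<beta>"])
  fix \<sigma> assume "\<sigma> \<in> {\<sigma>. \<sigma> permutes K \<and> \<sigma> ` F = F}"
  then have \<sigma>: "\<sigma> permutes K" "\<sigma> ` F = F" by auto
  have inj: "inj_on \<sigma> A" for A using permutes_inj[OF \<sigma>(1)] by (rule inj_on_subset) simp
  have KF: "\<sigma> ` (K - F) = K - F"
    using image_set_diff[OF permutes_inj[OF \<sigma>(1)]] permutes_image[OF \<sigma>(1)] \<sigma>(2) by simp
  have r: "perm_restrict \<sigma> A permutes A" if "\<sigma> ` A = A" for A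
  proof (rule bij_imp_permutes)
    show "bij_betw (perm_restrict \<sigma> A) A A"
      using bij_betw_cong[of A "perm_restrict \<sigma> A" \<sigma> A] inj[of A] that
      by (simp add: perm_restrict_def bij_betw_def)
  qed (simp add: perm_restrict_def)
  show "(perm_restrict \<sigma> F, perm_restrict \<sigma> (K - F)) \<in> {\<alpha>. \<alpha> permutes F} \<times> {\<beta>. \<beta> permutes K - F}"
    using r \<sigma>(2) KF by simp
  have "perm_restrict \<sigma> F \<circ> perm_restrict \<sigma> (K - F) = perm_restrict \<sigma> (F \<union> (K - F))"
    using r \<sigma>(2) KF by (intro perm_restrict_union) auto
  also have "\<dots> = \<sigma>" using F \<sigma>(1) by (simp add: Un_absorb1)
  finally have eq: "perm_restrict \<sigma> F \<circ> perm_restrict \<sigma> (K - F) = \<sigma>" .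
  show "(case (perm_restrict \<sigma> F, perm_restrict \<sigma> (K - F)) of (\<alpha>, \<beta>) \<Rightarrow> \<alpha> \<circ> \<beta>) = \<sigma>"
    using eq by simp
  show "(case (perm_restrict \<sigma> F, perm_restrict \<sigma> (K - F)) of (\<alpha>, \<beta>) \<Rightarrow> g (\<alpha> \<circ> \<beta>)) = g \<sigma>"
    using eq by simp
next
  fix p assume "p \<in> {\<alpha>. \<alpha> permutes F} \<times> {\<beta>. \<beta> permutes K - F}"
  then obtain \<alpha> \<beta> where p: "p = (\<alpha>, \<beta>)" and \<alpha>: "\<alpha> permutes F" and \<beta>: "\<beta> permutes K - F"
    by auto
  note q = permutes_pair_props[OF \<alpha> \<beta>]
  show "(case p of (\<alpha>, \<beta>) \<Rightarrow> \<alpha> \<circ> \<beta>) \<in> {\<sigma>. \<sigma> permutes K \<and> \<sigma> ` F = F}"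
    using q(1,2) by (simp add: p)
  have "perm_restrict (\<alpha> \<circ> \<beta>) F = \<alpha>"
    using q(3) \<alpha> by (auto simp: perm_restrict_def permutes_not_in fun_eq_iff simp del: o_apply)
  moreover have "perm_restrict (\<alpha> \<circ> \<beta>) (K - F) = \<beta>"
    using q(4) \<beta> by (auto simp: perm_restrict_def permutes_not_in fun_eq_iff simp del: o_apply)
  ultimately show "(perm_restrict (case p of (\<alpha>, \<beta>) \<Rightarrow> \<alpha> \<circ> \<beta>) F,
      perm_restrict (case p of (\<alpha>, \<beta>) \<Rightarrow> \<alpha> \<circ> \<beta>) (K - F)) = p"
    by (simp add: p)
qed

end

text \<open>Summing over stable subsets is inducing from Young subgroups, which becomes multiplication of
  Frobenius characteristics.\<close>

lemma frobenius_sum_stable: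
  assumes K: "finite K" and \<F>: "\<And>F. F \<in> \<F> \<Longrightarrow> F \<subseteq> K"
    and local: "\<And>F \<sigma> \<tau>. F \<in> \<F> \<Longrightarrow> (\<And>x. x \<in> F \<Longrightarrow> \<sigma> x = \<tau> x) \<Longrightarrow> f F \<sigma> = f F \<tau>"
  shows "frobenius K (\<lambda>\<sigma>. \<Sum>F | F \<in> \<F> \<and> \<sigma> ` F = F. f F \<sigma>) =
    (\<Sum>F\<in>\<F>. scalar (1 / of_nat (card K choose card F)) *
       (frobenius F (f F) * h_series (card K - card F)))"
proof -
  let ?P = "\<lambda>K. {\<sigma>. \<sigma> permutes K}"
  have fin\<F>: "finite \<F>" using \<F> K by (auto intro: finite_subset[of _ "Pow K"])
  have finP: "finite (?P K)" using K by (simp add: finite_permutations)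
  have "(\<Sum>\<sigma>\<in>?P K. (\<Sum>F | F \<in> \<F> \<and> \<sigma> ` F = F. f F \<sigma>) * fps_const (cycle_power_sum K \<sigma>)) =
      (\<Sum>\<sigma>\<in>?P K. \<Sum>F\<in>\<F>. if \<sigma> ` F = F then f F \<sigma> * fps_const (cycle_power_sum K \<sigma>) else 0)"
    unfolding sum.inter_filter[OF fin\<F>, symmetric] by (simp add: sum_distrib_right)
  also have "\<dots> = (\<Sum>F\<in>\<F>. \<Sum>\<sigma>\<in>?P K. if \<sigma> ` F = F then f F \<sigma> * fps_const (cycle_power_sum K \<sigma>) else 0)"
    by (rule sum.swap)
  also have "\<dots> = (\<Sum>F\<in>\<F>. \<Sum>\<sigma> | \<sigma> permutes K \<and> \<sigma> ` F = F. f F \<sigma> * fps_const (cycle_power_sum K \<sigma>))"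
    by (simp add: sum.inter_filter[OF finP, symmetric])
  also have "\<dots> = (\<Sum>F\<in>\<F>. (\<Sum>\<alpha>\<in>?P F. f F \<alpha> * fps_const (cycle_power_sum F \<alpha>)) *
      (\<Sum>\<beta>\<in>?P (K - F). 1 * fps_const (cycle_power_sum (K - F) \<beta>)))"
  proof (rule sum.cong)
    fix F assume F: "F \<in> \<F>"
    have "f F (\<alpha> \<circ> \<beta>) * fps_const (cycle_power_sum K (\<alpha> \<circ> \<beta>)) =
        f F \<alpha> * fps_const (cycle_power_sum F \<alpha>) * (1 * fps_const (cycle_power_sum (K - F) \<beta>))"
      if "\<alpha> permutes F" "\<beta> permutes K - F" for \<alpha> \<beta>
    proof -
      have "f F (\<alpha> \<circ> \<beta>) = f F \<alpha>"
        using local[OF F, of "\<alpha> \<circ> \<beta>" \<alpha>] permutes_pair_props(3)[OF K \<F>[OF F] that] by blast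
      then show ?thesis using cycle_power_sum_pair[OF K \<F>[OF F] that] by (simp only: fps_const_mult[symmetric] mult_ac mult_1)
    qed
    then show "(\<Sum>\<sigma> | \<sigma> permutes K \<and> \<sigma> ` F = F. f F \<sigma> * fps_const (cycle_power_sum K \<sigma>)) =
        (\<Sum>\<alpha>\<in>?P F. f F \<alpha> * fps_const (cycle_power_sum F \<alpha>)) *
        (\<Sum>\<beta>\<in>?P (K - F). 1 * fps_const (cycle_power_sum (K - F) \<beta>))"
      unfolding sum_permutes_stable[OF K \<F>[OF F]] sum_product sum.cartesian_product
      by (intro sum.cong) auto
  qed simp
  finally have main: "(\<Sum>\<sigma>\<in>?P K. (\<Sum>F | F \<in> \<F> \<and> \<sigma> ` F = F. f F \<sigma>) * fps_const (cycle_power_sum K \<sigma>)) =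
      (\<Sum>F\<in>\<F>. (\<Sum>\<alpha>\<in>?P F. f F \<alpha> * fps_const (cycle_power_sum F \<alpha>)) *
        (\<Sum>\<beta>\<in>?P (K - F). 1 * fps_const (cycle_power_sum (K - F) \<beta>)))" .
  show ?thesis
    unfolding frobenius_def[of K] main
  proof (subst sum_distrib_left, rule sum.cong)
    fix F assume F: "F \<in> \<F>"
    let ?a = "\<Sum>\<alpha>\<in>?P F. f F \<alpha> * fps_const (cycle_power_sum F \<alpha>)"
      and ?b = "\<Sum>\<beta>\<in>?P (K - F). 1 * fps_const (cycle_power_sum (K - F) \<beta>)"
    let ?c = "\<lambda>x. fps_const (mconst x) :: complex mseries fps"
    have c_mult: "?c x * ?c y = ?c (x * y)" for x y by (simp add: mconst_mult)
    have le: "card F \<le> card K" using K \<F>[OF F] by (rule card_mono)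
    have cKF: "card (K - F) = card K - card F"
      using K \<F>[OF F] finite_subset by (metis card_Diff_subset)
    have fact: "1 / of_nat (card K choose card F) * (1 / fact (card F)) * (1 / fact (card K - card F)) = (1 / fact (card K) :: complex)"
      using le by (simp add: binomial_fact field_simps)
    have "?c (1 / of_nat (card K choose card F)) * (frobenius F (f F) * h_series (card K - card F)) =
        ?c (1 / of_nat (card K choose card F)) * (?c (1 / fact (card F)) * ?a * (?c (1 / fact (card K - card F)) * ?b))"
      using frobenius_one[of "K - F"] K by (simp add: frobenius_def cKF)
    also have "\<dots> = ?c (1 / of_nat (card K choose card F)) * ?c (1 / fact (card F)) * ?c (1 / fact (card K - card F)) * (?a * ?b)"
      by (simp only: mult_ac)
    also have "\<dots> = ?c (1 / fact (card K)) * (?a * ?b)" by (simp only: c_mult fact)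
    finally show "?c (1 / fact (card K)) * (?a * ?b) =
      ?c (1 / of_nat (card K choose card F)) * (frobenius F (f F) * h_series (card K - card F))" by simp
  qed simp
qed

text \<open>
  The Frobenius image of the nested monomials with a given largest set of size \<open>k\<close>: the last step of the
  chain goes from a set of size \<open>j\<close> to one of size \<open>k\<close>, with an exponent \<open>a < k - j\<close>.
\<close>

fun nested_frobenius :: "nat \<Rightarrow> complex mseries fps" where
  "nested_frobenius k = (if k = 0 then 1 else
     \<Sum>j<k. nested_frobenius j * h_series (k - j) * (\<Sum>a=1..<k - j. fps_X ^ a))"

declare nested_frobenius.simps [simp del]

text \<open>
  The weights \<open>1 / (card K choose card F)\<close> left by induction cancel the numbers of sets of each size.
\<close>

lemma sum_choose_weighted:
  fixes g :: "nat \<Rightarrow> complex mseries fps"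
  assumes K: "finite K"
  shows "(\<Sum>F | F \<subset> K \<and> card F < l. scalar (1 / of_nat (card K choose card F)) * g (card F)) =
    (\<Sum>j<min l (card K). g j)"
proof -
  have "(\<Sum>F | F \<subset> K \<and> card F < l. scalar (1 / of_nat (card K choose card F)) * g (card F)) =
    (\<Sum>F | F \<subset> K. if card F < l then scalar (1 / of_nat (card K choose card F)) * g (card F) else 0)"
    using K by (subst sum.inter_filter[symmetric]) (auto intro: finite_subset[of _ "Pow K"])
  also have "\<dots> = (\<Sum>j<card K. of_nat (card K choose j) *
      (if j < l then scalar (1 / of_nat (card K choose j)) * g j else 0))"
    by (rule sum_psubsets_card[OF K, of "\<lambda>j. if j < l then scalar (1 / of_nat (card K choose j)) * g j else 0"])
  also have "\<dots> = (\<Sum>j<card K. if j < l then g j else 0)"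
  proof (rule sum.cong)
    fix j assume "j \<in> {..<card K}"
    then have "(of_nat (card K choose j) :: complex) \<noteq> 0" by simp
    moreover have "(of_nat m :: complex mseries fps) = scalar (of_nat m)" for m
      by (simp add: mconst_of_nat fps_of_nat)
    ultimately show "of_nat (card K choose j) * (if j < l then scalar (1 / of_nat (card K choose j)) * g j else 0) =
      (if j < l then g j else 0)"
      by (simp add: mult.assoc[symmetric] mconst_mult)
  qed simp
  also have "\<dots> = (\<Sum>j\<in>{j \<in> {..<card K}. j < l}. g j)"
    by (rule sum.inter_filter[symmetric]) simp
  also have "{j \<in> {..<card K}. j < l} = {..<min l (card K)}" by auto
  finally show ?thesis .
qed

lemma frobenius_top_series:
  assumes "finite K"
  shows "frobenius K (top_series fps_X K) = nested_frobenius (card K)"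
  using assms
proof (induction "card K" arbitrary: K rule: less_induct)
  case less
  show ?case
  proof (cases "K = {}")
    case True
    then show ?thesis
      by (simp add: frobenius_def cycle_power_sum_def nested_frobenius.simps)
  next
    case False
    let ?g = "\<lambda>j. nested_frobenius j * h_series (card K - j) * (\<Sum>a=1..<card K - j. fps_X ^ a)"
    have "frobenius K (top_series fps_X K) =
        frobenius K (\<lambda>\<sigma>. \<Sum>F | F \<in> {F. F \<subset> K} \<and> \<sigma> ` F = F. top_series fps_X F \<sigma> * (\<Sum>a=1..<card K - card F. fps_X ^ a))"
      using top_series_rec[OF less.prems False, of _ fps_X] by (intro frobenius_cong) simp
    also have "\<dots> = (\<Sum>F\<in>{F. F \<subset> K}. scalar (1 / of_nat (card K choose card F)) *
       (frobenius F (\<lambda>\<sigma>. top_series fps_X F \<sigma> * (\<Sum>a=1..<card K - card F. fps_X ^ a)) *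
        h_series (card K - card F)))"
      by (rule frobenius_sum_stable[OF less.prems])
        (auto intro!: arg_cong2[of _ _ _ _ "(*)"] top_series_cong)
    also have "\<dots> = (\<Sum>F\<in>{F. F \<subset> K}. scalar (1 / of_nat (card K choose card F)) * ?g (card F))"
    proof (rule sum.cong)
      fix F assume "F \<in> {F. F \<subset> K}"
      then have "card F < card K" "finite F"
        using less.prems by (auto intro: psubset_card_mono finite_subset)
      then show "scalar (1 / of_nat (card K choose card F)) *
         (frobenius F (\<lambda>\<sigma>. top_series fps_X F \<sigma> * (\<Sum>a=1..<card K - card F. fps_X ^ a)) *
          h_series (card K - card F)) =
        scalar (1 / of_nat (card K choose card F)) * ?g (card F)"
        using less.hyps[of F] by (simp add: frobenius_times mult_ac)
    qed simp
    also have "{F. F \<subset> K} = {F. F \<subset> K \<and> card F < card K}"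
      using less.prems by (auto intro: psubset_card_mono)
    also have "(\<Sum>F\<in>{F. F \<subset> K \<and> card F < card K}. scalar (1 / of_nat (card K choose card F)) * ?g (card F)) =
        (\<Sum>j<card K. ?g j)"
      using sum_choose_weighted[OF less.prems, of ?g "card K"] by simp
    also have "\<dots> = nested_frobenius (card K)"
      using False less.prems by (simp add: nested_frobenius.simps[of "card K"])
    finally show ?thesis .
  qed
qed

lemma (in uniform) frobenius_fy:
  "frobenius E (\<lambda>\<sigma>. \<Sum>m\<in>fixed_monomials \<sigma> (fy_monomials r n). fps_X ^ total_degree m) =
    (\<Sum>j<r. nested_frobenius j * h_series (n - j) * (\<Sum>a<r - j. fps_X ^ a))"
proof -
  let ?g = "\<lambda>j. nested_frobenius j * h_series (n - j) * (\<Sum>a<r - j. fps_X ^ a)"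
  have iff: "card F \<le> r - 1 \<longleftrightarrow> card F < r" for F :: "nat set" using r_pos by auto
  have "frobenius E (\<lambda>\<sigma>. \<Sum>m\<in>fixed_monomials \<sigma> (fy_monomials r n). fps_X ^ total_degree m) =
      frobenius E (\<lambda>\<sigma>. \<Sum>F | F \<in> {F. F \<subset> E \<and> card F < r} \<and> \<sigma> ` F = F. top_series fps_X F \<sigma> * (\<Sum>a<r - card F. fps_X ^ a))"
    using fy_series[of _ fps_X] by (intro frobenius_cong) (simp add: iff conj_assoc)
  also have "\<dots> = (\<Sum>F\<in>{F. F \<subset> E \<and> card F < r}. scalar (1 / of_nat (card E choose card F)) *
     (frobenius F (\<lambda>\<sigma>. top_series fps_X F \<sigma> * (\<Sum>a<r - card F. fps_X ^ a)) *
      h_series (card E - card F)))"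
    by (rule frobenius_sum_stable) (auto intro!: arg_cong2[of _ _ _ _ "(*)"] top_series_cong)
  also have "\<dots> = (\<Sum>F\<in>{F. F \<subset> E \<and> card F < r}. scalar (1 / of_nat (card E choose card F)) * ?g (card F))"
    by (intro sum.cong refl) (auto simp: frobenius_times frobenius_top_series finite_subset mult_ac)
  also have "\<dots> = (\<Sum>j<r. ?g j)"
    using sum_choose_weighted[of E ?g r] r_le by (simp add: min_def)
  finally show ?thesis .
qed

section \<open>Linear independence for uniform matroids\<close>

context uniform
begin

text \<open>
  Multiplication by \<open>x\<^sub>E ^ (n - r)\<close> maps the Chow ring of \<open>U\<^sub>r\<^sub>,\<^sub>n\<close> to that of the Boolean matroid,
  because it annihilates the variables \<open>x\<^sub>F\<close> with \<open>r \<le> card F < n\<close> that distinguish the two linear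
  relations.
\<close>

lemma boolean_uniform: "uniform n n"
  using r_pos r_le by unfold_locales auto

lemma flats_subset_boolean: "L \<subseteq> uniform_flats n n"
  using r_pos r_le by (fastforce simp: uniform_flats_def)

lemma flat_polys_subset_boolean: "p \<in> flat_polys L \<Longrightarrow> p \<in> flat_polys (uniform_flats n n)"
  using flats_subset_boolean unfolding flat_polys_iff by blast

lemma top_power_annihilates:
  assumes F: "F \<subset> E" "r \<le> card F"
  shows "flat_var F * flat_var E ^ (n - r) \<in> (chow_ideal E (uniform_flats n n) :: (nat, 'k::field) flat_poly set)"
proof -
  interpret B: uniform n n by (rule boolean_uniform)
  have c: "card F < n" using psubset_card_mono[OF _ F(1)] by simp
  have FL: "F \<in> B.L" "E \<in> B.L" using F c by (auto simp: B.flat_iff)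
  have ne: "F \<noteq> {}" using F r_pos by auto
  have rk: "B.rk E - B.rk F = n - card F" using FL F(1) by (simp add: B.rk_flat)
  have "{H \<in> B.L. E \<subseteq> H} = {E}" using B.flat_subset FL(2) by blast
  then have up: "upper_sum B.L E = (flat_var E :: (nat, 'k) flat_poly)" by (simp add: upper_sum_def)
  have x: "flat_var E ^ (card F - r) \<in> (flat_polys B.L :: (nat, 'k) flat_poly set)"
    using FL(2) E_nonempty by (intro flat_polys_power flat_polys_flat_var)
  have "flat_var E ^ (card F - r) * (flat_var1 F * upper_sum B.L E ^ (B.rk E - B.rk F)) \<in>
      (chow_ideal E B.L :: (nat, 'k) flat_poly set)"
    by (rule chow_ideal_mult[OF B.flat_var_times_upper_sum_power[OF refl FL F(1)] x])
  also have "flat_var E ^ (card F - r) * (flat_var1 F * upper_sum B.L E ^ (B.rk E - B.rk F)) =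
      (flat_var F * flat_var E ^ (card F - r + (n - card F)) :: (nat, 'k) flat_poly)"
    using ne unfolding rk up flat_var1_def power_add by (simp add: mult_ac)
  also have "card F - r + (n - card F) = n - r" using F(2) c by simp
  finally show ?thesis .
qed

lemma chow_ideal_times_top_power:
  assumes "p \<in> (chow_ideal E L :: (nat, 'k::field) flat_poly set)"
  shows "p * flat_var E ^ (n - r) \<in> chow_ideal E (uniform_flats n n)"
proof -
  let ?L = "uniform_flats n n" and ?x = "flat_var E ^ (n - r) :: (nat, 'k) flat_poly"
  have x: "?x \<in> flat_polys ?L"
    using E_nonempty by (intro flat_polys_power flat_polys_flat_var) (auto simp: uniform_flats_def)
  have "chow_ideal E L \<subseteq> {p. p * ?x \<in> chow_ideal E ?L}"
  proof (rule chow_ideal_least, unfold mem_Collect_eq)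
    show "0 * ?x \<in> chow_ideal E ?L" by simp
  next
    fix p q assume "p * ?x \<in> chow_ideal E ?L" "q * ?x \<in> chow_ideal E ?L"
    then show "(p + q) * ?x \<in> chow_ideal E ?L" unfolding distrib_right by (rule chow_ideal_add)
  next
    fix p u :: "(nat, 'k) flat_poly" assume "u \<in> flat_polys L" "p * ?x \<in> chow_ideal E ?L"
    then show "u * p * ?x \<in> chow_ideal E ?L"
      unfolding mult.assoc by (rule chow_ideal_mult[OF _ flat_polys_subset_boolean, rotated])
  next
    fix F G assume FG: "F \<in> L" "G \<in> L" "F \<noteq> {}" "G \<noteq> {}" "\<not> F \<subseteq> G" "\<not> G \<subseteq> F"
    have "?x * (flat_var F * flat_var G) \<in> chow_ideal E ?L"
      using FG flats_subset_boolean by (intro chow_ideal_mult[OF _ x] incomparable_in_chow_ideal) auto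
    then show "flat_var F * flat_var G * ?x \<in> chow_ideal E ?L" by (simp add: mult.commute)
  next
    fix i assume i: "i \<in> E"
    let ?A = "{F \<in> ?L - {{}}. i \<in> F}" and ?B = "{F \<in> L - {{}}. i \<in> F}"
    have "linear_relation ?L i = (\<Sum>F\<in>?A - ?B. flat_var F) + (linear_relation L i :: (nat, 'k) flat_poly)"
      unfolding linear_relation_def
      by (rule sum.subset_diff) (use flats_subset_boolean in \<open>auto intro: finite_subset[OF _ finite_uniform_flats[of n n]]\<close>)
    then have eq: "linear_relation L i * ?x = ?x * linear_relation ?L i - (\<Sum>F\<in>?A - ?B. flat_var F * ?x)"
      by (simp add: algebra_simps sum_distrib_left)
    have kills: "flat_var F * ?x \<in> chow_ideal E ?L" if F: "F \<in> ?A - ?B" for F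
    proof (rule top_power_annihilates)
      have "F \<in> ?L" "F \<notin> L" using F by auto
      then show "F \<subset> E" "r \<le> card F" by (auto simp: uniform_flats_def)
    qed
    have "?x * linear_relation ?L i \<in> chow_ideal E ?L"
      by (intro chow_ideal_mult linear_relation_in_chow_ideal i x)
    moreover have "(\<Sum>F\<in>?A - ?B. flat_var F * ?x) \<in> chow_ideal E ?L"
      by (rule chow_ideal_sum) (rule kills)
    ultimately show "linear_relation L i * ?x \<in> chow_ideal E ?L"
      unfolding eq by (rule chow_ideal_diff)
  qed
  then show ?thesis using assms by blast
qed

lemma fy_times_top_power:
  assumes "s \<in> fy_monomials r n"
  shows "s + single E (n - r) \<in> fy_monomials n n"
proof -
  interpret B: uniform n n by (rule boolean_uniform)
  obtain p where p: "p \<in> (SIGMA F:{F. F \<subset> E \<and> card F \<le> r - 1}. {..<r - card F} \<times> top_monomials F)"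
    "s = (\<lambda>(F, a, m). m + single E a) p"
    using assms[folded bij_betw_imp_surj_on[OF fy_monomials_bij]] by (elim imageE)
  obtain F a m where "p = (F, a, m)" by (cases p)
  with p have F: "F \<subset> E" "card F \<le> r - 1" and a: "a < r - card F" and m: "m \<in> top_monomials F"
    and s: "s = m + single E a" by auto
  have "(F, a + (n - r), m) \<in> (SIGMA F:{F. F \<subset> E \<and> card F \<le> n - 1}. {..<n - card F} \<times> top_monomials F)"
  proof (intro SigmaI CollectI conjI)
    show "card F \<le> n - 1" "a + (n - r) \<in> {..<n - card F}" using F(2) a r_le by auto
  qed (use F m in simp_all)
  then have "(\<lambda>(F, a, m). m + single E a) (F, a + (n - r), m) \<in> fy_monomials n n"
    unfolding bij_betw_imp_surj_on[OF B.fy_monomials_bij, symmetric] by (rule imageI)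
  then show ?thesis by (simp add: s single_add add.assoc)
qed

lemma fy_independent:
  assumes rel: "(\<Sum>s\<in>fy_degree d. single s (c s)) \<in> (chow_ideal E L :: (nat, complex) flat_poly set)"
    and s0: "s0 \<in> fy_degree d"
  shows "c s0 = 0"
proof -
  have n: "1 \<le> n" using r_pos r_le by simp
  interpret B: flag_points n using n by unfold_locales
  let ?e = "single E (n - r)" and ?d = "d + (n - r)"
  let ?c = "\<lambda>s. if s \<in> (\<lambda>s. s + ?e) ` fy_degree d then c (s - ?e) else 0"
  have sub: "(\<lambda>s. s + ?e) ` fy_degree d \<subseteq> B.fy_degree ?d"
    using fy_times_top_power by (auto simp: fy_degree_def B.fy_degree_def)
  have "(\<Sum>s\<in>fy_degree d. single s (c s)) * flat_var E ^ (n - r) = (\<Sum>s\<in>fy_degree d. single (s + ?e) (c s))"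
    by (simp add: flat_var_power sum_distrib_right mult_single)
  also have "\<dots> = (\<Sum>s\<in>(\<lambda>s. s + ?e) ` fy_degree d. single s (?c s))"
    by (subst sum.reindex) (auto intro!: inj_onI sum.cong)
  also have "\<dots> = (\<Sum>s\<in>B.fy_degree ?d. single s (?c s))"
    by (rule sum.mono_neutral_left[OF _ sub]) auto
  finally have "(\<Sum>s\<in>B.fy_degree ?d. single s (?c s)) \<in> (chow_ideal E B.L :: (nat, complex) flat_poly set)"
    using chow_ideal_times_top_power[OF rel] by simp
  then have "?c (s0 + ?e) = 0"
    using sub s0 by (intro B.boolean_independent[where d = ?d and c = ?c]) (auto simp: card_fy_boolean[OF n])
  then show ?thesis using s0 by (auto split: if_splits)
qed

end

section \<open>Coordinates and traces\<close>

locale coordinate_space =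
  fixes V :: "('k::field, 'v) module" (structure)
  assumes abelian_group: "abelian_group V"
    and smult_closed: "v \<in> carrier V \<Longrightarrow> c \<odot> v \<in> carrier V"
    and smult_l_distr: "v \<in> carrier V \<Longrightarrow> (c + d) \<odot> v = c \<odot> v \<oplus> d \<odot> v"
    and smult_r_distr: "v \<in> carrier V \<Longrightarrow> w \<in> carrier V \<Longrightarrow> c \<odot> (v \<oplus> w) = c \<odot> v \<oplus> c \<odot> w"
    and smult_assoc: "v \<in> carrier V \<Longrightarrow> (c * d) \<odot> v = c \<odot> (d \<odot> v)"
    and smult_one: "v \<in> carrier V \<Longrightarrow> 1 \<odot> v = v"
begin

sublocale abelian_group V by (rule abelian_group)

lemma smult_zero_left: "v \<in> carrier V \<Longrightarrow> 0 \<odot> v = \<zero>"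
  using smult_l_distr[of v 0 0] smult_closed[of v 0] r_neg1 by (metis add.l_cancel_one' add_0)

lemma smult_zero_right: "c \<odot> \<zero> = \<zero>"
  using smult_assoc[of \<zero> c 0] smult_zero_left[of \<zero>] by simp

lemma finsum_smult:
  "finite A \<Longrightarrow> f \<in> A \<rightarrow> carrier V \<Longrightarrow> c \<odot> (\<Oplus>x\<in>A. f x) = (\<Oplus>x\<in>A. c \<odot> f x)"
  by (induction A rule: finite_induct)
    (auto simp: smult_zero_right smult_r_distr smult_closed Pi_def finsum_insert finsum_closed)

definition coordinates :: "'v set \<Rightarrow> 'v \<Rightarrow> 'v \<Rightarrow> 'k" where
  "coordinates B v = (THE c. coordinates_wrt V B v c)"

context
  fixes B :: "'v set"
  assumes B: "finite_basis V B"
begin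

lemma basis_finite: "finite B" and basis_carrier: "B \<subseteq> carrier V"
  using B by (auto simp: finite_basis_def)

lemma coordinates_wrt_coordinates: "v \<in> carrier V \<Longrightarrow> coordinates_wrt V B v (coordinates B v)"
  unfolding coordinates_def by (rule theI'[of "coordinates_wrt V B v"]) (use B in \<open>simp add: finite_basis_def\<close>)

lemma coordinates_expand: "v \<in> carrier V \<Longrightarrow> v = (\<Oplus>b\<in>B. coordinates B v b \<odot> b)"
  using coordinates_wrt_coordinates by (auto simp: coordinates_wrt_def)

lemma coordinates_unique:
  assumes "v \<in> carrier V" "v = (\<Oplus>b\<in>B. c b \<odot> b)" "b \<in> B"
  shows "coordinates B v b = c b"
proof -
  have "(\<Oplus>b\<in>B. restrict c B b \<odot> b) = (\<Oplus>b\<in>B. c b \<odot> b)"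
    using basis_carrier by (intro finsum_cong') (auto simp: smult_closed)
  then have "coordinates_wrt V B v (restrict c B)"
    using assms by (simp add: coordinates_wrt_def)
  then have "coordinates B v = restrict c B"
    using coordinates_wrt_coordinates[OF assms(1)] B assms(1) unfolding finite_basis_def by blast
  then show ?thesis using assms(3) by simp
qed

lemma coordinates_add:
  assumes "v \<in> carrier V" "w \<in> carrier V" "b \<in> B"
  shows "coordinates B (v \<oplus> w) b = coordinates B v b + coordinates B w b"
proof (rule coordinates_unique)
  have "v \<oplus> w = (\<Oplus>b\<in>B. coordinates B v b \<odot> b) \<oplus> (\<Oplus>b\<in>B. coordinates B w b \<odot> b)"
    using coordinates_expand assms by metis
  also have "\<dots> = (\<Oplus>b\<in>B. coordinates B v b \<odot> b \<oplus> coordinates B w b \<odot> b)"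
    using basis_carrier by (intro finsum_addf[symmetric]) (auto simp: smult_closed)
  also have "\<dots> = (\<Oplus>b\<in>B. (coordinates B v b + coordinates B w b) \<odot> b)"
    using basis_carrier by (intro finsum_cong') (auto simp: smult_closed smult_l_distr)
  finally show "v \<oplus> w = (\<Oplus>b\<in>B. (coordinates B v b + coordinates B w b) \<odot> b)" .
qed (use assms in auto)

lemma coordinates_smult:
  assumes "v \<in> carrier V" "b \<in> B"
  shows "coordinates B (c \<odot> v) b = c * coordinates B v b"
proof (rule coordinates_unique)
  have "c \<odot> v = c \<odot> (\<Oplus>b\<in>B. coordinates B v b \<odot> b)"
    using coordinates_expand assms by metis
  also have "\<dots> = (\<Oplus>b\<in>B. c \<odot> (coordinates B v b \<odot> b))"
    using basis_carrier basis_finite by (intro finsum_smult) (auto simp: smult_closed)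
  also have "\<dots> = (\<Oplus>b\<in>B. (c * coordinates B v b) \<odot> b)"
    using basis_carrier by (intro finsum_cong') (auto simp: smult_closed smult_assoc)
  finally show "c \<odot> v = (\<Oplus>b\<in>B. (c * coordinates B v b) \<odot> b)" .
qed (use assms in \<open>auto simp: smult_closed\<close>)

lemma coordinates_zero: "b \<in> B \<Longrightarrow> coordinates B \<zero> b = 0"
  using coordinates_smult[of \<zero> b 0] by (simp add: smult_zero_right)

lemma coordinates_finsum:
  assumes "finite A" "f \<in> A \<rightarrow> carrier V" "b \<in> B"
  shows "coordinates B (\<Oplus>x\<in>A. c x \<odot> f x) b = (\<Sum>x\<in>A. c x * coordinates B (f x) b)"
  using assms
  by (induction A rule: finite_induct)
    (auto simp: coordinates_zero finsum_insert coordinates_add coordinates_smult smult_closed finsum_closed Pi_def)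

lemma coordinates_basis:
  assumes "b \<in> B" "b' \<in> B"
  shows "coordinates B b b' = (if b' = b then 1 else 0)"
proof (rule coordinates_unique)
  have "(\<Oplus>x\<in>B. (if x = b then 1 else 0) \<odot> x) = (\<Oplus>x\<in>B. if b = x then b else \<zero>)"
    using assms basis_carrier by (intro finsum_cong') (auto simp: smult_one smult_zero_left)
  also have "\<dots> = b"
    using assms basis_carrier basis_finite by (intro finsum_singleton) auto
  finally show "b = (\<Oplus>x\<in>B. (if x = b then 1 else 0) \<odot> x)" by simp
qed (use assms basis_carrier in auto)

end

text \<open>
  With \<open>P\<close> the change of basis and \<open>M\<close> the mixed matrix of \<open>f\<close>, taking \<open>B'\<close> to coordinates in \<open>B\<close>, both
  sums are the trace of \<open>P\<close> times \<open>M\<close>, in the two orders.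
\<close>

lemma trace_basis_independent:
  assumes B: "finite_basis V B" and B': "finite_basis V B'"
    and f: "f \<in> carrier V \<rightarrow> carrier V"
    and f_add: "\<And>v w. v \<in> carrier V \<Longrightarrow> w \<in> carrier V \<Longrightarrow> f (v \<oplus> w) = f v \<oplus> f w"
    and f_smult: "\<And>c v. v \<in> carrier V \<Longrightarrow> f (c \<odot> v) = c \<odot> f v"
  shows "(\<Sum>b\<in>B. coordinates B (f b) b) = (\<Sum>b\<in>B'. coordinates B' (f b) b)"
proof -
  note c = basis_carrier[OF B] basis_carrier[OF B'] basis_finite[OF B] basis_finite[OF B']
  have f_zero: "f \<zero> = \<zero>"
    using f_smult[of \<zero> 0] smult_zero_left f by (auto simp: Pi_def)
  have f_finsum: "f (\<Oplus>x\<in>A. k x \<odot> x) = (\<Oplus>x\<in>A. k x \<odot> f x)"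
    if "finite A" "A \<subseteq> carrier V" for A k
    using that f
    by (induction A rule: finite_induct)
      (auto simp: f_zero finsum_insert smult_closed finsum_closed Pi_def f_add f_smult subset_eq)
  have "(\<Sum>b\<in>B. coordinates B (f b) b) =
      (\<Sum>b\<in>B. \<Sum>b'\<in>B'. coordinates B' b b' * coordinates B (f b') b)"
  proof (rule sum.cong)
    fix b assume b: "b \<in> B"
    have "f b = f (\<Oplus>b'\<in>B'. coordinates B' b b' \<odot> b')"
      using coordinates_expand[OF B', of b] b c by auto
    also have "\<dots> = (\<Oplus>b'\<in>B'. coordinates B' b b' \<odot> f b')"
      using c by (intro f_finsum) auto
    finally show "coordinates B (f b) b = (\<Sum>b'\<in>B'. coordinates B' b b' * coordinates B (f b') b)"
      using coordinates_finsum[OF B c(4) _ b, of f "coordinates B' b"] f c by auto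
  qed simp
  also have "\<dots> = (\<Sum>b'\<in>B'. \<Sum>b\<in>B. coordinates B (f b') b * coordinates B' b b')"
    by (subst sum.swap) (simp add: mult.commute)
  also have "\<dots> = (\<Sum>b'\<in>B'. coordinates B' (f b') b')"
  proof (rule sum.cong)
    fix b' assume b': "b' \<in> B'"
    then have fb: "f b' \<in> carrier V" using f c by auto
    have "coordinates B' (f b') b' = coordinates B' (\<Oplus>b\<in>B. coordinates B (f b') b \<odot> b) b'"
      using coordinates_expand[OF B fb] by simp
    also have "\<dots> = (\<Sum>b\<in>B. coordinates B (f b') b * coordinates B' b b')"
      using c by (intro coordinates_finsum[OF B' _ _ b']) auto
    finally show "(\<Sum>b\<in>B. coordinates B (f b') b * coordinates B' b b') = coordinates B' (f b') b'"
      by simp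
  qed simp
  finally show ?thesis .
qed

text \<open>
  The trace of a permutation matrix counts the fixed basis elements.
\<close>

lemma linear_trace_permuted_basis:
  assumes B: "finite_basis V B" and perm: "\<And>b. b \<in> B \<Longrightarrow> f b \<in> B"
    and f: "f \<in> carrier V \<rightarrow> carrier V"
    and f_add: "\<And>v w. v \<in> carrier V \<Longrightarrow> w \<in> carrier V \<Longrightarrow> f (v \<oplus> w) = f v \<oplus> f w"
    and f_smult: "\<And>c v. v \<in> carrier V \<Longrightarrow> f (c \<odot> v) = c \<odot> f v"
  shows "linear_trace V f = of_nat (card {b \<in> B. f b = b})"
proof -
  let ?B = "SOME B. finite_basis V B"
  have "finite_basis V ?B" using B by (rule someI)
  then have "linear_trace V f = (\<Sum>b\<in>B. coordinates B (f b) b)"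
    unfolding linear_trace_def Let_def coordinates_def[symmetric]
    using trace_basis_independent[OF _ B f f_add f_smult] by blast
  also have "\<dots> = (\<Sum>b\<in>B. if f b = b then 1 else 0)"
    using coordinates_basis[OF B] perm by (intro sum.cong refl) auto
  also have "\<dots> = of_nat (card {b \<in> B. f b = b})"
    using basis_finite[OF B] by (simp flip: sum.inter_filter)
  finally show ?thesis .
qed

end

section \<open>The graded pieces of the Chow ring as permutation modules\<close>

lemma chow_class_conv: "chow_class E L p = (\<lambda>h. h + p) ` chow_ideal E L"
  by (auto simp: chow_class_def a_r_coset_def')

context
  fixes E :: "'e set" and L :: "'e set set"
begin

abbreviation cls :: "('e, 'k::field) flat_poly \<Rightarrow> ('e, 'k) flat_poly set" where
  "cls \<equiv> chow_class E L"

lemma chow_class_eq_iff: "cls p = cls q \<longleftrightarrow> p - q \<in> chow_ideal E L"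
proof
  assume "cls p = cls q"
  moreover have "0 + p \<in> cls p" unfolding chow_class_conv by (rule imageI) simp
  ultimately obtain h where "p = h + q" "h \<in> chow_ideal E L" by (auto simp: chow_class_conv)
  then show "p - q \<in> chow_ideal E L" by simp
next
  assume I: "p - q \<in> chow_ideal E L"
  have "h + p \<in> cls q" if "h \<in> chow_ideal E L" for h
    unfolding chow_class_conv
    by (rule image_eqI[of _ _ "h + (p - q)"]) (use that I in \<open>auto intro: chow_ideal_add\<close>)
  moreover have "h + q \<in> cls p" if "h \<in> chow_ideal E L" for h
    unfolding chow_class_conv
    by (rule image_eqI[of _ _ "h - (p - q)"]) (use that I in \<open>auto intro: chow_ideal_diff\<close>)
  ultimately show "cls p = cls q" by (auto simp: chow_class_conv)
qed

lemma chow_ring_ops: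
  fixes p q :: "('e, 'k::field) flat_poly"
  assumes "p \<in> flat_polys L" "q \<in> flat_polys L"
  shows "cls p \<oplus>\<^bsub>chow_ring E L\<^esub> cls q = cls (p + q)"
    and "cls p \<otimes>\<^bsub>chow_ring E L\<^esub> cls q = cls (p * q)"
    and "\<zero>\<^bsub>chow_ring E L\<^esub> = cls (0 :: ('e, 'k) flat_poly)"
    and "cls p \<in> carrier (chow_ring E L)"
proof -
  interpret ideal "chow_ideal E L" "flat_poly_ring L :: ('e, 'k) flat_poly ring"
    by (rule ideal_chow_ideal)
  have hom: "cls \<in> ring_hom (flat_poly_ring L :: ('e, 'k) flat_poly ring) (chow_ring E L)"
    unfolding chow_class_def chow_ring_def by (rule rcos_ring_hom)
  show "cls p \<oplus>\<^bsub>chow_ring E L\<^esub> cls q = cls (p + q)" "cls p \<otimes>\<^bsub>chow_ring E L\<^esub> cls q = cls (p * q)"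
    using ring_hom_add[OF hom assms] ring_hom_mult[OF hom assms] by simp_all
  show "\<zero>\<^bsub>chow_ring E L\<^esub> = cls (0 :: ('e, 'k) flat_poly)"
    unfolding chow_ring_def chow_class_conv by (simp add: FactRing_def)
  show "cls p \<in> carrier (chow_ring E L)" using ring_hom_closed[OF hom assms(1)] .
qed

lemma flat_polys_const [simp]: "single 0 c \<in> flat_polys L"
  by auto

lemma homogeneous_iff: "homogeneous i p \<longleftrightarrow> (\<forall>m\<in>keys p. total_degree m = i)"
  by (simp add: homogeneous_def total_degree_def)

lemma homogeneous_0 [simp]: "homogeneous i 0"
  by (simp add: homogeneous_iff)

lemma homogeneous_add: "homogeneous i p \<Longrightarrow> homogeneous i q \<Longrightarrow> homogeneous i (p + q)"
  using keys_add[of p q] by (auto simp: homogeneous_iff)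

lemma homogeneous_smult: "homogeneous i p \<Longrightarrow> homogeneous i (single 0 c * p)"
  using keys_mult[of "single 0 c" p] by (fastforce simp: homogeneous_iff split: if_splits)

lemma homogeneous_single: "total_degree m = i \<Longrightarrow> homogeneous i (single m c)"
  by (auto simp: homogeneous_iff split: if_splits)

abbreviation forms :: "nat \<Rightarrow> ('e, 'k::field) flat_poly set" where
  "forms i \<equiv> {p \<in> flat_polys L. homogeneous i p}"

lemma piece_carrier: "carrier (chow_piece E L i) = cls ` forms i"
  by (simp add: chow_piece_def)

lemma piece_ops:
  fixes p q :: "('e, 'k::field) flat_poly"
  assumes "p \<in> flat_polys L" "q \<in> flat_polys L"
  shows "cls p \<oplus>\<^bsub>chow_piece E L i\<^esub> cls q = cls (p + q)"
    and "c \<odot>\<^bsub>chow_piece E L i\<^esub> cls p = cls (single 0 c * p)"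
    and "\<zero>\<^bsub>chow_piece E L i\<^esub> = cls (0 :: ('e, 'k) flat_poly)"
proof -
  have c: "single 0 c \<in> (flat_polys L :: ('e, 'k) flat_poly set)" by auto
  show "cls p \<oplus>\<^bsub>chow_piece E L i\<^esub> cls q = cls (p + q)"
    and "c \<odot>\<^bsub>chow_piece E L i\<^esub> cls p = cls (single 0 c * p)"
    and "\<zero>\<^bsub>chow_piece E L i\<^esub> = cls (0 :: ('e, 'k) flat_poly)"
    using chow_ring_ops(1)[OF assms] chow_ring_ops(2)[OF c assms(1)] chow_ring_ops(3)[OF assms]
    by (simp_all add: chow_piece_def chow_algebra_def)
qed

lemma coordinate_space_piece: "coordinate_space (chow_piece E L i :: ('k::field, ('e, 'k) flat_poly set) module)"
proof (rule coordinate_space.intro)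
  let ?V = "chow_piece E L i :: ('k, ('e, 'k) flat_poly set) module"
  show "abelian_group ?V"
  proof (rule abelian_groupI)
    fix x assume "x \<in> carrier ?V"
    then obtain p where p: "x = cls p" "p \<in> forms i" by (auto simp: piece_carrier)
    have "single 0 (- 1) * p \<in> forms i"
      using p(2) by (auto intro!: homogeneous_smult flat_polys_mult flat_polys_single)
    moreover have "cls (single 0 (- 1) * p) \<oplus>\<^bsub>?V\<^esub> x = \<zero>\<^bsub>?V\<^esub>"
      using p by (subst p(1), subst piece_ops) (auto simp: piece_ops(3)[of 0 0] single_uminus)
    ultimately show "\<exists>y\<in>carrier ?V. y \<oplus>\<^bsub>?V\<^esub> x = \<zero>\<^bsub>?V\<^esub>"
      by (auto simp: piece_carrier)
  qed (auto simp: piece_carrier piece_ops piece_ops(3)[of 0 0] intro!: imageI homogeneous_add 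
    simp: algebra_simps flat_polys_add)
qed (auto simp: piece_carrier piece_ops flat_polys_add flat_polys_mult intro!: imageI homogeneous_smult
    simp: distrib_left distrib_right single_add mult_single mult.assoc[symmetric])

lemma finsum_piece:
  fixes f :: "'x \<Rightarrow> ('e, 'k::field) flat_poly"
  assumes "finite A" "\<And>x. x \<in> A \<Longrightarrow> f x \<in> forms i"
  shows "(\<Oplus>\<^bsub>chow_piece E L i\<^esub>x\<in>A. cls (f x)) = cls (\<Sum>x\<in>A. f x)"
proof -
  interpret coordinate_space "chow_piece E L i :: ('k, ('e, 'k) flat_poly set) module"
    by (rule coordinate_space_piece)
  show ?thesis
    using assms
  proof (induction A rule: finite_induct)
    case empty
    show ?case by (simp add: piece_ops(3)[of 0 0])
  next
    case (insert x A)
    have f: "sum f A \<in> flat_polys L" "f x \<in> flat_polys L" using insert.prems by auto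
    have "(\<Oplus>\<^bsub>chow_piece E L i\<^esub>x\<in>insert x A. cls (f x)) =
        cls (f x) \<oplus>\<^bsub>chow_piece E L i\<^esub> (\<Oplus>\<^bsub>chow_piece E L i\<^esub>x\<in>A. cls (f x))"
      using insert by (intro finsum_insert) (auto simp: piece_carrier)
    then show ?case using insert f by (simp add: piece_ops)
  qed
qed

end

lemma relabel_vars_conv:
  "relabel_vars g p = monomial_extension (single 0) (\<lambda>m. single (relabel_monomial g m) 1) p"
  by (simp add: relabel_vars_def monomial_extension_def relabel_monomial_def mult_single)

context
  fixes g :: "'e set \<Rightarrow> 'e set"
begin

interpretation multiplicative_extension "single 0 :: 'k::field \<Rightarrow> ('e, 'k) flat_poly"
  "\<lambda>m. single (relabel_monomial g m) 1"
  by unfold_locales (simp_all add: single_add mult_single)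

lemmas relabel_vars_add = ext_add[folded relabel_vars_conv]
  and relabel_vars_mult = ext_mult[folded relabel_vars_conv]
  and relabel_vars_sum = ext_sum[folded relabel_vars_conv]
  and relabel_vars_0 [simp] = ext_0[folded relabel_vars_conv]

lemma relabel_vars_single [simp]:
  "relabel_vars g (single m c :: ('e, 'k::field) flat_poly) = single (relabel_monomial g m) c"
  using ext_single[of m c] by (simp add: relabel_vars_conv mult_single)

end

lemma relabel_vars_flat_var [simp]: "relabel_vars g (flat_var F) = flat_var (g F)"
  by (simp add: flat_var_def)

lemma relabel_vars_relabel: "relabel_vars g (relabel_vars g' p) = relabel_vars (g \<circ> g') p"
  by (subst (1 2) poly_mapping_eq_sum_single[of p])
    (simp only: relabel_vars_sum relabel_vars_single relabel_monomial_relabel)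

lemma relabel_vars_id: "relabel_vars id p = p"
  by (subst (1 2) poly_mapping_eq_sum_single[of p])
    (simp only: relabel_vars_sum relabel_vars_single relabel_monomial_id)

lemma lookup_relabel_monomial:
  assumes "inj g"
  shows "lookup (relabel_monomial g m) (g F) = lookup m F"
proof -
  have "lookup (relabel_monomial g m) (g F) = (\<Sum>G\<in>keys m. if G = F then lookup m G else 0)"
    using assms by (auto simp: relabel_monomial_def lookup_sum lookup_single when_def inj_eq intro!: sum.cong)
  also have "\<dots> = lookup m F" by (simp add: in_keys_iff)
  finally show ?thesis .
qed

context uniform
begin

context
  fixes \<sigma> :: "nat \<Rightarrow> nat"
  assumes \<sigma>: "\<sigma> permutes E"
begin

lemma inj_image_\<sigma>: "inj (image \<sigma>)"
  using permutes_inj[OF \<sigma>] by (metis inj_image_eq_iff injI)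

lemma card_image_\<sigma> [simp]: "card (\<sigma> ` F) = card F"
  using permutes_inj[OF \<sigma>] by (metis card_image inj_on_subset subset_UNIV)

lemma image_flat: "\<sigma> ` F \<in> L \<longleftrightarrow> F \<in> L"
proof -
  have "\<sigma> ` F \<subseteq> E \<longleftrightarrow> F \<subseteq> E"
    using permutes_in_image[OF \<sigma>] by auto
  moreover have "\<sigma> ` F = E \<longleftrightarrow> F = E"
    using permutes_image[OF \<sigma>] permutes_inj[OF \<sigma>] by (metis inj_image_eq_iff)
  ultimately show ?thesis by (simp add: flat_iff)
qed

lemma relabel_fy:
  assumes "s \<in> fy_degree d"
  shows "relabel_monomial (image \<sigma>) s \<in> fy_degree d"
proof -
  have sub: "\<sigma> ` A \<subseteq> \<sigma> ` B \<longleftrightarrow> A \<subseteq> B" for A B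
    using permutes_inj[OF \<sigma>] by (simp add: inj_image_subset_iff)
  have psub: "\<sigma> ` A \<subset> \<sigma> ` B \<longleftrightarrow> A \<subset> B" for A B
    unfolding psubset_eq sub using inj_image_\<sigma> by (auto simp: inj_eq)
  have s: "keys s \<subseteq> L - {{}}" "nested rk s" "total_degree s = d"
    using assms by (auto simp: fy_degree_def fy_monomials_def)
  have "keys (relabel_monomial (image \<sigma>) s) \<subseteq> L - {{}}"
    using s(1) by (auto simp: keys_relabel_monomial image_flat)
  moreover have "nested rk (relabel_monomial (image \<sigma>) s)"
  proof -
    have ins: "insert {} (image \<sigma> ` keys s) = image \<sigma> ` insert {} (keys s)" by simp
    show ?thesis
      using s(2) unfolding nested_def keys_relabel_monomial ins
      by (simp add: sub psub psub[of "{}", simplified] lookup_relabel_monomial[OF inj_image_\<sigma>] uniform_rank_def)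
  qed
  ultimately show ?thesis using s(3) by (simp add: fy_degree_def fy_monomials_def)
qed

lemma relabel_flat_polys:
  assumes "p \<in> flat_polys L"
  shows "relabel_vars (image \<sigma>) p \<in> flat_polys L"
proof -
  have "relabel_vars (image \<sigma>) p = (\<Sum>m\<in>keys p. single (relabel_monomial (image \<sigma>) m) (lookup p m))"
    by (subst poly_mapping_eq_sum_single[of p]) (simp only: relabel_vars_sum relabel_vars_single)
  also have "\<dots> \<in> flat_polys L"
  proof (intro flat_polys_sum flat_polys_single)
    fix m assume "m \<in> keys p"
    then have "keys m \<subseteq> L - {{}}" using assms by (auto simp only: flat_polys_iff)
    then show "keys (relabel_monomial (image \<sigma>) m) \<subseteq> L - {{}}"
      by (auto simp: keys_relabel_monomial image_flat)
  qed
  finally show ?thesis .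
qed

lemma relabel_homogeneous:
  assumes "homogeneous i p"
  shows "homogeneous i (relabel_vars (image \<sigma>) p)"
proof -
  have "relabel_vars (image \<sigma>) p = (\<Sum>m\<in>keys p. single (relabel_monomial (image \<sigma>) m) (lookup p m))"
    by (subst poly_mapping_eq_sum_single[of p]) (simp only: relabel_vars_sum relabel_vars_single)
  moreover have "homogeneous i (\<Sum>m\<in>A. single (relabel_monomial (image \<sigma>) m) (lookup p m))"
    if "A \<subseteq> keys p" "finite A" for A
    using that(2,1) assms
    by (induction A rule: finite_induct)
      (auto intro!: homogeneous_add homogeneous_single simp: homogeneous_iff[of i p])
  ultimately show ?thesis by simp
qed

lemma relabel_chow_ideal:
  assumes "p \<in> (chow_ideal E L :: (nat, 'k::field) flat_poly set)"
  shows "relabel_vars (image \<sigma>) p \<in> chow_ideal E L"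
proof -
  let ?I = "chow_ideal E L :: (nat, 'k) flat_poly set" and ?r = "relabel_vars (image \<sigma>) :: (nat, 'k) flat_poly \<Rightarrow> _"
  have "?I \<subseteq> {p. ?r p \<in> ?I}"
  proof (rule chow_ideal_least, unfold mem_Collect_eq)
    fix p q assume "?r p \<in> ?I" "?r q \<in> ?I"
    then show "?r (p + q) \<in> ?I" unfolding relabel_vars_add by (rule chow_ideal_add)
  next
    fix p u :: "(nat, 'k) flat_poly" assume "u \<in> flat_polys L" "?r p \<in> ?I"
    then show "?r (u * p) \<in> ?I" unfolding relabel_vars_mult by (intro chow_ideal_mult relabel_flat_polys)
  next
    fix F G assume "F \<in> L" "G \<in> L" "F \<noteq> {}" "G \<noteq> {}" "\<not> F \<subseteq> G" "\<not> G \<subseteq> F"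
    then show "?r (flat_var F * flat_var G) \<in> ?I"
      using permutes_inj[OF \<sigma>] unfolding relabel_vars_mult relabel_vars_flat_var
      by (intro incomparable_in_chow_ideal) (auto simp: image_flat inj_image_subset_iff)
  next
    fix i assume i: "i \<in> E"
    have "?r (linear_relation L i) = (\<Sum>F\<in>{F \<in> L - {{}}. i \<in> F}. flat_var (\<sigma> ` F))"
      by (simp add: linear_relation_def relabel_vars_sum)
    also have "\<dots> = (\<Sum>F\<in>image \<sigma> ` {F \<in> L - {{}}. i \<in> F}. flat_var F)"
      using inj_image_\<sigma> by (subst sum.reindex) (auto intro: inj_on_subset)
    also have "image \<sigma> ` {F \<in> L - {{}}. i \<in> F} = {F \<in> L - {{}}. \<sigma> i \<in> F}"
    proof (intro equalityI subsetI)
      fix F assume F: "F \<in> {F \<in> L - {{}}. \<sigma> i \<in> F}"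
      have "F = \<sigma> ` (inv_into UNIV \<sigma> ` F)"
        using permutes_surj[OF \<sigma>] by (simp add: image_f_inv_f)
      moreover have "i \<in> inv_into UNIV \<sigma> ` F"
        using F permutes_inverses(2)[OF \<sigma>, of i] by (metis (no_types, lifting) imageI mem_Collect_eq)
      moreover from calculation have "inv_into UNIV \<sigma> ` F \<in> L"
        using F image_flat[of "inv_into UNIV \<sigma> ` F"] by simp
      ultimately show "F \<in> image \<sigma> ` {F \<in> L - {{}}. i \<in> F}"
        using F by (intro image_eqI[of _ _ "inv_into UNIV \<sigma> ` F"]) auto
    qed (auto simp: image_flat)
    finally have "?r (linear_relation L i) = linear_relation L (\<sigma> i)"
      by (simp add: linear_relation_def)
    moreover have "\<sigma> i \<in> E" using i permutes_in_image[OF \<sigma>] by simp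
    ultimately show "?r (linear_relation L i) \<in> ?I" using linear_relation_in_chow_ideal by metis
  qed simp
  then show ?thesis using assms by blast
qed

end

lemma relabel_chow_ideal_image:
  assumes \<sigma>: "\<sigma> permutes E"
  shows "relabel_vars (image \<sigma>) ` chow_ideal E L = (chow_ideal E L :: (nat, 'k::field) flat_poly set)"
proof (intro equalityI subsetI)
  fix p :: "(nat, 'k) flat_poly" assume p: "p \<in> chow_ideal E L"
  let ?q = "relabel_vars (image (inv_into UNIV \<sigma>)) p"
  have "image \<sigma> \<circ> image (inv_into UNIV \<sigma>) = id"
    using permutes_surj[OF \<sigma>] by (auto simp: fun_eq_iff image_f_inv_f)
  then have "p = relabel_vars (image \<sigma>) ?q" by (simp add: relabel_vars_relabel relabel_vars_id)
  moreover have "?q \<in> chow_ideal E L" using permutes_inv[OF \<sigma>] p by (rule relabel_chow_ideal)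
  ultimately show "p \<in> relabel_vars (image \<sigma>) ` chow_ideal E L" by (rule image_eqI)
qed (use relabel_chow_ideal[OF \<sigma>] in blast)

lemma chow_action_class:
  assumes "\<sigma> permutes E"
  shows "chow_action \<sigma> (chow_class E L p) = chow_class E L (relabel_vars (image \<sigma>) p :: (nat, 'k::field) flat_poly)"
proof -
  have "chow_action \<sigma> (chow_class E L p) =
      (\<lambda>h. h + relabel_vars (image \<sigma>) p) ` relabel_vars (image \<sigma>) ` chow_ideal E L"
    by (simp add: chow_action_def chow_class_conv image_image relabel_vars_add)
  then show ?thesis by (simp only: relabel_chow_ideal_image[OF assms] chow_class_conv)
qed

abbreviation piece :: "nat \<Rightarrow> (complex, (nat, complex) flat_poly set) module" where
  "piece i \<equiv> chow_piece E L i"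

definition fy_class :: "(nat set \<Rightarrow>\<^sub>0 nat) \<Rightarrow> (nat, complex) flat_poly set" where
  "fy_class s = chow_class E L (single s 1)"

lemma fy_form: "s \<in> fy_degree i \<Longrightarrow> single s c \<in> {p \<in> flat_polys L. homogeneous i p}"
  by (auto simp: fy_degree_def fy_monomials_def intro!: homogeneous_single)

text \<open>
  A coincidence of two classes would be a linear dependency with coefficients \<open>1\<close> and \<open>-1\<close>.
\<close>

lemma inj_fy_class: "inj_on fy_class (fy_degree i)"
proof (rule inj_onI)
  fix s s' assume s: "s \<in> fy_degree i" "s' \<in> fy_degree i" and eq: "fy_class s = fy_class s'"
  show "s = s'"
  proof (rule ccontr)
    assume ne: "s \<noteq> s'"
    let ?c = "\<lambda>x. if x = s then 1 else if x = s' then - 1 else 0 :: complex"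
    have "(\<Sum>x\<in>fy_degree i. single x (?c x)) = (\<Sum>x\<in>{s, s'}. single x (?c x))"
      using s by (intro sum.mono_neutral_right) auto
    also have "\<dots> = single s 1 - single s' 1" using ne by (simp add: single_uminus)
    also have "\<dots> \<in> chow_ideal E L" using eq unfolding fy_class_def chow_class_eq_iff .
    finally have "?c s = 0" by (rule fy_independent) (rule s)
    then show False by simp
  qed
qed

lemma finsum_fy_basis:
  "(\<Oplus>\<^bsub>piece i\<^esub>b\<in>fy_class ` fy_degree i. c b \<odot>\<^bsub>piece i\<^esub> b) =
     chow_class E L (\<Sum>s\<in>fy_degree i. single s (c (fy_class s)))"
proof -
  interpret coordinate_space "piece i" by (rule coordinate_space_piece)
  have smult: "c \<odot>\<^bsub>piece i\<^esub> fy_class s = chow_class E L (single s c)" if "s \<in> fy_degree i" for s c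
  proof -
    have p: "(single s 1 :: (nat, complex) flat_poly) \<in> flat_polys L"
      using fy_form[OF that, of "1::complex"] by simp
    show ?thesis by (simp add: fy_class_def piece_ops(2)[OF p p] mult_single)
  qed
  have mem: "chow_class E L (single s c) \<in> carrier (piece i)" if "s \<in> fy_degree i" for s c
    unfolding piece_carrier by (rule imageI[OF fy_form[OF that]])
  have "(\<Oplus>\<^bsub>piece i\<^esub>b\<in>fy_class ` fy_degree i. c b \<odot>\<^bsub>piece i\<^esub> b) =
      (\<Oplus>\<^bsub>piece i\<^esub>s\<in>fy_degree i. c (fy_class s) \<odot>\<^bsub>piece i\<^esub> fy_class s)"
    by (rule finsum_reindex[OF _ inj_fy_class]) (use smult mem in auto)
  also have "\<dots> = (\<Oplus>\<^bsub>piece i\<^esub>s\<in>fy_degree i. chow_class E L (single s (c (fy_class s))))"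
    using mem by (intro finsum_cong') (auto simp: smult)
  also have "\<dots> = chow_class E L (\<Sum>s\<in>fy_degree i. single s (c (fy_class s)))"
    using fy_form by (intro finsum_piece) auto
  finally show ?thesis .
qed

text \<open>
  Coordinates exist because every form reduces to nested monomials, and they are unique because these are
  independent.
\<close>

lemma fy_basis: "finite_basis (piece i) (fy_class ` fy_degree i)"
  unfolding finite_basis_def
proof (intro conjI ballI)
  let ?B = "fy_class ` fy_degree i"
  show "finite ?B" by simp
  show "?B \<subseteq> carrier (piece i)"
    unfolding fy_class_def piece_carrier using fy_form by auto
  fix v assume "v \<in> carrier (piece i)"
  then obtain p where v: "v = chow_class E L p" and p: "p \<in> flat_polys L" "homogeneous i p"
    by (auto simp: piece_carrier)
  obtain k where k: "p - (\<Sum>s\<in>fy_degree i. single s (k s)) \<in> chow_ideal E L"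
    using reducible_homogeneous[OF refl p] unfolding reducible_def[OF refl] by auto
  define c where "c = restrict (\<lambda>b. k (the_inv_into (fy_degree i) fy_class b)) ?B"
  have ck: "c (fy_class s) = k s" if "s \<in> fy_degree i" for s
    using that by (simp add: c_def the_inv_into_f_f[OF inj_fy_class])
  show "\<exists>!c. coordinates_wrt (piece i) ?B v c"
  proof (rule ex1I)
    have "v = chow_class E L (\<Sum>s\<in>fy_degree i. single s (c (fy_class s)))"
      unfolding v chow_class_eq_iff using k by (simp add: ck cong: sum.cong)
    then show "coordinates_wrt (piece i) ?B v c"
      by (simp add: coordinates_wrt_def finsum_fy_basis c_def)
  next
    fix c' assume c': "coordinates_wrt (piece i) ?B v c'"
    have "chow_class E L (\<Sum>s\<in>fy_degree i. single s (c' (fy_class s))) = chow_class E L p"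
      using c' v by (simp add: coordinates_wrt_def finsum_fy_basis)
    then have "(\<Sum>s\<in>fy_degree i. single s (c' (fy_class s))) - p \<in> chow_ideal E L"
      unfolding chow_class_eq_iff .
    then have "(\<Sum>s\<in>fy_degree i. single s (c' (fy_class s))) - p + (p - (\<Sum>s\<in>fy_degree i. single s (k s))) \<in> chow_ideal E L"
      using k by (rule chow_ideal_add)
    then have "(\<Sum>s\<in>fy_degree i. single s (c' (fy_class s) - k s)) \<in> chow_ideal E L"
      by (simp add: single_diff sum_subtractf)
    then have eq: "c' (fy_class s) - k s = 0" if "s \<in> fy_degree i" for s using that by (rule fy_independent)
    show "c' = c"
    proof (rule extensionalityI[of _ ?B])
      show "c' \<in> extensional ?B" using c' by (simp add: coordinates_wrt_def)
      show "c \<in> extensional ?B" by (simp add: c_def)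
      fix b assume "b \<in> ?B"
      then show "c' b = c b" using eq ck by auto
    qed
  qed
qed

lemma trace_chow_piece:
  assumes \<sigma>: "\<sigma> permutes E"
  shows "linear_trace (piece i) (chow_action \<sigma>) =
    of_nat (card {s \<in> fixed_monomials \<sigma> (fy_monomials r n). total_degree s = i})"
proof -
  interpret coordinate_space "piece i" by (rule coordinate_space_piece)
  let ?B = "fy_class ` fy_degree i" and ?r = "relabel_monomial (image \<sigma>)"
  have act: "chow_action \<sigma> (fy_class s) = fy_class (?r s)" for s
    by (simp add: fy_class_def chow_action_class[OF \<sigma>])
  have r: "relabel_vars (image \<sigma>) p \<in> {p \<in> flat_polys L. homogeneous i p}"
    if "p \<in> {p \<in> flat_polys L. homogeneous i p}" for p :: "(nat, complex) flat_poly"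
    using that relabel_flat_polys[OF \<sigma>] relabel_homogeneous[OF \<sigma>] by auto
  have "linear_trace (piece i) (chow_action \<sigma>) = of_nat (card {b \<in> ?B. chow_action \<sigma> b = b})"
  proof (rule linear_trace_permuted_basis[OF fy_basis])
    show "chow_action \<sigma> b \<in> ?B" if "b \<in> ?B" for b
      using that relabel_fy[OF \<sigma>] by (auto simp: act)
    show "chow_action \<sigma> \<in> carrier (piece i) \<rightarrow> carrier (piece i)"
      using r by (auto simp: piece_carrier chow_action_class[OF \<sigma>])
    fix v assume "v \<in> carrier (piece i)"
    then obtain p where p: "v = chow_class E L p" "p \<in> flat_polys L" by (auto simp: piece_carrier)
    show "chow_action \<sigma> (c \<odot>\<^bsub>piece i\<^esub> v) = c \<odot>\<^bsub>piece i\<^esub> chow_action \<sigma> v" for c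
      using p relabel_flat_polys[OF \<sigma> p(2)]
      by (simp add: piece_ops chow_action_class[OF \<sigma>] relabel_vars_mult)
    fix w assume "w \<in> carrier (piece i)"
    then obtain q where q: "w = chow_class E L q" "q \<in> flat_polys L" by (auto simp: piece_carrier)
    show "chow_action \<sigma> (v \<oplus>\<^bsub>piece i\<^esub> w) = chow_action \<sigma> v \<oplus>\<^bsub>piece i\<^esub> chow_action \<sigma> w"
      using p q relabel_flat_polys[OF \<sigma> p(2)] relabel_flat_polys[OF \<sigma> q(2)]
      by (simp add: piece_ops chow_action_class[OF \<sigma>] relabel_vars_add)
  qed
  also have "{b \<in> ?B. chow_action \<sigma> b = b} = fy_class ` {s \<in> fy_degree i. ?r s = s}"
  proof -
    have "fy_class (?r s) = fy_class s \<longleftrightarrow> ?r s = s" if "s \<in> fy_degree i" for s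
      using inj_on_eq_iff[OF inj_fy_class relabel_fy[OF \<sigma> that] that] .
    then show ?thesis by (auto simp: act)
  qed
  also have "card \<dots> = card {s \<in> fy_degree i. ?r s = s}"
    by (rule card_image) (rule inj_on_subset[OF inj_fy_class], auto)
  also have "{s \<in> fy_degree i. ?r s = s} = {s \<in> fixed_monomials \<sigma> (fy_monomials r n). total_degree s = i}"
    by (auto simp: fy_degree_def fixed_monomials_def)
  finally show ?thesis .
qed

lemma frobenius_nth:
  "fps_nth (frobenius K f) i =
    mconst (1 / fact (card K)) * (\<Sum>\<sigma> | \<sigma> permutes K. fps_nth (f \<sigma>) i * cycle_power_sum K \<sigma>)"
  by (simp add: frobenius_def fps_sum_nth)

lemma graded_frobenius_chow:
  "graded_frobenius n piece chow_action =
    (\<Sum>j<r. nested_frobenius j * h_series (n - j) * (\<Sum>a<r - j. fps_X ^ a))"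
proof -
  have "graded_frobenius n piece chow_action =
      frobenius E (\<lambda>\<sigma>. \<Sum>m\<in>fixed_monomials \<sigma> (fy_monomials r n). fps_X ^ total_degree m)"
  proof (rule fps_ext)
    fix i
    have coeff: "fps_nth (\<Sum>m\<in>fixed_monomials \<sigma> (fy_monomials r n). fps_X ^ total_degree m) i =
        mconst (linear_trace (piece i) (chow_action \<sigma>))" if "\<sigma> permutes E" for \<sigma>
    proof -
      have fin: "finite (fixed_monomials \<sigma> (fy_monomials r n))"
        by (simp add: fixed_monomials_def)
      have "fps_nth (\<Sum>m\<in>fixed_monomials \<sigma> (fy_monomials r n). fps_X ^ total_degree m) i =
          (\<Sum>m\<in>fixed_monomials \<sigma> (fy_monomials r n). if total_degree m = i then 1 else 0 :: complex mseries)"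
        by (auto simp: fps_sum_nth intro!: sum.cong)
      also have "\<dots> = of_nat (card {s \<in> fixed_monomials \<sigma> (fy_monomials r n). total_degree s = i})"
        using fin by (simp flip: sum.inter_filter)
      finally show ?thesis by (simp add: trace_chow_piece[OF that] mconst_of_nat)
    qed
    have "fps_nth (frobenius E (\<lambda>\<sigma>. \<Sum>m\<in>fixed_monomials \<sigma> (fy_monomials r n). fps_X ^ total_degree m)) i =
        mconst (1 / fact n) * (\<Sum>\<sigma> | \<sigma> permutes E. mconst (linear_trace (piece i) (chow_action \<sigma>)) * cycle_power_sum E \<sigma>)"
      unfolding frobenius_nth by (intro arg_cong2[of _ _ _ _ "(*)"] sum.cong refl) (simp_all add: coeff del: fps_sum_nth)
    then show "fps_nth (graded_frobenius n piece chow_action) i =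
        fps_nth (frobenius E (\<lambda>\<sigma>. \<Sum>m\<in>fixed_monomials \<sigma> (fy_monomials r n). fps_X ^ total_degree m)) i"
      by (simp add: graded_frobenius_def frobenius_char_def cycle_power_sum_def cycle_type_power_sum_def)
  qed
  then show ?thesis by (simp only: frobenius_fy)
qed

end

section \<open>Permutations compatible with a colouring\<close>

text \<open>
  For a weakly decreasing colouring \<open>s\<close> of the positions, these are the permutations whose barred word
  increases within each colour class, that is, those for which \<open>s\<close> is a term of the fundamental
  quasisymmetric function. The weak form treats fixed points like excedances.
\<close>

definition compatible :: "nat set \<Rightarrow> (nat \<Rightarrow> nat) \<Rightarrow> (nat \<Rightarrow> nat) \<Rightarrow> bool" where
  "compatible K s \<sigma> \<longleftrightarrow> (\<forall>i\<in>K. \<forall>j\<in>K. i < j \<and> s i = s j \<longrightarrow>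
     (j < \<sigma> j \<longrightarrow> i < \<sigma> i) \<and> ((i < \<sigma> i \<longleftrightarrow> j < \<sigma> j) \<longrightarrow> \<sigma> i < \<sigma> j))"

definition weakly_compatible :: "nat set \<Rightarrow> (nat \<Rightarrow> nat) \<Rightarrow> (nat \<Rightarrow> nat) \<Rightarrow> bool" where
  "weakly_compatible K s \<sigma> \<longleftrightarrow> (\<forall>i\<in>K. \<forall>j\<in>K. i < j \<and> s i = s j \<longrightarrow>
     (j \<le> \<sigma> j \<longrightarrow> i \<le> \<sigma> i) \<and> ((i \<le> \<sigma> i \<longleftrightarrow> j \<le> \<sigma> j) \<longrightarrow> \<sigma> i < \<sigma> j))"

definition excedances :: "nat set \<Rightarrow> (nat \<Rightarrow> nat) \<Rightarrow> nat set" where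
  "excedances K \<sigma> = {i \<in> K. i < \<sigma> i}"

definition weak_excedances :: "nat set \<Rightarrow> (nat \<Rightarrow> nat) \<Rightarrow> nat set" where
  "weak_excedances K \<sigma> = {i \<in> K. i \<le> \<sigma> i}"

definition derangements :: "nat set \<Rightarrow> (nat \<Rightarrow> nat) set" where
  "derangements K = {\<sigma>. \<sigma> permutes K \<and> (\<forall>i\<in>K. \<sigma> i \<noteq> i)}"

definition derangement_sum :: "(nat \<Rightarrow> 'a::comm_monoid_add) \<Rightarrow> nat set \<Rightarrow> (nat \<Rightarrow> nat) \<Rightarrow> 'a" where
  "derangement_sum g K s = (\<Sum>\<sigma> | \<sigma> \<in> derangements K \<and> compatible K s \<sigma>. g (card (excedances K \<sigma>)))"

definition decreasing_on :: "nat set \<Rightarrow> (nat \<Rightarrow> nat) \<Rightarrow> bool" where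
  "decreasing_on K s \<longleftrightarrow> (\<forall>i\<in>K. \<forall>j\<in>K. i \<le> j \<longrightarrow> s j \<le> s i)"

lemma EXC_eq_excedances:
  assumes "\<sigma> permutes {1..n}"
  shows "EXC n \<sigma> = excedances {1..n} \<sigma>"
proof -
  have "\<sigma> i \<le> n" if "i \<in> {1..n}" for i using permutes_in_image[OF assms, of i] that by simp
  then have "i < n" if "1 \<le> i" "i \<le> n" "i < \<sigma> i" for i using that by fastforce
  then show ?thesis by (auto simp: EXC_def excedances_def)
qed

text \<open>
  The condition \<open>?P\<close> on two positions fails for neighbours exactly at the descents of the barred word,
  and it is transitive; so within a colour class it passes from neighbours to all pairs.
\<close>

lemma compatible_iff_DEX:
  assumes \<sigma>: "\<sigma> permutes {1..n}" and s: "decreasing_on {1..n} s"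
  shows "(\<forall>i\<in>DEX n \<sigma>. s (i + 1) < s i) \<longleftrightarrow> compatible {1..n} s \<sigma>"
proof -
  let ?P = "\<lambda>i j. (j < \<sigma> j \<longrightarrow> i < \<sigma> i) \<and> ((i < \<sigma> i \<longleftrightarrow> j < \<sigma> j) \<longrightarrow> \<sigma> i < \<sigma> j)"
  have DEX: "i \<in> DEX n \<sigma> \<longleftrightarrow> i \<in> {1..<n} \<and> \<not> ?P i (i + 1)" for i
  proof (cases "i \<in> {1..<n}")
    case True
    then have "i \<in> {1..n}" "i + 1 \<in> {1..n}" by auto
    then have e: "i \<in> EXC n \<sigma> \<longleftrightarrow> i < \<sigma> i" "i + 1 \<in> EXC n \<sigma> \<longleftrightarrow> i + 1 < \<sigma> (i + 1)"
      by (simp_all add: EXC_eq_excedances[OF \<sigma>] excedances_def)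
    have "\<sigma> i \<noteq> \<sigma> (i + 1)" using permutes_inj[OF \<sigma>] by (auto simp: inj_eq)
    then show ?thesis using True by (auto simp: DEX_def barred_word_def e)
  qed (auto simp: DEX_def)
  show ?thesis
  proof
    assume compat: "compatible {1..n} s \<sigma>"
    show "\<forall>i\<in>DEX n \<sigma>. s (i + 1) < s i"
    proof
      fix i assume "i \<in> DEX n \<sigma>"
      then have i: "i \<in> {1..n}" "i + 1 \<in> {1..n}" and nP: "\<not> ?P i (i + 1)"
        unfolding DEX by auto
      then have "s i \<noteq> s (i + 1)" using compat unfolding compatible_def by (metis less_add_one)
      moreover have "s (i + 1) \<le> s i" using s i by (auto simp: decreasing_on_def)
      ultimately show "s (i + 1) < s i" by simp
    qed
  next
    assume D: "\<forall>i\<in>DEX n \<sigma>. s (i + 1) < s i"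
    have pairs: "?P i (i + d + 1)" if "1 \<le> i" "i + d + 1 \<le> n" "s i = s (i + d + 1)" for i d
      using that(2,3)
    proof (induction d)
      case 0
      then show ?case using D DEX[of i] that(1) by fastforce
    next
      case (Suc d)
      let ?k = "i + d + 1"
      have next_idx: "i + Suc d + 1 = ?k + 1" by simp
      note prems = Suc.prems[unfolded next_idx]
      have idx: "i \<in> {1..n}" "?k \<in> {1..n}" "?k + 1 \<in> {1..n}" using prems that(1) by auto
      have "s (?k + 1) \<le> s ?k" "s ?k \<le> s i"
        using s[unfolded decreasing_on_def, rule_format, of ?k "?k + 1"]
          s[unfolded decreasing_on_def, rule_format, of i ?k] idx by simp_all
      then have eq: "s ?k = s i" "s ?k = s (?k + 1)" using prems(2) by linarith+
      have "?k \<le> n" using prems(1) by simp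
      then have "?P i ?k" using Suc.IH eq(1) by simp
      moreover have "?P ?k (?k + 1)"
      proof (rule ccontr)
        assume "\<not> ?P ?k (?k + 1)"
        moreover have "?k \<in> {1..<n}" using idx by simp
        ultimately have "s (?k + 1) < s ?k" using D DEX[of ?k] by blast
        then show False using eq by simp
      qed
      ultimately show ?case
        unfolding next_idx by (cases "i < \<sigma> i"; cases "?k < \<sigma> ?k"; cases "?k + 1 < \<sigma> (?k + 1)") auto
    qed
    show "compatible {1..n} s \<sigma>"
      unfolding compatible_def
    proof (intro ballI impI)
      fix i j assume ij: "i \<in> {1..n}" "j \<in> {1..n}" "i < j \<and> s i = s j"
      then obtain d where j: "j = i + d + 1" using less_imp_Suc_add[of i j] by auto
      show "?P i j" unfolding j by (rule pairs) (use ij j in auto)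
    qed
  qed
qed

section \<open>Removing fixed points\<close>

text \<open>
  In a compatible permutation the fixed points come last in each colour class, in a weakly compatible one
  they come first. The other positions therefore form a set of this kind, for \<open>f i = i\<close> and
  \<open>f i = - i\<close> respectively.
\<close>

definition initial :: "(nat \<Rightarrow> int) \<Rightarrow> nat set \<Rightarrow> (nat \<Rightarrow> nat) \<Rightarrow> nat set \<Rightarrow> bool" where
  "initial f A s K \<longleftrightarrow> K \<subseteq> A \<and> (\<forall>j\<in>K. \<forall>i\<in>A. s i = s j \<and> f i < f j \<longrightarrow> i \<in> K)"

context
  fixes n :: nat and s :: "nat \<Rightarrow> nat"
  assumes s: "decreasing_on {1..n} s"
begin

lemma same_colour_between:
  assumes "1 \<le> i" "i \<le> k" "k \<le> j" "j \<le> n" "s i = s j"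
  shows "s k = s i"
proof -
  have "s k \<le> s i" "s j \<le> s k"
    using s[unfolded decreasing_on_def, rule_format, of i k] s[unfolded decreasing_on_def, rule_format, of k j]
      assms(1-4) by simp_all
  then show ?thesis using assms(5) by simp
qed

lemma permutes_compl_fixed:
  assumes \<sigma>: "\<sigma> permutes {1..n}"
  defines "X \<equiv> {i \<in> {1..n}. \<sigma> i = i}"
  shows "\<sigma> \<in> derangements ({1..n} - X)"
proof -
  have "\<sigma> permutes ({1..n} - X)"
    by (rule permutes_superset[OF \<sigma>]) (auto simp: X_def)
  then show ?thesis by (auto simp: derangements_def X_def)
qed

lemma derangement_extends:
  assumes K: "K \<subseteq> {1..n}" and \<sigma>: "\<sigma> \<in> derangements K"
  shows "\<sigma> permutes {1..n}" "{i \<in> {1..n}. \<sigma> i = i} = {1..n} - K"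
  using assms permutes_subset[of \<sigma> K "{1..n}"]
  by (auto simp: derangements_def permutes_not_in)

text \<open>
  The later positions of the colour of a fixed point are not excedances, and \<open>\<sigma>\<close> increases on them, so
  that its values cannot fall below the diagonal there.
\<close>

lemma compatible_fixed_upward:
  assumes compat: "compatible {1..n} s \<sigma>" and i: "1 \<le> i" "\<sigma> i = i" and j: "i < j" "j \<le> n" "s i = s j"
  shows "\<sigma> j = j"
proof -
  have same: "s k = s i" if "i \<le> k" "k \<le> j" for k using same_colour_between[OF i(1) that j(2,3)] .
  have nonexc: "\<not> k < \<sigma> k" if "i \<le> k" "k \<le> j" for k
  proof (cases "k = i")
    case False
    then have "i < k" "k \<in> {1..n}" "i \<in> {1..n}" using that i j by auto
    then have "k < \<sigma> k \<longrightarrow> i < \<sigma> i"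
      using compat[unfolded compatible_def, rule_format, of i k] same[OF that] by simp
    then show ?thesis using i by simp
  qed (use i in simp)
  have "k \<le> \<sigma> k" if "i \<le> k" "k \<le> j" for k
    using that
  proof (induction k rule: dec_induct)
    case base
    then show ?case using i by simp
  next
    case (step k)
    then have "\<sigma> k < \<sigma> (Suc k)"
      using compat[unfolded compatible_def, rule_format, of k "Suc k"]
        nonexc[of k] nonexc[of "Suc k"] same[of k] same[of "Suc k"] i j by simp
    then show ?case using step by simp
  qed
  then show ?thesis using nonexc[of j] j by (metis le_neq_implies_less less_imp_le order_refl)
qed

lemma weakly_compatible_fixed_downward:
  assumes compat: "weakly_compatible {1..n} s \<sigma>" and i: "1 \<le> i" and j: "i < j" "j \<le> n" "s i = s j" "\<sigma> j = j"
  shows "\<sigma> i = i"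
proof -
  have same: "s k = s i" if "i \<le> k" "k \<le> j" for k using same_colour_between[OF i(1) that j(2,3)] .
  have wexc: "k \<le> \<sigma> k" if "i \<le> k" "k \<le> j" for k
  proof (cases "k = j")
    case False
    then have "k < j" "k \<in> {1..n}" "j \<in> {1..n}" using that i j by auto
    then have "j \<le> \<sigma> j \<longrightarrow> k \<le> \<sigma> k"
      using compat[unfolded weakly_compatible_def, rule_format, of k j] same[OF that] j by simp
    then show ?thesis using j by simp
  qed (use j in simp)
  have "\<sigma> k \<le> k" if "i \<le> k" "k \<le> j" for k
    using that(2,1)
  proof (induction k rule: inc_induct)
    case base
    then show ?case using j by simp
  next
    case (step k)
    then have "\<sigma> k < \<sigma> (Suc k)"
      using compat[unfolded weakly_compatible_def, rule_format, of k "Suc k"]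
        wexc[of k] wexc[of "Suc k"] same[of k] same[of "Suc k"] i j by simp
    then show ?case using step by simp
  qed
  then show ?thesis using wexc[of i] j by (meson le_antisym less_imp_le order_refl)
qed

lemma compatible_restrict:
  assumes \<sigma>: "\<sigma> permutes {1..n}"
  defines "K \<equiv> {1..n} - {i \<in> {1..n}. \<sigma> i = i}"
  shows "compatible {1..n} s \<sigma> \<longleftrightarrow> initial int {1..n} s K \<and> compatible K s \<sigma>"
proof
  assume c: "compatible {1..n} s \<sigma>"
  moreover have "initial int {1..n} s K"
    using compatible_fixed_upward[OF c] by (auto simp: initial_def K_def)
  ultimately show "initial int {1..n} s K \<and> compatible K s \<sigma>"
    unfolding compatible_def K_def by blast
next
  assume c: "initial int {1..n} s K \<and> compatible K s \<sigma>"
  show "compatible {1..n} s \<sigma>"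
    unfolding compatible_def
  proof (intro ballI impI)
    fix i j assume ij: "i \<in> {1..n}" "j \<in> {1..n}" "i < j \<and> s i = s j"
    show "(j < \<sigma> j \<longrightarrow> i < \<sigma> i) \<and> ((i < \<sigma> i \<longleftrightarrow> j < \<sigma> j) \<longrightarrow> \<sigma> i < \<sigma> j)"
    proof (cases "j \<in> K")
      case True
      then have "i \<in> K" using c ij by (auto simp: initial_def)
      then show ?thesis using c ij True unfolding compatible_def by blast
    next
      case False
      then have "\<sigma> j = j" using ij by (simp add: K_def)
      then show ?thesis using ij by auto
    qed
  qed
qed

lemma weakly_compatible_restrict:
  assumes \<sigma>: "\<sigma> permutes {1..n}"
  defines "K \<equiv> {1..n} - {i \<in> {1..n}. \<sigma> i = i}"
  shows "weakly_compatible {1..n} s \<sigma> \<longleftrightarrow> initial (\<lambda>i. - int i) {1..n} s K \<and> compatible K s \<sigma>"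
proof -
  have strict: "k \<le> \<sigma> k \<longleftrightarrow> k < \<sigma> k" if "k \<in> K" for k using that by (auto simp: K_def)
  then have weak: "weakly_compatible K s \<sigma> \<longleftrightarrow> compatible K s \<sigma>"
    unfolding weakly_compatible_def compatible_def by (simp cong: ball_cong)
  show ?thesis
  proof
    assume c: "weakly_compatible {1..n} s \<sigma>"
    moreover have "\<forall>j\<in>K. \<forall>i\<in>{1..n}. s i = s j \<and> j < i \<longrightarrow> i \<in> K"
    proof (intro ballI impI)
      fix i j assume that: "j \<in> K" "i \<in> {1..n}" "s i = s j \<and> j < i"
      show "i \<in> K"
        using weakly_compatible_fixed_downward[OF c, of j i] that by (auto simp: K_def)
    qed
    then have "initial (\<lambda>i. - int i) {1..n} s K" 
      using Diff_subset[of "{1..n}" "{i \<in> {1..n}. \<sigma> i = i}", folded K_def]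
      unfolding initial_def by simp
    moreover have "weakly_compatible K s \<sigma>"
      using c unfolding weakly_compatible_def K_def by blast
    ultimately show "initial (\<lambda>i. - int i) {1..n} s K \<and> compatible K s \<sigma>"
      using weak by blast
  next
    assume c: "initial (\<lambda>i. - int i) {1..n} s K \<and> compatible K s \<sigma>"
    show "weakly_compatible {1..n} s \<sigma>"
      unfolding weakly_compatible_def
    proof (intro ballI impI)
      fix i j assume ij: "i \<in> {1..n}" "j \<in> {1..n}" "i < j \<and> s i = s j"
      show "(j \<le> \<sigma> j \<longrightarrow> i \<le> \<sigma> i) \<and> ((i \<le> \<sigma> i \<longleftrightarrow> j \<le> \<sigma> j) \<longrightarrow> \<sigma> i < \<sigma> j)"
      proof (cases "i \<in> K")
        case True
        then have "j \<in> K" using c ij by (auto simp: initial_def)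
        then show ?thesis using weak c ij True unfolding weakly_compatible_def by blast
      next
        case False
        then have "\<sigma> i = i" using ij by (simp add: K_def)
        then show ?thesis using ij by auto
      qed
    qed
  qed
qed

text \<open>
  A permutation is grouped by the complement \<open>K\<close> of its fixed points. As a function it is unchanged by the
  passage to a derangement of \<open>K\<close>, and any derangement of an admissible \<open>K\<close> occurs.
\<close>

lemma sum_by_fixed_points:
  fixes g :: "(nat \<Rightarrow> nat) \<Rightarrow> 'a::comm_monoid_add"
  assumes cond: "\<And>\<sigma>. \<sigma> permutes {1..n} \<Longrightarrow>
      C \<sigma> \<longleftrightarrow> P ({1..n} - {i \<in> {1..n}. \<sigma> i = i}) \<and> compatible ({1..n} - {i \<in> {1..n}. \<sigma> i = i}) s \<sigma>"
    and g: "\<And>K \<sigma>. K \<subseteq> {1..n} \<Longrightarrow> \<sigma> \<in> derangements K \<Longrightarrow> g \<sigma> = h K (card (excedances K \<sigma>))"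
  shows "(\<Sum>\<sigma> | \<sigma> permutes {1..n} \<and> C \<sigma> \<and> R (fix_number n \<sigma>). g \<sigma>) =
    (\<Sum>K | K \<subseteq> {1..n} \<and> P K \<and> R (n - card K). derangement_sum (h K) K s)"
proof -
  let ?N = "\<lambda>\<sigma>. {1..n} - {i \<in> {1..n}. \<sigma> i = i}"
  let ?A = "{\<sigma>. \<sigma> permutes {1..n} \<and> C \<sigma> \<and> R (fix_number n \<sigma>)}"
  let ?B = "{K. K \<subseteq> {1..n} \<and> P K \<and> R (n - card K)}"
  have card: "fix_number n \<sigma> = n - card (?N \<sigma>)" for \<sigma>
  proof -
    have "card {i \<in> {1..n}. \<sigma> i = i} \<le> card {1..n}" by (rule card_mono) auto
    then have "card {i \<in> {1..n}. \<sigma> i = i} \<le> n" by simp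
    then show ?thesis unfolding fix_number_def by (subst card_Diff_subset) auto
  qed
  have "(\<Sum>\<sigma>\<in>?A. g \<sigma>) = (\<Sum>K\<in>?B. \<Sum>\<sigma>\<in>{\<sigma> \<in> ?A. ?N \<sigma> = K}. g \<sigma>)"
    using cond card
    by (intro sum.group[symmetric]) (auto intro: finite_subset[OF _ finite_permutations[of "{1..n}"]])
  also have "\<dots> = (\<Sum>K\<in>?B. derangement_sum (h K) K s)"
  proof (rule sum.cong)
    fix K assume K: "K \<in> ?B"
    then have sub: "K \<subseteq> {1..n}" by simp
    have "{\<sigma> \<in> ?A. ?N \<sigma> = K} = {\<sigma>. \<sigma> \<in> derangements K \<and> compatible K s \<sigma>}"
    proof (intro equalityI subsetI)
      fix \<sigma> assume "\<sigma> \<in> {\<sigma> \<in> ?A. ?N \<sigma> = K}"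
      then show "\<sigma> \<in> {\<sigma>. \<sigma> \<in> derangements K \<and> compatible K s \<sigma>}"
        using cond[of \<sigma>] permutes_compl_fixed[of \<sigma>] by auto
    next
      fix \<sigma> assume \<sigma>: "\<sigma> \<in> {\<sigma>. \<sigma> \<in> derangements K \<and> compatible K s \<sigma>}"
      then have e: "\<sigma> permutes {1..n}" "{i \<in> {1..n}. \<sigma> i = i} = {1..n} - K"
        using derangement_extends[OF sub] by auto
      have N: "?N \<sigma> = K" unfolding e(2) using sub by blast
      then have "C \<sigma>" "R (fix_number n \<sigma>)"
        using cond[OF e(1)] \<sigma> K by (simp_all add: card)
      then show "\<sigma> \<in> {\<sigma> \<in> ?A. ?N \<sigma> = K}" using e(1) N by simp
    qed
    then show "(\<Sum>\<sigma>\<in>{\<sigma> \<in> ?A. ?N \<sigma> = K}. g \<sigma>) = derangement_sum (h K) K s"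
      unfolding derangement_sum_def using g[OF sub] by (auto intro!: sum.cong)
  qed simp
  finally show ?thesis .
qed

end

text \<open>
  The second count includes the fixed points outside \<open>K\<close>; on \<open>K\<close> there are no others.
\<close>

lemma excedances_extend:
  assumes "K \<subseteq> {1..n}" "\<sigma> \<in> derangements K"
  shows "excedances {1..n} \<sigma> = excedances K \<sigma>"
    and "card (weak_excedances {1..n} \<sigma>) = card (excedances K \<sigma>) + (n - card K)"
proof -
  have off: "\<sigma> i = i" if "i \<notin> K" for i
    using assms(2) that permutes_not_in[of \<sigma> K i] by (simp add: derangements_def)
  then show "excedances {1..n} \<sigma> = excedances K \<sigma>"
    using assms by (auto simp: excedances_def) (metis less_irrefl)
  have "weak_excedances {1..n} \<sigma> = excedances K \<sigma> \<union> ({1..n} - K)"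
    using assms off by (auto simp: weak_excedances_def excedances_def derangements_def le_less)
  moreover have "finite (excedances K \<sigma>)" "excedances K \<sigma> \<inter> ({1..n} - K) = {}"
    using assms finite_subset[OF assms(1)] by (auto simp: excedances_def)
  ultimately show "card (weak_excedances {1..n} \<sigma>) = card (excedances K \<sigma>) + (n - card K)"
    using assms finite_subset[OF assms(1)] by (simp add: card_Un_disjoint card_Diff_subset)
qed

section \<open>Shifting the values\<close>

text \<open>Lowering all values cyclically by one turns excedances into weak excedances; the new value \<open>n\<close> in
  place of 1 creates one more.\<close>

definition lower :: "nat \<Rightarrow> nat \<Rightarrow> nat" where
  "lower n v = (if v \<in> {1..n} then if v = 1 then n else v - 1 else v)"

definition raise :: "nat \<Rightarrow> nat \<Rightarrow> nat" where
  "raise n v = (if v \<in> {1..n} then if v = n then 1 else v + 1 else v)"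

lemma raise_lower [simp]: "raise n (lower n v) = v" "lower n (raise n v) = v"
  by (auto simp: raise_def lower_def)

lemma lower_permutes: "lower n permutes {1..n}" and raise_permutes: "raise n permutes {1..n}"
proof -
  have "bij_betw (lower n) {1..n} {1..n}" "bij_betw (raise n) {1..n} {1..n}"
    by (rule bij_betw_byWitness[where f' = "raise n"], auto simp: lower_def raise_def)
      (rule bij_betw_byWitness[where f' = "lower n"], auto simp: lower_def raise_def)
  then show "lower n permutes {1..n}" "raise n permutes {1..n}"
    by (auto intro!: bij_imp_permutes simp: lower_def raise_def)
qed

text \<open>
  The value 1 becomes \<open>n\<close>. It is the least value of a position that is not an excedance and becomes the
  greatest value of a weak excedance, and so keeps its place at the boundary between the two groups.
\<close>

lemma lower_pair:
  assumes "1 \<le> i" "i < j" "j \<le> n" "1 \<le> a" "a \<le> n" "1 \<le> b" "b \<le> n" "a \<noteq> b"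
  shows "((j < b \<longrightarrow> i < a) \<and> ((i < a \<longleftrightarrow> j < b) \<longrightarrow> a < b)) \<longleftrightarrow>
    ((j \<le> lower n b \<longrightarrow> i \<le> lower n a) \<and> ((i \<le> lower n a \<longleftrightarrow> j \<le> lower n b) \<longrightarrow> lower n a < lower n b))"
  using assms by (cases "a = 1"; cases "b = 1") (auto simp: lower_def)

lemma compatible_lower:
  assumes \<sigma>: "\<sigma> permutes {1..n}"
  shows "weakly_compatible {1..n} s (lower n \<circ> \<sigma>) \<longleftrightarrow> compatible {1..n} s \<sigma>"
proof -
  have "((j < \<sigma> j \<longrightarrow> i < \<sigma> i) \<and> ((i < \<sigma> i \<longleftrightarrow> j < \<sigma> j) \<longrightarrow> \<sigma> i < \<sigma> j)) \<longleftrightarrow>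
    ((j \<le> lower n (\<sigma> j) \<longrightarrow> i \<le> lower n (\<sigma> i)) \<and>
     ((i \<le> lower n (\<sigma> i) \<longleftrightarrow> j \<le> lower n (\<sigma> j)) \<longrightarrow> lower n (\<sigma> i) < lower n (\<sigma> j)))"
    if "i \<in> {1..n}" "j \<in> {1..n}" "i < j" for i j
    using that permutes_in_image[OF \<sigma>, of i] permutes_in_image[OF \<sigma>, of j] permutes_inj[OF \<sigma>]
    by (intro lower_pair) (auto simp: inj_eq)
  then show ?thesis unfolding compatible_def weakly_compatible_def o_apply by blast
qed

lemma card_weak_excedances_lower:
  assumes \<sigma>: "\<sigma> permutes {1..n}" and n: "1 \<le> n"
  shows "card (weak_excedances {1..n} (lower n \<circ> \<sigma>)) = card (excedances {1..n} \<sigma>) + 1"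
proof -
  obtain i0 where i0: "i0 \<in> {1..n}" "\<sigma> i0 = 1"
    using permutes_image[OF \<sigma>] n by (metis atLeastAtMost_iff imageE order_refl)
  have "i \<le> lower n (\<sigma> i) \<longleftrightarrow> i = i0 \<or> i < \<sigma> i" if i: "i \<in> {1..n}" for i
  proof (cases "\<sigma> i = 1")
    case True
    then have "i = i0" using i0 permutes_inj[OF \<sigma>] by (metis injD)
    then show ?thesis using i0 i True by (simp add: lower_def)
  next
    case False
    moreover have "i \<noteq> i0" using False i0 by auto
    moreover have "\<sigma> i \<in> {1..n}" using permutes_in_image[OF \<sigma>] i by simp
    ultimately show ?thesis by (auto simp: lower_def)
  qed
  then have "weak_excedances {1..n} (lower n \<circ> \<sigma>) = insert i0 (excedances {1..n} \<sigma>)"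
    using i0 by (auto simp: weak_excedances_def excedances_def)
  moreover have "i0 \<notin> excedances {1..n} \<sigma>" using i0 by (auto simp: excedances_def)
  ultimately show ?thesis by (simp add: excedances_def)
qed

lemma sum_compatible_shift:
  fixes g :: "nat \<Rightarrow> 'a::comm_monoid_add"
  assumes "1 \<le> n"
  shows "(\<Sum>\<sigma> | \<sigma> permutes {1..n} \<and> compatible {1..n} s \<sigma>. g (card (excedances {1..n} \<sigma>) + 1)) =
    (\<Sum>\<sigma> | \<sigma> permutes {1..n} \<and> weakly_compatible {1..n} s \<sigma>. g (card (weak_excedances {1..n} \<sigma>)))"
proof (rule sum.reindex_bij_witness[where j = "\<lambda>\<sigma>. lower n \<circ> \<sigma>" and i = "\<lambda>\<tau>. raise n \<circ> \<tau>"])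
  fix \<sigma> assume "\<sigma> \<in> {\<sigma>. \<sigma> permutes {1..n} \<and> compatible {1..n} s \<sigma>}"
  then have \<sigma>: "\<sigma> permutes {1..n}" "compatible {1..n} s \<sigma>" by auto
  show "raise n \<circ> (lower n \<circ> \<sigma>) = \<sigma>" by (simp add: fun_eq_iff)
  show "lower n \<circ> \<sigma> \<in> {\<sigma>. \<sigma> permutes {1..n} \<and> weakly_compatible {1..n} s \<sigma>}"
    using \<sigma> permutes_compose[OF \<sigma>(1) lower_permutes] compatible_lower by simp
  show "g (card (weak_excedances {1..n} (lower n \<circ> \<sigma>))) = g (card (excedances {1..n} \<sigma>) + 1)"
    using card_weak_excedances_lower[OF \<sigma>(1) assms] by simp
next
  fix \<tau> assume "\<tau> \<in> {\<sigma>. \<sigma> permutes {1..n} \<and> weakly_compatible {1..n} s \<sigma>}"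
  then have \<tau>: "\<tau> permutes {1..n}" "weakly_compatible {1..n} s \<tau>" by auto
  show eq: "lower n \<circ> (raise n \<circ> \<tau>) = \<tau>" by (simp add: fun_eq_iff)
  have "raise n \<circ> \<tau> permutes {1..n}" by (rule permutes_compose[OF \<tau>(1) raise_permutes])
  then show "raise n \<circ> \<tau> \<in> {\<sigma>. \<sigma> permutes {1..n} \<and> compatible {1..n} s \<sigma>}"
    using compatible_lower[of "raise n \<circ> \<tau>" n s] eq \<tau>(2) by simp
qed

section \<open>Coefficients of the Eulerian quasisymmetric functions\<close>

definition content :: "nat set \<Rightarrow> (nat \<Rightarrow> nat) \<Rightarrow> (nat \<Rightarrow>\<^sub>0 nat)" where
  "content K s = (\<Sum>i\<in>K. single (s i) 1)"

lemma lookup_content: "finite K \<Longrightarrow> lookup (content K s) v = card {i \<in> K. s i = v}"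
  by (simp add: content_def lookup_sum lookup_single when_def sum.If_cases Int_def)

lemma total_degree_content [simp]: "total_degree (content K s) = card K"
  by (simp add: content_def)

lemma lookup_list_content: "lookup (\<Sum>i\<leftarrow>xs. single i 1) v = count (mset xs) v"
  by (induction xs) (auto simp: lookup_add lookup_single when_def)

lemma total_degree_list_content: "total_degree (\<Sum>i\<leftarrow>xs. single i (1::nat)) = length xs"
  by (induction xs) simp_all

lemma list_with_content: "\<exists>xs. (\<Sum>i\<leftarrow>xs. single i 1) = (w :: nat \<Rightarrow>\<^sub>0 nat)"
proof (induction "total_degree w" arbitrary: w)
  case 0
  then show ?case by (intro exI[of _ "[]"]) simp
next
  case (Suc k)
  then have "w \<noteq> 0" by auto
  then obtain v where "v \<in> keys w" by fastforce
  then obtain w' where w': "w = w' + single v 1"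
    using split_monomial[of 1 w v] by (auto simp: in_keys_iff Suc_le_eq)
  then obtain xs where "(\<Sum>i\<leftarrow>xs. single i 1) = w'"
    using Suc.hyps(1)[of w'] Suc.hyps(2) by auto
  then show ?case by (intro exI[of _ "v # xs"]) (simp add: w' add.commute)
qed

text \<open>
  Sorting turns a list with the required content into the decreasing one.
\<close>

lemma decreasing_list_unique:
  fixes w :: "nat \<Rightarrow>\<^sub>0 nat"
  shows "\<exists>!xs. sorted (rev xs) \<and> (\<Sum>i\<leftarrow>xs. single i 1) = w"
proof (rule ex_ex1I)
  obtain xs where xs: "(\<Sum>i\<leftarrow>xs. single i 1) = w" using list_with_content by blast
  have "(\<Sum>i\<leftarrow>rev (sort xs). single i 1) = w"
    unfolding xs[symmetric] by (rule poly_mapping_eqI) (simp add: lookup_list_content)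
  then show "\<exists>xs. sorted (rev xs) \<and> (\<Sum>i\<leftarrow>xs. single i 1) = w"
    by (intro exI[of _ "rev (sort xs)"]) simp
next
  fix xs ys :: "nat list"
  assume xs: "sorted (rev xs) \<and> (\<Sum>i\<leftarrow>xs. single i 1) = w" and ys: "sorted (rev ys) \<and> (\<Sum>i\<leftarrow>ys. single i 1) = w"
  have "mset xs = mset ys"
    using xs ys by (intro multiset_eqI) (metis lookup_list_content)
  then have "sort (rev xs) = rev ys" using ys by (intro properties_for_sort) simp_all
  moreover have "sort (rev xs) = rev xs" using xs by (simp add: sorted_sort_id)
  ultimately show "xs = ys" by simp
qed

definition decreasing_list :: "(nat \<Rightarrow>\<^sub>0 nat) \<Rightarrow> nat list" where
  "decreasing_list w = (THE xs. sorted (rev xs) \<and> (\<Sum>i\<leftarrow>xs. single i 1) = w)"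

lemma decreasing_list: "sorted (rev (decreasing_list w))" "(\<Sum>i\<leftarrow>decreasing_list w. single i 1) = w"
  using theI'[OF decreasing_list_unique[of w]] by (simp_all add: decreasing_list_def)

lemma decreasing_list_eqI: "sorted (rev xs) \<Longrightarrow> (\<Sum>i\<leftarrow>xs. single i 1) = w \<Longrightarrow> decreasing_list w = xs"
  using decreasing_list_unique[of w] decreasing_list[of w] by blast

lemma length_decreasing_list: "length (decreasing_list w) = total_degree w"
  using total_degree_list_content[of "decreasing_list w"] by (simp add: decreasing_list(2))

definition colour :: "(nat \<Rightarrow>\<^sub>0 nat) \<Rightarrow> nat \<Rightarrow> nat" where
  "colour w i = decreasing_list w ! (i - 1)"

lemma colour_decreasing: "decreasing_on {1..total_degree w} (colour w)"
  using decreasing_list(1)[of w]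
  by (auto simp: decreasing_on_def colour_def sorted_rev_iff_nth_mono length_decreasing_list)

lemma sum_list_shift: "(\<Sum>i\<leftarrow>xs. f i) = (\<Sum>i\<in>{1..length xs}. f (xs ! (i - 1)))" for f :: "nat \<Rightarrow> 'a::comm_monoid_add"
proof -
  have "(\<Sum>i\<leftarrow>xs. f i) = (\<Sum>i<length xs. f (xs ! i))"
    by (simp add: sum_list_sum_nth atLeast0LessThan)
  also have "\<dots> = (\<Sum>i\<in>{1..length xs}. f (xs ! (i - 1)))"
    by (rule sum.reindex_bij_witness[where i = "\<lambda>i. i - 1" and j = Suc]) auto
  finally show ?thesis .
qed

lemma content_colour: "content {1..total_degree w} (colour w) = w"
  using decreasing_list(2)[of w]
  by (simp add: sum_list_shift length_decreasing_list content_def colour_def)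

lemma colour_content:
  assumes "decreasing_on {1..n} s" "i \<in> {1..n}"
  shows "colour (content {1..n} s) i = s i"
proof -
  let ?xs = "map (\<lambda>i. s (i + 1)) [0..<n]"
  have "decreasing_list (content {1..n} s) = ?xs"
  proof (rule decreasing_list_eqI)
    show "sorted (rev ?xs)"
      using assms(1) by (auto simp: sorted_rev_iff_nth_mono decreasing_on_def)
    have "(\<Sum>i\<leftarrow>?xs. single i 1) = (\<Sum>i\<in>{1..n}. single (?xs ! (i - 1)) (1::nat))"
      using sum_list_shift[of "\<lambda>i. single i (1::nat)" ?xs] by simp
    also have "\<dots> = content {1..n} s" unfolding content_def by (intro sum.cong) auto
    finally show "(\<Sum>i\<leftarrow>?xs. single i 1) = content {1..n} s" .
  qed
  then show ?thesis using assms(2) by (auto simp: colour_def)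
qed

text \<open>
  Only the decreasing arrangement of the indices of a monomial can be one of the sequences counted, so
  each coefficient is 0 or 1.
\<close>

lemma mcoeff_fundamental_qsym:
  assumes S: "S \<subseteq> {1..<n}"
  shows "mcoeff (fundamental_qsym S n) w =
    (if total_degree w = n \<and> (\<forall>i\<in>S. colour w (i + 1) < colour w i) then 1 else 0)"
proof -
  let ?X = "{xs \<in> fundamental_seqs S n. (\<Sum>i\<leftarrow>xs. single i 1) = w}"
  have sorted_iff: "(\<forall>j\<in>{1..<n}. xs ! j \<le> xs ! (j - 1)) \<longleftrightarrow> sorted (rev xs)" if "length xs = n" for xs :: "nat list"
  proof -
    have "sorted (rev xs) \<longleftrightarrow> (\<forall>i. Suc i < n \<longrightarrow> xs ! Suc i \<le> xs ! i)"
      using that by (simp add: sorted_rev_iff_nth_Suc)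
    also have "\<dots> \<longleftrightarrow> (\<forall>j\<in>{1..<n}. xs ! j \<le> xs ! (j - 1))"
    proof safe
      fix j assume "\<forall>i. Suc i < n \<longrightarrow> xs ! Suc i \<le> xs ! i" "j \<in> {1..<n}"
      then show "xs ! j \<le> xs ! (j - 1)" by (cases j) auto
    next
      fix i assume le: "\<forall>j\<in>{1..<n}. xs ! j \<le> xs ! (j - 1)" and "Suc i < n"
      then have "Suc i \<in> {1..<n}" by simp
      with le have "xs ! Suc i \<le> xs ! (Suc i - 1)" by (rule bspec)
      then show "xs ! Suc i \<le> xs ! i" by simp
    qed
    finally show ?thesis by simp
  qed
  have "?X = (if total_degree w = n \<and> (\<forall>i\<in>S. colour w (i + 1) < colour w i) then {decreasing_list w} else {})"
  proof -
    have "xs \<in> ?X \<longleftrightarrow> xs = decreasing_list w \<and> total_degree w = n \<and> (\<forall>i\<in>S. colour w (i + 1) < colour w i)" for xs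
    proof
      assume mem: "xs \<in> ?X"
      then have len: "length xs = n" by (simp add: fundamental_seqs_def)
      then have "sorted (rev xs)" using mem sorted_iff by (auto simp: fundamental_seqs_def)
      then have eq: "decreasing_list w = xs" using mem by (intro decreasing_list_eqI) auto
      then show "xs = decreasing_list w \<and> total_degree w = n \<and> (\<forall>i\<in>S. colour w (i + 1) < colour w i)"
        using mem len length_decreasing_list[of w] by (auto simp: fundamental_seqs_def colour_def)
    next
      assume mem: "xs = decreasing_list w \<and> total_degree w = n \<and> (\<forall>i\<in>S. colour w (i + 1) < colour w i)"
      then have "length xs = n" by (simp add: length_decreasing_list)
      then show "xs \<in> ?X"
        using mem decreasing_list[of w] sorted_iff[of xs] by (auto simp: fundamental_seqs_def colour_def)
    qed
    then show ?thesis by auto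
  qed
  then show ?thesis by (simp add: fundamental_qsym_def)
qed

definition eulerian_sum :: "nat \<Rightarrow> (nat \<Rightarrow> nat) set \<Rightarrow> (nat \<Rightarrow> complex) \<Rightarrow> complex mseries" where
  "eulerian_sum n A g = (\<Sum>\<sigma>\<in>A. mconst (g (exc_number n \<sigma>)) * fundamental_qsym (DEX n \<sigma>) n)"

abbreviation derangement_part :: "nat \<Rightarrow> (nat \<Rightarrow> complex) \<Rightarrow> complex mseries" where
  "derangement_part k \<equiv> eulerian_sum k (derangements {1..k})"

lemma mcoeff_eulerian_sum:
  assumes A: "A \<subseteq> {\<sigma>. \<sigma> permutes {1..n}}"
  shows "mcoeff (eulerian_sum n A g) w = (if total_degree w = n
    then \<Sum>\<sigma> | \<sigma> \<in> A \<and> compatible {1..n} (colour w) \<sigma>. g (card (excedances {1..n} \<sigma>)) else 0)"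
proof -
  have fin: "finite A" using A finite_subset[OF _ finite_permutations[of "{1..n}"]] by blast
  have "mcoeff (eulerian_sum n A g) w = (\<Sum>\<sigma>\<in>A. g (exc_number n \<sigma>) * mcoeff (fundamental_qsym (DEX n \<sigma>) n) w)"
    by (simp add: eulerian_sum_def mcoeff_sum)
  also have "\<dots> = (\<Sum>\<sigma>\<in>A. if total_degree w = n \<and> compatible {1..n} (colour w) \<sigma>
      then g (card (excedances {1..n} \<sigma>)) else 0)"
  proof (rule sum.cong)
    fix \<sigma> assume "\<sigma> \<in> A"
    then have \<sigma>: "\<sigma> permutes {1..n}" using A by auto
    have D: "DEX n \<sigma> \<subseteq> {1..<n}" by (auto simp: DEX_def)
    have "(\<forall>i\<in>DEX n \<sigma>. colour w (i + 1) < colour w i) \<longleftrightarrow> compatible {1..n} (colour w) \<sigma>"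
      if "total_degree w = n"
      using compatible_iff_DEX[OF \<sigma>, of "colour w"] colour_decreasing[of w] that by simp
    then show "g (exc_number n \<sigma>) * mcoeff (fundamental_qsym (DEX n \<sigma>) n) w =
      (if total_degree w = n \<and> compatible {1..n} (colour w) \<sigma> then g (card (excedances {1..n} \<sigma>)) else 0)"
      unfolding mcoeff_fundamental_qsym[OF D] exc_number_def EXC_eq_excedances[OF \<sigma>]
      by (cases "total_degree w = n") simp_all
  qed simp
  also have "\<dots> = (if total_degree w = n
    then \<Sum>\<sigma> | \<sigma> \<in> A \<and> compatible {1..n} (colour w) \<sigma>. g (card (excedances {1..n} \<sigma>)) else 0)"
    using fin by (simp add: sum.inter_filter)
  finally show ?thesis .
qed

section \<open>Invariance under order isomorphisms\<close>

definition order_iso :: "nat set \<Rightarrow> nat set \<Rightarrow> (nat \<Rightarrow> nat) \<Rightarrow> (nat \<Rightarrow> nat) \<Rightarrow> bool" where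
  "order_iso K K' \<phi> \<psi> \<longleftrightarrow> (\<forall>i\<in>K. \<phi> i \<in> K' \<and> \<psi> (\<phi> i) = i) \<and> (\<forall>j\<in>K'. \<psi> j \<in> K \<and> \<phi> (\<psi> j) = j) \<and>
     (\<forall>i\<in>K. \<forall>i'\<in>K. \<phi> i < \<phi> i' \<longleftrightarrow> i < i')"

definition conjugate :: "nat set \<Rightarrow> (nat \<Rightarrow> nat) \<Rightarrow> (nat \<Rightarrow> nat) \<Rightarrow> (nat \<Rightarrow> nat) \<Rightarrow> nat \<Rightarrow> nat" where
  "conjugate K' \<phi> \<psi> \<sigma> j = (if j \<in> K' then \<phi> (\<sigma> (\<psi> j)) else j)"

lemma order_iso_sym: "order_iso K K' \<phi> \<psi> \<Longrightarrow> order_iso K' K \<psi> \<phi>"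
  unfolding order_iso_def by metis

lemma conjugate_properties:
  assumes iso: "order_iso K K' \<phi> \<psi>" and s: "\<And>i. i \<in> K \<Longrightarrow> s' (\<phi> i) = s i"
    and \<sigma>: "\<sigma> \<in> derangements K" "compatible K s \<sigma>"
  shows "conjugate K' \<phi> \<psi> \<sigma> \<in> derangements K'" "compatible K' s' (conjugate K' \<phi> \<psi> \<sigma>)"
    "card (excedances K' (conjugate K' \<phi> \<psi> \<sigma>)) = card (excedances K \<sigma>)"
    "conjugate K \<psi> \<phi> (conjugate K' \<phi> \<psi> \<sigma>) = \<sigma>"
proof -
  have \<phi>: "\<phi> i \<in> K'" "\<psi> (\<phi> i) = i" if "i \<in> K" for i using iso that by (auto simp: order_iso_def)
  have \<psi>: "\<psi> j \<in> K" "\<phi> (\<psi> j) = j" if "j \<in> K'" for j using iso that by (auto simp: order_iso_def)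
  have less: "\<phi> i < \<phi> i' \<longleftrightarrow> i < i'" if "i \<in> K" "i' \<in> K" for i i' using iso that by (auto simp: order_iso_def)
  have perm: "\<sigma> permutes K" using \<sigma> by (simp add: derangements_def)
  have in_K: "\<sigma> i \<in> K" if "i \<in> K" for i using permutes_in_image[OF perm] that by simp
  let ?\<tau> = "conjugate K' \<phi> \<psi> \<sigma>"
  have \<tau>: "?\<tau> (\<phi> i) = \<phi> (\<sigma> i)" if "i \<in> K" for i using \<phi>[OF that] by (simp add: conjugate_def)
  have K': "K' = \<phi> ` K"
  proof (intro equalityI subsetI)
    fix j assume "j \<in> K'"
    then show "j \<in> \<phi> ` K" by (intro image_eqI[of _ _ "\<psi> j"]) (simp_all add: \<psi>)
  qed (use \<phi>(1) in blast)
  have inj: "inj_on \<phi> K" using \<phi>(2) by (metis inj_onI)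
  have "bij_betw ?\<tau> K' K'"
  proof (rule bij_betw_imageI)
    show "inj_on ?\<tau> K'"
    proof (rule inj_onI)
      fix x y assume "x \<in> K'" "y \<in> K'" and eq: "?\<tau> x = ?\<tau> y"
      then obtain i i' where i: "x = \<phi> i" "y = \<phi> i'" "i \<in> K" "i' \<in> K"
        using \<psi> by metis
      then have "\<sigma> i = \<sigma> i'" using eq inj in_K by (simp add: \<tau> inj_on_eq_iff)
      then show "x = y" using permutes_inj[OF perm] i by (simp add: inj_eq)
    qed
    have "?\<tau> ` \<phi> ` K = \<phi> ` \<sigma> ` K"
      unfolding image_image by (intro image_cong refl \<tau>)
    also have "\<sigma> ` K = K" by (rule permutes_image[OF perm])
    finally show "?\<tau> ` K' = K'" by (simp only: K'[symmetric])
  qed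
  then have "?\<tau> permutes K'" by (rule bij_imp_permutes) (simp add: conjugate_def)
  moreover have "?\<tau> j \<noteq> j" if "j \<in> K'" for j
  proof -
    obtain i where i: "j = \<phi> i" "i \<in> K" using \<open>j \<in> K'\<close> K' by blast
    have "\<sigma> i \<noteq> i" using \<sigma> i by (simp add: derangements_def)
    then show ?thesis using i inj in_K by (simp add: \<tau> inj_on_eq_iff)
  qed
  ultimately show "?\<tau> \<in> derangements K'" by (simp add: derangements_def)
  have ball: "(\<forall>j\<in>K'. P j) \<longleftrightarrow> (\<forall>i\<in>K. P (\<phi> i))" and img: "{j \<in> K'. P j} = \<phi> ` {i \<in> K. P (\<phi> i)}" for P
    using K' by auto
  show "compatible K' s' ?\<tau>"
    using \<sigma>(2) unfolding compatible_def ball by (simp add: \<tau> less in_K s)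
  have "excedances K' ?\<tau> = \<phi> ` excedances K \<sigma>"
    unfolding excedances_def img by (intro arg_cong[of _ _ "image \<phi>"] Collect_cong) (auto simp: \<tau> less in_K)
  then show "card (excedances K' ?\<tau>) = card (excedances K \<sigma>)"
    using card_image[OF inj_on_subset[OF inj, of "excedances K \<sigma>"]] by (auto simp: excedances_def)
  show "conjugate K \<psi> \<phi> ?\<tau> = \<sigma>"
  proof
    fix i show "conjugate K \<psi> \<phi> ?\<tau> i = \<sigma> i"
    proof (cases "i \<in> K")
      case True
      then show ?thesis using \<phi>(2)[OF in_K[OF True]] by (simp add: conjugate_def[of K] \<tau>)
    next
      case False
      then show ?thesis using perm by (simp add: conjugate_def permutes_not_in)
    qed
  qed
qed

lemma derangement_sum_iso:
  assumes iso: "order_iso K K' \<phi> \<psi>" and s: "\<And>i. i \<in> K \<Longrightarrow> s' (\<phi> i) = s i"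
  shows "derangement_sum g K s = derangement_sum g K' s'"
  unfolding derangement_sum_def
proof (rule sum.reindex_bij_witness[where j = "conjugate K' \<phi> \<psi>" and i = "conjugate K \<psi> \<phi>"])
  have s': "s (\<psi> j) = s' j" if "j \<in> K'" for j
    using s[of "\<psi> j"] iso that by (auto simp: order_iso_def)
  fix \<sigma> assume "\<sigma> \<in> {\<sigma>. \<sigma> \<in> derangements K \<and> compatible K s \<sigma>}"
  then have \<sigma>: "\<sigma> \<in> derangements K" "compatible K s \<sigma>" by auto
  show "conjugate K \<psi> \<phi> (conjugate K' \<phi> \<psi> \<sigma>) = \<sigma>"
    "conjugate K' \<phi> \<psi> \<sigma> \<in> {\<sigma>. \<sigma> \<in> derangements K' \<and> compatible K' s' \<sigma>}"
    "g (card (excedances K' (conjugate K' \<phi> \<psi> \<sigma>))) = g (card (excedances K \<sigma>))"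
    using conjugate_properties[where s' = s', OF iso s \<sigma>] by simp_all
next
  have s': "s (\<psi> j) = s' j" if "j \<in> K'" for j
    using s[of "\<psi> j"] iso that by (auto simp: order_iso_def)
  fix \<tau> assume "\<tau> \<in> {\<sigma>. \<sigma> \<in> derangements K' \<and> compatible K' s' \<sigma>}"
  then have \<tau>: "\<tau> \<in> derangements K'" "compatible K' s' \<tau>" by auto
  show "conjugate K' \<phi> \<psi> (conjugate K \<psi> \<phi> \<tau>) = \<tau>"
    "conjugate K \<psi> \<phi> \<tau> \<in> {\<sigma>. \<sigma> \<in> derangements K \<and> compatible K s \<sigma>}"
    using conjugate_properties[where s' = s, OF order_iso_sym[OF iso] s' \<tau>] by simp_all
qed

lemma obtain_order_iso:
  assumes "finite (K :: nat set)"
  obtains \<phi> \<psi> where "order_iso {1..card K} K \<phi> \<psi>"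
proof -
  obtain h where h: "bij_betw h {..<card K} K" "strict_mono_on {..<card K} h"
    by (rule ex_bij_betw_strict_mono_card[OF assms])
  let ?\<phi> = "\<lambda>i. h (i - 1)" and ?\<psi> = "\<lambda>j. inv_into {..<card K} h j + 1"
  have inv: "inv_into {..<card K} h j \<in> {..<card K}" "h (inv_into {..<card K} h j) = j" if "j \<in> K" for j
  proof -
    have "j \<in> h ` {..<card K}" using that bij_betw_imp_surj_on[OF h(1)] by simp
    then show "inv_into {..<card K} h j \<in> {..<card K}" "h (inv_into {..<card K} h j) = j"
      by (simp_all only: inv_into_into f_inv_into_f)
  qed
  have less: "h i < h i' \<longleftrightarrow> i < i'" if "i < card K" "i' < card K" for i i'
  proof -
    have "i < i' \<Longrightarrow> h i < h i'" "i' < i \<Longrightarrow> h i' < h i"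
      using strict_mono_onD[OF h(2), of i i'] strict_mono_onD[OF h(2), of i' i] that by simp_all
    then show ?thesis by (cases i i' rule: linorder_cases) auto
  qed
  have "order_iso {1..card K} K ?\<phi> ?\<psi>"
    unfolding order_iso_def
  proof (intro conjI ballI)
    fix i assume i: "i \<in> {1..card K}"
    then have i': "i - 1 \<in> {..<card K}" by auto
    show "h (i - 1) \<in> K" using bij_betwE[OF h(1)] i' by blast
    show "inv_into {..<card K} h (h (i - 1)) + 1 = i"
      using bij_betw_inv_into_left[OF h(1) i'] i by simp
    fix i2 assume "i2 \<in> {1..card K}"
    then show "h (i - 1) < h (i2 - 1) \<longleftrightarrow> i < i2" using i by (subst less) auto
  next
    fix j assume j: "j \<in> K"
    show "inv_into {..<card K} h j + 1 \<in> {1..card K}" using inv(1)[OF j] by auto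
    show "h (inv_into {..<card K} h j + 1 - 1) = j" using inv(2)[OF j] by simp
  qed
  then show ?thesis by (rule that)
qed

text \<open>
  The order isomorphism from \<open>{1..card K}\<close> to \<open>K\<close> carries the colouring to a decreasing one with the same
  content, and there is only one of these.
\<close>

lemma derangement_sum_standardize:
  assumes K: "finite K" and s: "decreasing_on K s"
  shows "derangement_sum g K s = derangement_sum g {1..card K} (colour (content K s))"
proof -
  obtain \<phi> \<psi> where iso: "order_iso {1..card K} K \<phi> \<psi>" using obtain_order_iso[OF K] .
  have \<phi>: "\<phi> i \<in> K" "\<psi> (\<phi> i) = i" if "i \<in> {1..card K}" for i using iso that by (auto simp: order_iso_def)
  have less: "\<phi> i < \<phi> i' \<longleftrightarrow> i < i'" if "i \<in> {1..card K}" "i' \<in> {1..card K}" for i i'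
    using iso that by (auto simp: order_iso_def)
  have "decreasing_on {1..card K} (\<lambda>i. s (\<phi> i))"
    unfolding decreasing_on_def
  proof (intro ballI impI)
    fix i j assume ij: "i \<in> {1..card K}" "j \<in> {1..card K}" "i \<le> j"
    then have "\<phi> i \<le> \<phi> j" using less[of i j] by (cases "i = j") auto
    then show "s (\<phi> j) \<le> s (\<phi> i)"
      using s \<phi>(1) ij unfolding decreasing_on_def by blast
  qed
  moreover have "content {1..card K} (\<lambda>i. s (\<phi> i)) = content K s"
    unfolding content_def
    using iso by (intro sum.reindex_bij_witness[where i = \<psi> and j = \<phi>]) (auto simp: order_iso_def)
  ultimately have "colour (content K s) i = s (\<phi> i)" if "i \<in> {1..card K}" for i
    using colour_content[of "card K" "\<lambda>i. s (\<phi> i)" i] that by simp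
  then show ?thesis by (intro derangement_sum_iso[OF iso, symmetric]) simp
qed

section \<open>Initial sets and contents\<close>

lemma exists_initial_part:
  assumes "finite S" "inj_on (f :: nat \<Rightarrow> int) S" "m \<le> card S"
  shows "\<exists>T\<subseteq>S. card T = m \<and> (\<forall>j\<in>T. \<forall>i\<in>S. f i < f j \<longrightarrow> i \<in> T)"
  using assms(3)
proof (induction m)
  case 0
  show ?case by (intro exI[of _ "{}"]) auto
next
  case (Suc m)
  then obtain T where T: "T \<subseteq> S" "card T = m" "\<forall>j\<in>T. \<forall>i\<in>S. f i < f j \<longrightarrow> i \<in> T"
    by auto
  have fin: "finite (S - T)" "finite T" using assms(1) T(1) finite_subset by auto
  have "S - T \<noteq> {}" using Suc.prems T assms(1) by (metis Diff_eq_empty_iff Suc_n_not_le_n card_mono fin(2) order_trans)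
  then obtain x where x: "x \<in> S - T" "\<forall>y\<in>S - T. f x \<le> f y"
    using fin(1) by (metis arg_min_if_finite(1,2) not_le)
  show ?case
  proof (intro exI[of _ "insert x T"] conjI ballI impI)
    fix j i assume "j \<in> insert x T" "i \<in> S" "f i < f j"
    then show "i \<in> insert x T" using x T(3) by force
  qed (use x T fin in auto)
qed

text \<open>
  In each colour class an initial set is an initial segment for the order given by \<open>f\<close>, and so it is
  determined by the number of its elements there, which is arbitrary.
\<close>

lemma initial_content_bij:
  assumes A: "finite A" and f: "inj f"
  shows "bij_betw (\<lambda>K. content K s) {K. initial f A s K \<and> card K = k}
    {b. (\<exists>a. a + b = content A s) \<and> total_degree b = k}"
proof (rule bij_betw_imageI)
  have finK: "finite K" if "initial f A s K" for K using that A finite_subset by (auto simp: initial_def)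
  show "inj_on (\<lambda>K. content K s) {K. initial f A s K \<and> card K = k}"
  proof (rule inj_onI)
    have "K \<subseteq> K'" if K: "initial f A s K" and K': "initial f A s K'" and eq: "content K s = content K' s" for K K'
    proof
      fix i assume i: "i \<in> K"
      show "i \<in> K'"
      proof (rule ccontr)
        assume n: "i \<notin> K'"
        let ?B = "\<lambda>K. {j \<in> K. s j = s i}"
        have "?B K' \<subseteq> ?B K"
        proof
          fix j assume j: "j \<in> ?B K'"
          then have "j \<noteq> i" using n by auto
          then have "f j \<noteq> f i" using f by (auto simp: inj_eq)
          moreover have "\<not> f i < f j" using K' j n i K by (auto simp: initial_def)
          ultimately have "f j < f i" by simp
          then show "j \<in> ?B K" using K K' i j by (auto simp: initial_def)
        qed
        then have "?B K' \<subset> ?B K" using i n by auto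
        then have "card (?B K') < card (?B K)" using finK[OF K] by (intro psubset_card_mono) auto
        moreover have "card (?B K') = card (?B K)"
          using eq lookup_content[OF finK[OF K], of s "s i"] lookup_content[OF finK[OF K'], of s "s i"] by simp
        ultimately show False by simp
      qed
    qed
    then show "K = K'" if "K \<in> {K. initial f A s K \<and> card K = k}" "K' \<in> {K. initial f A s K \<and> card K = k}"
      "content K s = content K' s" for K K'
      using that by (metis (no_types, lifting) mem_Collect_eq subset_antisym)
  qed
  show "(\<lambda>K. content K s) ` {K. initial f A s K \<and> card K = k} =
    {b. (\<exists>a. a + b = content A s) \<and> total_degree b = k}"
  proof (intro equalityI subsetI)
    fix b assume "b \<in> (\<lambda>K. content K s) ` {K. initial f A s K \<and> card K = k}"
    then obtain K where K: "initial f A s K" "card K = k" "b = content K s" by blast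
    have "content (A - K) s + content K s = content A s"
      unfolding content_def using K(1) A by (intro sum.subset_diff[symmetric]) (auto simp: initial_def)
    then show "b \<in> {b. (\<exists>a. a + b = content A s) \<and> total_degree b = k}" using K by auto
  next
    fix b assume "b \<in> {b. (\<exists>a. a + b = content A s) \<and> total_degree b = k}"
    then obtain a where ab: "a + b = content A s" "total_degree b = k" by blast
    have le: "lookup b v \<le> card {i \<in> A. s i = v}" for v
      using arg_cong[OF ab(1), of "\<lambda>w. lookup w v"] by (simp add: lookup_add lookup_content[OF A])
    have "\<exists>T\<subseteq>{i \<in> A. s i = v}. card T = lookup b v \<and> (\<forall>j\<in>T. \<forall>i\<in>{i \<in> A. s i = v}. f i < f j \<longrightarrow> i \<in> T)" for v
      using A le by (intro exists_initial_part) (auto intro: inj_on_subset[OF f])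
    then have "\<forall>v. \<exists>T. T \<subseteq> {i \<in> A. s i = v} \<and> card T = lookup b v \<and>
        (\<forall>j\<in>T. \<forall>i\<in>{i \<in> A. s i = v}. f i < f j \<longrightarrow> i \<in> T)" by blast
    from choice[OF this] obtain T where "\<forall>v. T v \<subseteq> {i \<in> A. s i = v} \<and> card (T v) = lookup b v \<and>
        (\<forall>j\<in>T v. \<forall>i\<in>{i \<in> A. s i = v}. f i < f j \<longrightarrow> i \<in> T v)" by (elim exE)
    then have T: "\<And>v. T v \<subseteq> {i \<in> A. s i = v}" "\<And>v. card (T v) = lookup b v"
      "\<And>j i. j \<in> T (s j) \<Longrightarrow> i \<in> A \<Longrightarrow> s i = s j \<Longrightarrow> f i < f j \<Longrightarrow> i \<in> T (s j)"
      by simp_all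
    let ?K = "{i \<in> A. i \<in> T (s i)}"
    have "initial f A s ?K" unfolding initial_def by (auto intro: T(3))
    moreover have content: "content ?K s = b"
    proof (rule poly_mapping_eqI)
      fix v
      have "{i \<in> ?K. s i = v} = T v" using T(1)[of v] by auto
      then show "lookup (content ?K s) v = lookup b v" using A T(2) by (simp add: lookup_content)
    qed
    moreover have "card ?K = k" using ab(2) content total_degree_content[of ?K s] by simp
    ultimately show "b \<in> (\<lambda>K. content K s) ` {K. initial f A s K \<and> card K = k}"
      by blast
  qed
qed

lemma decreasing_on_subset: "decreasing_on A s \<Longrightarrow> K \<subseteq> A \<Longrightarrow> decreasing_on K s"
  by (auto simp: decreasing_on_def)

text \<open>
  The coefficient of a product with a complete homogeneous function sums over all sub-contents \<open>b\<close> of \<open>w\<close>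
  of degree \<open>k\<close>; by the previous bijection these are the contents of the initial sets of size \<open>k\<close>.
\<close>

lemma sum_initial:
  assumes f: "inj f" and w: "total_degree w = n" and k: "k \<le> n"
  shows "(\<Sum>K | initial f {1..n} (colour w) K \<and> card K = k. derangement_sum g K (colour w)) =
    mcoeff (complete_homogeneous (n - k) * derangement_part k g) w"
proof -
  let ?s = "colour w"
  have dec: "decreasing_on {1..n} ?s" and cont: "content {1..n} ?s = w"
    using colour_decreasing[of w] content_colour[of w] w by simp_all
  let ?D = "\<lambda>b. derangement_sum g {1..k} (colour b)"
  let ?B = "{b. (\<exists>a. a + b = content {1..n} ?s) \<and> total_degree b = k}"
  have "(\<Sum>K | initial f {1..n} ?s K \<and> card K = k. derangement_sum g K ?s) =
      (\<Sum>K | initial f {1..n} ?s K \<and> card K = k. ?D (content K ?s))"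
  proof (rule sum.cong)
    fix K assume "K \<in> {K. initial f {1..n} ?s K \<and> card K = k}"
    then have K: "K \<subseteq> {1..n}" "card K = k" by (auto simp: initial_def)
    then show "derangement_sum g K ?s = ?D (content K ?s)"
      using derangement_sum_standardize[of K ?s g] decreasing_on_subset[OF dec] finite_subset by blast
  qed simp
  also have "\<dots> = (\<Sum>b\<in>?B. ?D b)"
    by (rule sum.reindex_bij_betw[OF initial_content_bij[OF _ f]]) simp
  also have "\<dots> = (\<Sum>p\<in>{p \<in> splittings w. total_degree (snd p) = k}. ?D (snd p))"
    by (rule sum.reindex_bij_witness[where i = snd and j = "\<lambda>b. (w - b, b)"])
      (auto simp: splittings_def cont)
  also have "\<dots> = (\<Sum>p\<in>splittings w. if total_degree (snd p) = k then ?D (snd p) else 0)"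
    by (rule sum.inter_filter) simp
  also have "\<dots> = mcoeff (complete_homogeneous (n - k) * derangement_part k g) w"
    unfolding mcoeff_mult
  proof (rule sum.cong)
    fix p assume "p \<in> splittings w"
    then obtain a b where p: "p = (a, b)" "a + b = w" by (auto simp: splittings_def)
    then have "total_degree a + total_degree b = n" using w by auto
    then have iff: "total_degree b = k \<Longrightarrow> total_degree a = n - k" by simp
    have D: "derangements {1..k} \<subseteq> {\<sigma>. \<sigma> permutes {1..k}}"
      by (auto simp: derangements_def)
    show "(if total_degree (snd p) = k then ?D (snd p) else 0) =
      (case p of (a, b) \<Rightarrow> mcoeff (complete_homogeneous (n - k)) a * mcoeff (derangement_part k g) b)"
      by (simp add: p mcoeff_complete_homogeneous mcoeff_eulerian_sum[OF D] iff derangement_sum_def)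
  qed simp
  finally show ?thesis .
qed

lemma mcoeff_product_degree:
  assumes "k \<le> n" "total_degree w \<noteq> n"
  shows "mcoeff (complete_homogeneous (n - k) * derangement_part k g) w = 0"
  unfolding mcoeff_mult
proof (rule sum.neutral, safe)
  fix a b assume "(a, b) \<in> splittings w"
  then have "total_degree a + total_degree b \<noteq> n" using assms(2) by (auto simp: splittings_def)
  then have "total_degree a \<noteq> n - k \<or> total_degree b \<noteq> k" using assms(1) by auto
  moreover have "derangements {1..k} \<subseteq> {\<sigma>. \<sigma> permutes {1..k}}"
    by (auto simp: derangements_def)
  ultimately show "mcoeff (complete_homogeneous (n - k)) a * mcoeff (derangement_part k g) b = 0"
    by (auto simp: mcoeff_complete_homogeneous mcoeff_eulerian_sum)
qed

text \<open>
  In the coefficient of \<open>w\<close>, a compatible permutation splits into its set of fixed points, whose colours give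
  the factor \<open>h\<close>, and a derangement of the rest.
\<close>

theorem eulerian_sum_fixed_points:
  assumes k: "k \<le> n"
  shows "eulerian_sum n {\<sigma>. \<sigma> permutes {1..n} \<and> fix_number n \<sigma> = n - k} g =
    complete_homogeneous (n - k) * derangement_part k g"
proof (rule mseries_eqI)
  fix w
  let ?A = "{\<sigma>. \<sigma> permutes {1..n} \<and> fix_number n \<sigma> = n - k}"
  have A: "?A \<subseteq> {\<sigma>. \<sigma> permutes {1..n}}" by auto
  show "mcoeff (eulerian_sum n ?A g) w =
      mcoeff (complete_homogeneous (n - k) * derangement_part k g) w"
  proof (cases "total_degree w = n")
    case True
    let ?s = "colour w"
    have dec: "decreasing_on {1..n} ?s" using colour_decreasing[of w] True by simp
    have "mcoeff (eulerian_sum n ?A g) w =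
        (\<Sum>\<sigma> | \<sigma> permutes {1..n} \<and> compatible {1..n} ?s \<sigma> \<and> fix_number n \<sigma> = n - k. g (card (excedances {1..n} \<sigma>)))"
      unfolding mcoeff_eulerian_sum[OF A] using True by (simp add: conj_ac)
    also have "\<dots> = (\<Sum>K | K \<subseteq> {1..n} \<and> initial int {1..n} ?s K \<and> n - card K = n - k. derangement_sum g K ?s)"
      using compatible_restrict[OF dec]
      by (intro sum_by_fixed_points[OF dec, where h = "\<lambda>K. g" and R = "\<lambda>f. f = n - k"])
        (simp_all add: excedances_extend)
    also have "{K. K \<subseteq> {1..n} \<and> initial int {1..n} ?s K \<and> n - card K = n - k} =
        {K. initial int {1..n} ?s K \<and> card K = k}"
    proof -
      have "n - card K = n - k \<longleftrightarrow> card K = k" if "K \<subseteq> {1..n}" for K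
      proof -
        have "card K \<le> n" using card_mono[OF _ that] by simp
        then show ?thesis using k by (metis diff_diff_cancel)
      qed
      then show ?thesis by (auto simp: initial_def)
    qed
    also have "(\<Sum>K\<in>{K. initial int {1..n} ?s K \<and> card K = k}. derangement_sum g K ?s) =
        mcoeff (complete_homogeneous (n - k) * derangement_part k g) w"
      by (rule sum_initial[OF _ True k]) simp
    finally show ?thesis .
  next
    case False
    then show ?thesis by (simp add: mcoeff_eulerian_sum[OF A] mcoeff_product_degree[OF k])
  qed
qed

text \<open>
  Both sides split the same sum by fixed points: on the left the sum over compatible permutations by
  excedances plus one, on the right the sum over weakly compatible permutations by weak excedances, to
  which the \<open>n - k\<close> fixed points contribute. The cyclic shift of the values identifies the two.
\<close>

theorem eulerian_sum_shift:
  assumes n: "1 \<le> n"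
  shows "(\<Sum>k\<le>n. complete_homogeneous (n - k) * derangement_part k (\<lambda>e. g (e + 1))) =
    (\<Sum>k\<le>n. complete_homogeneous (n - k) * derangement_part k (\<lambda>e. g (e + (n - k))))"
proof (rule mseries_eqI)
  fix w
  show "mcoeff (\<Sum>k\<le>n. complete_homogeneous (n - k) * derangement_part k (\<lambda>e. g (e + 1))) w =
    mcoeff (\<Sum>k\<le>n. complete_homogeneous (n - k) * derangement_part k (\<lambda>e. g (e + (n - k)))) w"
  proof (cases "total_degree w = n")
    case True
    let ?s = "colour w"
    have dec: "decreasing_on {1..n} ?s" using colour_decreasing[of w] True by simp
    have by_card: "(\<Sum>K | K \<subseteq> {1..n} \<and> initial f {1..n} ?s K. derangement_sum (h (card K)) K ?s) =
        (\<Sum>k\<le>n. mcoeff (complete_homogeneous (n - k) * derangement_part k (h k)) w)"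
      if f: "inj f" for f h
    proof -
      let ?X = "{K. K \<subseteq> {1..n} \<and> initial f {1..n} ?s K}"
      have "(\<Sum>K\<in>?X. derangement_sum (h (card K)) K ?s) =
          (\<Sum>k\<in>{..n}. \<Sum>K\<in>{K \<in> ?X. card K = k}. derangement_sum (h (card K)) K ?s)"
        using card_mono[of "{1..n}"] by (intro sum.group[symmetric]) (auto intro: finite_subset[of _ "Pow {1..n}"])
      also have "\<dots> = (\<Sum>k\<le>n. mcoeff (complete_homogeneous (n - k) * derangement_part k (h k)) w)"
      proof (rule sum.cong)
        fix k assume k: "k \<in> {..n}"
        have "{K \<in> ?X. card K = k} = {K. initial f {1..n} ?s K \<and> card K = k}"
          by (auto simp: initial_def)
        then have "(\<Sum>K\<in>{K \<in> ?X. card K = k}. derangement_sum (h (card K)) K ?s) =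
            (\<Sum>K | initial f {1..n} ?s K \<and> card K = k. derangement_sum (h k) K ?s)"
          by (intro sum.cong) auto
        also have "\<dots> = mcoeff (complete_homogeneous (n - k) * derangement_part k (h k)) w"
          using k by (intro sum_initial[OF f True]) simp
        finally show "(\<Sum>K\<in>{K \<in> ?X. card K = k}. derangement_sum (h (card K)) K ?s) =
          mcoeff (complete_homogeneous (n - k) * derangement_part k (h k)) w" .
      qed simp
      finally show ?thesis .
    qed
    have strong: "(\<Sum>\<sigma> | \<sigma> permutes {1..n} \<and> compatible {1..n} ?s \<sigma>. g (card (excedances {1..n} \<sigma>) + 1)) =
        (\<Sum>K | K \<subseteq> {1..n} \<and> initial int {1..n} ?s K. derangement_sum (\<lambda>e. g (e + 1)) K ?s)"
      using compatible_restrict[OF dec]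
        sum_by_fixed_points[OF dec, where C = "compatible {1..n} ?s" and P = "initial int {1..n} ?s"
          and g = "\<lambda>\<sigma>. g (card (excedances {1..n} \<sigma>) + 1)" and h = "\<lambda>K e. g (e + 1)" and R = "\<lambda>_. True"]
      by (simp add: excedances_extend)
    have weak: "(\<Sum>\<sigma> | \<sigma> permutes {1..n} \<and> weakly_compatible {1..n} ?s \<sigma>. g (card (weak_excedances {1..n} \<sigma>))) =
        (\<Sum>K | K \<subseteq> {1..n} \<and> initial (\<lambda>i. - int i) {1..n} ?s K. derangement_sum (\<lambda>e. g (e + (n - card K))) K ?s)"
      using weakly_compatible_restrict[OF dec]
        sum_by_fixed_points[OF dec, where C = "weakly_compatible {1..n} ?s" and P = "initial (\<lambda>i. - int i) {1..n} ?s"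
          and g = "\<lambda>\<sigma>. g (card (weak_excedances {1..n} \<sigma>))" and h = "\<lambda>K e. g (e + (n - card K))" and R = "\<lambda>_. True"]
      by (simp add: excedances_extend)
    have inj: "inj int" "inj (\<lambda>i. - int i)" by (auto intro: injI)
    show ?thesis
      using strong weak sum_compatible_shift[OF n, of g ?s]
        by_card[OF inj(1), of "\<lambda>k e. g (e + 1)"] by_card[OF inj(2), of "\<lambda>k e. g (e + (n - k))"]
      by (simp add: mcoeff_sum)
  next
    case False
    then show ?thesis by (simp add: mcoeff_sum mcoeff_product_degree)
  qed
qed

section \<open>The two expressions for the Frobenius series\<close>

definition eulerian_series :: "nat \<Rightarrow> (nat \<Rightarrow> nat) set \<Rightarrow> (nat \<Rightarrow> nat) \<Rightarrow> complex mseries fps" where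
  "eulerian_series n A \<phi> =
     (\<Sum>\<sigma>\<in>A. fps_const (fundamental_qsym (DEX n \<sigma>) n) * fps_X ^ \<phi> (exc_number n \<sigma>))"

lemma eulerian_series_nth:
  "fps_nth (eulerian_series n A \<phi>) e = eulerian_sum n A (\<lambda>x. if \<phi> x = e then 1 else 0)"
  unfolding eulerian_series_def eulerian_sum_def fps_sum_nth by (intro sum.cong) auto

lemma eulerian_series_add: "eulerian_series n A (\<lambda>e. \<phi> e + c) = eulerian_series n A \<phi> * fps_X ^ c"
  by (simp only: eulerian_series_def power_add sum_distrib_right mult.assoc)

lemma Q_eulerian_eq: "Q_eulerian n = eulerian_series n {\<sigma>. \<sigma> permutes {1..n}} (\<lambda>e. e)"
  by (simp add: Q_eulerian_def eulerian_series_def)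

lemma Q0_eulerian_eq: "Q0_eulerian n = eulerian_series n (derangements {1..n}) (\<lambda>e. e)"
  by (simp add: Q0_eulerian_def eulerian_series_def derangements_def)

lemma eulerian_series_fixed_points:
  assumes "k \<le> n"
  shows "eulerian_series n {\<sigma>. \<sigma> permutes {1..n} \<and> fix_number n \<sigma> = n - k} \<phi> =
    h_series (n - k) * eulerian_series k (derangements {1..k}) \<phi>"
  by (rule fps_ext) (simp add: eulerian_series_nth eulerian_sum_fixed_points[OF assms])

lemma fix_number_le: "fix_number n \<sigma> \<le> n"
proof -
  have "card {i \<in> {1..n}. \<sigma> i = i} \<le> card {1..n}" by (rule card_mono) auto
  then show ?thesis by (simp add: fix_number_def)
qed

lemma eulerian_series_many_fixed_points:
  assumes "j \<le> n"
  shows "eulerian_series n {\<sigma>. \<sigma> permutes {1..n} \<and> fix_number n \<sigma> \<ge> n - j} \<phi> =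
    (\<Sum>k\<le>j. h_series (n - k) * eulerian_series k (derangements {1..k}) \<phi>)"
proof -
  let ?A = "{\<sigma>. \<sigma> permutes {1..n} \<and> fix_number n \<sigma> \<ge> n - j}"
  let ?t = "\<lambda>\<sigma>. fps_const (fundamental_qsym (DEX n \<sigma>) n) * fps_X ^ \<phi> (exc_number n \<sigma>)"
  have fin: "finite ?A" by (rule finite_subset[OF _ finite_permutations[of "{1..n}"]]) auto
  have "eulerian_series n ?A \<phi> = (\<Sum>k\<in>{..j}. \<Sum>\<sigma>\<in>{\<sigma> \<in> ?A. n - fix_number n \<sigma> = k}. ?t \<sigma>)"
    unfolding eulerian_series_def by (rule sum.group[symmetric]) (use fin in auto)
  also have "\<dots> = (\<Sum>k\<le>j. h_series (n - k) * eulerian_series k (derangements {1..k}) \<phi>)"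
  proof (rule sum.cong)
    fix k assume k: "k \<in> {..j}"
    have "n - fix_number n \<sigma> = k \<longleftrightarrow> fix_number n \<sigma> = n - k" for \<sigma>
      using fix_number_le[of n \<sigma>] k assms by auto
    then have "{\<sigma> \<in> ?A. n - fix_number n \<sigma> = k} = {\<sigma>. \<sigma> permutes {1..n} \<and> fix_number n \<sigma> = n - k}"
      using k by auto
    then show "(\<Sum>\<sigma>\<in>{\<sigma> \<in> ?A. n - fix_number n \<sigma> = k}. ?t \<sigma>) =
        h_series (n - k) * eulerian_series k (derangements {1..k}) \<phi>"
      using eulerian_series_fixed_points[of k n \<phi>] k assms by (simp add: eulerian_series_def)
  qed simp
  finally show ?thesis .
qed

lemma Q_eulerian_expand: "Q_eulerian n = (\<Sum>k\<le>n. h_series (n - k) * Q0_eulerian k)"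
  using eulerian_series_many_fixed_points[of n n "\<lambda>e. e"] by (simp add: Q_eulerian_eq Q0_eulerian_eq)

lemma Q0_eulerian_shift:
  assumes "1 \<le> n"
  shows "(\<Sum>k\<le>n. h_series (n - k) * Q0_eulerian k * fps_X) =
    (\<Sum>k\<le>n. h_series (n - k) * Q0_eulerian k * fps_X ^ (n - k))"
proof -
  have "(\<Sum>k\<le>n. h_series (n - k) * eulerian_series k (derangements {1..k}) (\<lambda>e. e + 1)) =
      (\<Sum>k\<le>n. h_series (n - k) * eulerian_series k (derangements {1..k}) (\<lambda>e. e + (n - k)))"
    by (rule fps_ext)
      (simp add: fps_sum_nth eulerian_series_nth eulerian_sum_shift[OF assms, of "\<lambda>x. if x = _ then 1 else 0"])
  then show ?thesis
    unfolding eulerian_series_add by (simp add: Q0_eulerian_eq mult.assoc)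
qed

lemma fps_one_minus_X_cancel:
  fixes A B :: "'a::comm_ring_1 fps"
  assumes "A * (1 - fps_X) = B * (1 - fps_X)"
  shows "A = B"
proof (rule fps_ext)
  fix e
  have step: "fps_nth A e - (if e = 0 then 0 else fps_nth A (e - 1)) =
      fps_nth B e - (if e = 0 then 0 else fps_nth B (e - 1))" for e
    using arg_cong[OF assms, of "\<lambda>f. fps_nth f e"] by (simp add: algebra_simps)
  show "fps_nth A e = fps_nth B e"
  proof (induction e)
    case 0
    then show ?case using step[of 0] by simp
  next
    case (Suc e)
    then show ?case using step[of "Suc e"] by simp
  qed
qed

lemma geometric_times: "(\<Sum>a=1..<m. fps_X ^ a) * (1 - fps_X) = fps_X - (fps_X ^ m :: 'a::comm_ring_1 fps)"
  if "1 \<le> m"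
  using that
proof (induction m rule: dec_induct)
  case (step m)
  have "(\<Sum>a=1..<Suc m. fps_X ^ a) * (1 - fps_X :: 'a fps) = (\<Sum>a=1..<m. fps_X ^ a) * (1 - fps_X) + fps_X ^ m * (1 - fps_X)"
    using step.hyps by (simp add: sum.atLeastLessThan_Suc distrib_right)
  also have "\<dots> = fps_X - fps_X ^ m + fps_X ^ m * (1 - fps_X)" by (simp only: step.IH)
  also have "\<dots> = fps_X - fps_X ^ Suc m" by (simp add: algebra_simps)
  finally show ?case .
qed simp

text \<open>
  The shift identity determines \<open>Q0_eulerian n\<close> up to the factor \<open>1 - t\<close> from the earlier ones, and dividing by
  this factor turns \<open>t - t ^ m\<close> into \<open>t + \<dots> + t ^ (m - 1)\<close>, the factor in the recursion for nested
  monomials.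
\<close>

theorem Q0_eulerian_eq_nested_frobenius: "Q0_eulerian n = nested_frobenius n"
proof (induction n rule: less_induct)
  case (less n)
  show ?case
  proof (cases "n = 0")
    case True
    then show ?thesis by (simp add: Q0_eulerian_0 nested_frobenius.simps)
  next
    case False
    let ?G = "\<lambda>k. h_series (n - k) * Q0_eulerian k"
    have "(\<Sum>k<n. ?G k * fps_X) + Q0_eulerian n * fps_X = (\<Sum>k<n. ?G k * fps_X ^ (n - k)) + Q0_eulerian n"
      using Q0_eulerian_shift[of n] False by (simp add: lessThan_Suc_atMost[symmetric])
    then have "Q0_eulerian n * (1 - fps_X) = (\<Sum>k<n. ?G k * fps_X) - (\<Sum>k<n. ?G k * fps_X ^ (n - k))"
      by (simp add: algebra_simps)
    also have "\<dots> = (\<Sum>k<n. ?G k * (fps_X - fps_X ^ (n - k)))"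
      by (simp add: right_diff_distrib sum_subtractf)
    also have "\<dots> = (\<Sum>k<n. nested_frobenius k * h_series (n - k) *
        (\<Sum>a=1..<n - k. fps_X ^ a) * (1 - fps_X))"
      using less by (intro sum.cong refl) (simp add: mult.assoc geometric_times mult.left_commute)
    also have "\<dots> = nested_frobenius n * (1 - fps_X)"
      using False by (simp add: nested_frobenius.simps[of n] sum_distrib_right)
    finally show ?thesis by (rule fps_one_minus_X_cancel)
  qed
qed

text \<open>
  The centre of symmetry \<open>d / 2\<close> is prescribed, rather than read off from the degree, so that sums preserve
  the property.
\<close>

definition palindromic :: "nat \<Rightarrow> 'a::comm_ring_1 fps \<Rightarrow> bool" where
  "palindromic d p \<longleftrightarrow> (\<forall>i>d. fps_nth p i = 0) \<and> (\<forall>i\<le>d. fps_nth p (d - i) = fps_nth p i)"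

lemma palindromic_zero: "palindromic d p \<Longrightarrow> d < i \<Longrightarrow> fps_nth p i = 0"
  and palindromic_flip: "palindromic d p \<Longrightarrow> i \<le> d \<Longrightarrow> fps_nth p (d - i) = fps_nth p i"
  by (simp_all add: palindromic_def)

lemma palindromic_sum: "(\<And>x. x \<in> A \<Longrightarrow> palindromic d (f x)) \<Longrightarrow> palindromic d (\<Sum>x\<in>A. f x)"
  by (auto simp: palindromic_def fps_sum_nth)

lemma palindromic_const_mult: "palindromic d p \<Longrightarrow> palindromic d (fps_const c * p)"
  by (auto simp: palindromic_def)

lemma palindromic_mult:
  assumes p: "palindromic d p" and q: "palindromic d' q"
  shows "palindromic (d + d') (p * q)"
proof -
  \<comment> \<open>Coefficients vanish outside the two degree ranges, so the convolution sums can be taken over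
    all pairs in a fixed box, on which reversal acts.\<close>
  have conv: "fps_nth (p * q) i = (\<Sum>(a, b)\<in>{(a, b). a \<le> d \<and> b \<le> d' \<and> a + b = i}. fps_nth p a * fps_nth q b)" for i
  proof -
    have "fps_nth (p * q) i = (\<Sum>(a, b)\<in>{(a, b). a + b = i}. fps_nth p a * fps_nth q b)"
      unfolding fps_mult_nth
      by (rule sum.reindex_bij_witness[where i = fst and j = "\<lambda>a. (a, i - a)"]) auto
    also have "\<dots> = (\<Sum>(a, b)\<in>{(a, b). a \<le> d \<and> b \<le> d' \<and> a + b = i}. fps_nth p a * fps_nth q b)"
    proof (rule sum.mono_neutral_right)
      show "finite {(a, b). a + b = i}"
        by (rule finite_subset[of _ "{..i} \<times> {..i}"]) auto
      have zero: "fps_nth p a * fps_nth q b = 0" if "\<not> (a \<le> d \<and> b \<le> d')" for a b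
        using that palindromic_zero[OF p, of a] palindromic_zero[OF q, of b] by (auto simp: not_le)
      show "\<forall>x\<in>{(a, b). a + b = i} - {(a, b). a \<le> d \<and> b \<le> d' \<and> a + b = i}.
          (case x of (a, b) \<Rightarrow> fps_nth p a * fps_nth q b) = 0"
      proof
        fix x assume x: "x \<in> {(a, b). a + b = i} - {(a, b). a \<le> d \<and> b \<le> d' \<and> a + b = i}"
        obtain a b where "x = (a, b)" by (cases x)
        then show "(case x of (a, b) \<Rightarrow> fps_nth p a * fps_nth q b) = 0"
          using x zero[of a b] by auto
      qed
    qed auto
    finally show ?thesis .
  qed
  show ?thesis
    unfolding palindromic_def
  proof (intro conjI allI impI)
    fix i assume "d + d' < i"
    then have empty: "{(a, b). a \<le> d \<and> b \<le> d' \<and> a + b = i} = {}" by auto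
    show "fps_nth (p * q) i = 0" unfolding conv empty by simp
  next
    fix i assume "i \<le> d + d'"
    then show "fps_nth (p * q) (d + d' - i) = fps_nth (p * q) i"
      unfolding conv
      by (intro sum.reindex_bij_witness[where i = "\<lambda>(a, b). (d - a, d' - b)" and j = "\<lambda>(a, b). (d - a, d' - b)"])
        (use palindromic_flip[OF p] palindromic_flip[OF q] in auto)
  qed
qed

lemma palindromic_geometric: "palindromic m (\<Sum>a=1..<m. fps_X ^ a)"
proof -
  have "fps_nth (\<Sum>a=1..<m. fps_X ^ a :: 'a fps) i = (if 1 \<le> i \<and> i < m then 1 else 0)" for i
    by (simp add: fps_sum_nth)
  then show ?thesis by (auto simp: palindromic_def)
qed

lemma palindromic_nested_frobenius: "palindromic k (nested_frobenius k)"
proof (induction k rule: less_induct)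
  case (less k)
  show ?case
  proof (cases "k = 0")
    case True
    then show ?thesis by (simp add: nested_frobenius.simps palindromic_def)
  next
    case False
    have "palindromic k (nested_frobenius j * h_series (k - j) * (\<Sum>a=1..<k - j. fps_X ^ a))"
      if "j < k" for j
    proof -
      have "palindromic (j + (k - j)) (nested_frobenius j * (h_series (k - j) * (\<Sum>a=1..<k - j. fps_X ^ a)))"
        by (intro palindromic_mult palindromic_const_mult palindromic_geometric less that)
      then show ?thesis using that by (simp add: mult.assoc)
    qed
    then show ?thesis
      using False by (subst nested_frobenius.simps) (auto intro!: palindromic_sum)
  qed
qed

lemma exc_number_le: "exc_number k \<sigma> \<le> k"
proof -
  have "card {i \<in> {1..<k}. i < \<sigma> i} \<le> card {1..k}" by (rule card_mono) auto
  then show ?thesis by (simp add: exc_number_def EXC_def)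
qed

text \<open>
  The recursion for nested monomials has palindromic factors, so that replacing the number of excedances
  by its difference from \<open>k\<close> does not change \<open>Q0_eulerian k\<close>.
\<close>

lemma Q0_eulerian_reverse:
  assumes j: "k \<le> j"
  shows "eulerian_series k (derangements {1..k}) (\<lambda>e. j - e) = fps_X ^ (j - k) * Q0_eulerian k"
proof (rule fps_ext)
  fix i
  have pal: "palindromic k (Q0_eulerian k)"
    using palindromic_nested_frobenius[of k] by (simp add: Q0_eulerian_eq_nested_frobenius)
  have nth: "fps_nth (Q0_eulerian k) e = eulerian_sum k (derangements {1..k}) (\<lambda>x. if x = e then 1 else 0)" for e
    by (simp add: Q0_eulerian_eq eulerian_series_nth)
  have "fps_nth (eulerian_series k (derangements {1..k}) (\<lambda>e. j - e)) i =
      (if i \<le> j then fps_nth (Q0_eulerian k) (j - i) else 0)"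
  proof -
    have "(j - exc_number k \<sigma> = i) \<longleftrightarrow> i \<le> j \<and> exc_number k \<sigma> = j - i" if "\<sigma> \<in> derangements {1..k}" for \<sigma>
      using exc_number_le[of k \<sigma>] that j by (auto simp: derangements_def)
    then show ?thesis
      unfolding eulerian_series_nth nth eulerian_sum_def by (cases "i \<le> j") (auto intro!: sum.cong sum.neutral)
  qed
  also have "\<dots> = fps_nth (fps_X ^ (j - k) * Q0_eulerian k) i"
  proof (cases "i < j - k")
    case True
    then show ?thesis using palindromic_zero[OF pal, of "j - i"] by (simp add: fps_X_power_mult_nth)
  next
    case False
    show ?thesis
    proof (cases "i \<le> j")
      case True
      then have "i - (j - k) \<le> k" "k - (i - (j - k)) = j - i" using False j by auto
      then show ?thesis using palindromic_flip[OF pal, of "i - (j - k)"] True False by (simp add: fps_X_power_mult_nth)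
    next
      case False
      then show ?thesis using palindromic_zero[OF pal, of "i - (j - k)"] j by (simp add: fps_X_power_mult_nth)
    qed
  qed
  finally show "fps_nth (eulerian_series k (derangements {1..k}) (\<lambda>e. j - e)) i =
    fps_nth (fps_X ^ (j - k) * Q0_eulerian k) i" .
qed

text \<open>
  Lowering \<open>r\<close> by one removes the top power of \<open>t\<close> from each geometric sum; the induction starts from the
  case \<open>r = n\<close>, given by \<open>top\<close>.
\<close>

lemma truncated_sums:
  fixes G :: "nat \<Rightarrow> complex mseries fps"
  assumes "r \<le> n" and top: "(\<Sum>j<n. G j * (\<Sum>a<n - j. fps_X ^ a)) = Q"
  shows "(\<Sum>j<r. G j * (\<Sum>a<r - j. fps_X ^ a)) = Q - (\<Sum>j=r..<n. \<Sum>k\<le>j. G k * fps_X ^ (j - k))"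
  using assms(1)
proof (induction r rule: inc_induct)
  case base
  then show ?case using top by simp
next
  case (step r)
  have "(\<Sum>j<Suc r. G j * (\<Sum>a<Suc r - j. fps_X ^ a)) =
      (\<Sum>j<Suc r. G j * (\<Sum>a<r - j. fps_X ^ a) + G j * fps_X ^ (r - j))"
    by (intro sum.cong refl) (auto simp: Suc_diff_le distrib_left)
  also have "\<dots> = (\<Sum>j<r. G j * (\<Sum>a<r - j. fps_X ^ a)) + (\<Sum>k\<le>r. G k * fps_X ^ (r - k))"
    by (simp add: sum.distrib lessThan_Suc_atMost[symmetric])
  finally have "(\<Sum>j<r. G j * (\<Sum>a<r - j. fps_X ^ a)) =
      (\<Sum>j<Suc r. G j * (\<Sum>a<Suc r - j. fps_X ^ a)) - (\<Sum>k\<le>r. G k * fps_X ^ (r - k))"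
    by (simp only: add_diff_cancel_right')
  also have "\<dots> = Q - (\<Sum>j=Suc r..<n. \<Sum>k\<le>j. G k * fps_X ^ (j - k)) - (\<Sum>k\<le>r. G k * fps_X ^ (r - k))"
    by (simp only: step.IH)
  also have "\<dots> = Q - ((\<Sum>k\<le>r. G k * fps_X ^ (r - k)) + (\<Sum>j=Suc r..<n. \<Sum>k\<le>j. G k * fps_X ^ (j - k)))"
    by (simp only: diff_diff_add add.commute)
  also have "(\<Sum>k\<le>r. G k * fps_X ^ (r - k)) + (\<Sum>j=Suc r..<n. \<Sum>k\<le>j. G k * fps_X ^ (j - k)) =
      (\<Sum>j=r..<n. \<Sum>k\<le>j. G k * fps_X ^ (j - k))"
    using step.hyps by (simp only: sum.atLeast_Suc_lessThan[of r n])
  finally show ?case .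
qed

theorem theorem1p6:
  fixes r n :: nat
  assumes "1 \<le> r" and "r \<le> n"
  shows "graded_frobenius n (chow_piece {1..n} (uniform_flats r n)) chow_action =
           (\<Sum>j = 0..r - 1. fps_const (complete_homogeneous (n - j)) * Q0_eulerian j *
              (\<Sum>k = 0..r - j - 1. fps_X ^ k)) \<and>
         graded_frobenius n (chow_piece {1..n} (uniform_flats r n)) chow_action =
           Q_eulerian n -
             (\<Sum>j = r..n - 1. \<Sum>\<sigma> | \<sigma> permutes {1..n} \<and> fix_number n \<sigma> \<ge> n - j.
                fps_const (fundamental_qsym (DEX n \<sigma>) n) * fps_X ^ (j - exc_number n \<sigma>))"
proof -
  interpret uniform r n using assms by unfold_locales
  let ?F = "graded_frobenius n (chow_piece {1..n} (uniform_flats r n)) chow_action"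
  let ?G = "\<lambda>k. h_series (n - k) * Q0_eulerian k"
  have F: "?F = (\<Sum>j<r. ?G j * (\<Sum>a<r - j. fps_X ^ a))"
    unfolding graded_frobenius_chow by (simp add: Q0_eulerian_eq_nested_frobenius mult_ac)
  have "?F = (\<Sum>j = 0..r - 1. ?G j * (\<Sum>k = 0..r - j - 1. fps_X ^ k))"
    unfolding F
  proof (rule sum.cong)
    show "{..<r} = {0..r - 1}" using assms by auto
    fix j assume "j \<in> {0..r - 1}"
    then have "{..<r - j} = {0..r - j - 1}" using assms by auto
    then show "?G j * (\<Sum>a<r - j. fps_X ^ a) = ?G j * (\<Sum>k = 0..r - j - 1. fps_X ^ k)"
      by (simp only:)
  qed
  moreover have "?F = Q_eulerian n - (\<Sum>j = r..n - 1. \<Sum>\<sigma> | \<sigma> permutes {1..n} \<and> fix_number n \<sigma> \<ge> n - j.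
      fps_const (fundamental_qsym (DEX n \<sigma>) n) * fps_X ^ (j - exc_number n \<sigma>))"
  proof -
    have "(\<Sum>j<n. ?G j * (\<Sum>a<n - j. fps_X ^ a)) = (\<Sum>j<n. ?G j * (1 + (\<Sum>a=1..<n - j. fps_X ^ a)))"
    proof (rule sum.cong)
      fix j assume "j \<in> {..<n}"
      then have "{..<n - j} = insert 0 {1..<n - j}" by auto
      then show "?G j * (\<Sum>a<n - j. fps_X ^ a) = ?G j * (1 + (\<Sum>a=1..<n - j. fps_X ^ a))"
        by simp
    qed simp
    also have "\<dots> = (\<Sum>j<n. ?G j) + nested_frobenius n"
      using assms by (simp add: distrib_left sum.distrib nested_frobenius.simps[of n]
          Q0_eulerian_eq_nested_frobenius mult_ac)
    also have "\<dots> = Q_eulerian n"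
      by (simp add: Q_eulerian_expand lessThan_Suc_atMost[symmetric] Q0_eulerian_eq_nested_frobenius)
    finally have top: "(\<Sum>j<n. ?G j * (\<Sum>a<n - j. fps_X ^ a)) = Q_eulerian n" .
    have "(\<Sum>j=r..<n. \<Sum>k\<le>j. ?G k * fps_X ^ (j - k)) =
        (\<Sum>j = r..n - 1. \<Sum>\<sigma> | \<sigma> permutes {1..n} \<and> fix_number n \<sigma> \<ge> n - j.
           fps_const (fundamental_qsym (DEX n \<sigma>) n) * fps_X ^ (j - exc_number n \<sigma>))"
    proof (rule sum.cong)
      show "{r..<n} = {r..n - 1}" using assms by auto
      fix j assume "j \<in> {r..n - 1}"
      then have "j \<le> n" by auto
      then show "(\<Sum>k\<le>j. ?G k * fps_X ^ (j - k)) =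
          (\<Sum>\<sigma> | \<sigma> permutes {1..n} \<and> fix_number n \<sigma> \<ge> n - j.
             fps_const (fundamental_qsym (DEX n \<sigma>) n) * fps_X ^ (j - exc_number n \<sigma>))"
        using eulerian_series_many_fixed_points[of j n "\<lambda>e. j - e"]
        by (simp add: eulerian_series_def[of n] Q0_eulerian_reverse mult_ac)
    qed
    then show ?thesis unfolding F using truncated_sums[OF assms(2) top] by simp
  qed
  ultimately show ?thesis by blast
qed

end
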